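(* Let $G$ be a compact Lie group with Lie algebra $\mathfrak{g}$, a bi-invariant Riemannian metric, and complexification $G_{\mathbb{C}}=G\cdot\exp(i\mathfrak{g})$, and let $S$ be a complex-valued action on $G^N$ that extends to a holomorphic function on $G_{\mathbb{C}}^N$, with notation as in the context. Suppose there exists a bounded, simply connected domain $\Omega_I\subset[\exp(i\mathfrak{g})]^N$ such that for $\Omega=G^N\cdot\Omega_I\subset G_{\mathbb{C}}^N$, $$\langle Z(\{U\}),n(\{U\})\rangle_{\{U\}}\le0,\qquad\forall\{U\}\in\partial\Omega,$$ where $n$ denotes the outer unit normal of $\Omega$, and $Z(\{U\})$ is the velocity field $$Z(\{U\})=\bigoplus_{x,\mu}\sum_{a=1}^m(dR_{U_{x,\mu}})_e\Big(K^a_{x,\mu}(\{U\})X^a+J^a_{x,\mu}(\{U\})Y^a\Big).$$ Then $S$ is a constant everywhere.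
   Context: Lattice: $\mathcal{X}=(\mathbb{Z}/N_0\mathbb{Z})\times\cdots\times(\mathbb{Z}/N_d\mathbb{Z})$ and $N=(d+1)N_0N_1\cdots N_d$. A field $\{U\}$ is a collection of link variables $U_{x,\mu}$, $x\in\mathcal{X}$, $\mu=0,\dots,d$; $\{U\}\in G^N$ (resp. $G_{\mathbb{C}}^N$) if all $U_{x,\mu}\in G$ (resp. $G_{\mathbb{C}}$). Group: $G$ has identity $e$ and bi-invariant metric $\langle\cdot,\cdot\rangle_g$; $\{X^1,\dots,X^m\}$ is an orthonormal basis of $\mathfrak{g}$ for $\langle\cdot,\cdot\rangle_e$ and $Y^a=iX^a$. $G_{\mathbb{C}}=G\cdot\exp(i\mathfrak{g})$ has Lie algebra $\mathfrak{g}\oplus i\mathfrak{g}$; every $U\in G_{\mathbb{C}}$ is uniquely $VW$ with $V\in G$, $W\in\exp(i\mathfrak{g})$. The product $G^N\cdot\Omega_I$ is the set of fields with components $V_{x,\mu}W_{x,\mu}$, $\{V\}\in G^N$, $\{W\}\in\Omega_I$. $R_g:h\mapsto hg$ is right translation and $(dR_h)_g$ its differential at $g$. The metric on $G_{\mathbb{C}}$ is $$\langle X_1+iX_1',X_2+iX_2'\rangle_e=\langle X_1,X_2\rangle_e+\langle X_1',X_2'\rangle_e\quad(X_1,X_1',X_2,X_2'\in\mathfrak{g}),$$ $$\langle Z_1,Z_2\rangle_g=\langle(dR_{g^{-1}})_g(Z_1),(dR_{g^{-1}})_g(Z_2)\rangle_e\quad(g\in G_{\mathbb{C}},\ Z_1,Z_2\in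 T_gG_{\mathbb{C}}),$$ and the metric on $G_{\mathbb{C}}^N$ is the sum of the metrics of the components. The boundary of $\Omega_I$ is implicitly regular enough for the outer unit normals to be defined. $\mathcal{L}_{X^a_{x,\mu}}$ is the Lie derivative with respect to $U_{x,\mu}$ along the right-invariant vector field generated by $X^a$; $K^a_{x,\mu}=-\mathcal{L}_{X^a_{x,\mu}}\operatorname{Re}S$ and $J^a_{x,\mu}=-\mathcal{L}_{X^a_{x,\mu}}\operatorname{Im}S$.
   Formalization: "S is a constant everywhere" is proved for connected G; for a general compact G, S is proved constant on each connected component of G_C^N, since for disconnected G (e.g. U(1)×Z/2 with S locally constant, Z = 0) the claim as stated is false. *)

theory Defs
  imports "HOL-Analysis.Analysis" "HOL-Algebra.Group"
begin

section \<open>Complex vector spaces\<close>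

text \<open>Real vector spaces with a complex structure; \<open>imult\<close> is multiplication by the imaginary unit.\<close>

class complex_space = real_vector +
  fixes imult :: "'a \<Rightarrow> 'a"
  assumes imult_add: "imult (x + y) = imult x + imult y"
    and imult_scaleR: "imult (r *\<^sub>R x) = r *\<^sub>R imult x"
    and imult_imult: "imult (imult x) = - x"

instantiation complex :: complex_space
begin
definition imult_complex :: "complex \<Rightarrow> complex" where "imult_complex z = \<i> * z"
instance by standard (simp_all add: imult_complex_def algebra_simps flip: mult.assoc)
end

instantiation vec :: (complex_space, finite) complex_space
begin
definition imult_vec :: "'a ^ 'b \<Rightarrow> 'a ^ 'b" where "imult_vec v = (\<chi> i. imult (v $ i))"
instance
  by standard (simp_all add: imult_vec_def vec_eq_iff imult_add imult_scaleR imult_imult)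
end

instantiation prod :: (complex_space, complex_space) complex_space
begin
definition imult_prod :: "'a \<times> 'b \<Rightarrow> 'a \<times> 'b" where
  "imult_prod p = (imult (fst p), imult (snd p))"
instance
  by standard (simp_all add: imult_prod_def prod_eq_iff imult_add imult_scaleR imult_imult)
end

definition holo_on :: "('a::{real_normed_vector,complex_space} \<Rightarrow> 'b::{real_normed_vector,complex_space})
    \<Rightarrow> 'a set \<Rightarrow> bool" where
  "holo_on f S \<longleftrightarrow>
     (\<forall>z\<in>S. \<exists>f'. (f has_derivative f') (at z) \<and> (\<forall>v. f' (imult v) = imult (f' v)))"


section \<open>Complex manifolds\<close>

text \<open>
  An atlas is given as a family of charts indexed by the points of the manifold: \<open>\<kappa> p\<close> is a
  pair (domain, coordinate map) whose domain contains \<open>p\<close>. The tangent space at \<open>p\<close> is the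
  model space, a tangent vector being represented by its coordinates in the chart \<open>\<kappa> p\<close>.
\<close>

type_synonym ('a, 'e) charts = "'a \<Rightarrow> 'a set \<times> ('a \<Rightarrow> 'e)"

abbreviation cdom :: "('a, 'e) charts \<Rightarrow> 'a \<Rightarrow> 'a set" where
  "cdom \<kappa> p \<equiv> fst (\<kappa> p)"

abbreviation cmap :: "('a, 'e) charts \<Rightarrow> 'a \<Rightarrow> 'a \<Rightarrow> 'e" where
  "cmap \<kappa> p \<equiv> snd (\<kappa> p)"

abbreviation cinv :: "('a, 'e) charts \<Rightarrow> 'a \<Rightarrow> 'e \<Rightarrow> 'a" where
  "cinv \<kappa> p \<equiv> inv_into (cdom \<kappa> p) (cmap \<kappa> p)"

definition complex_atlas ::
    "('a::topological_space, 'e::{real_normed_vector,complex_space}) charts \<Rightarrow> bool" where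
  "complex_atlas \<kappa> \<longleftrightarrow>
     (\<forall>p. p \<in> cdom \<kappa> p \<and> open (cdom \<kappa> p) \<and> open (cmap \<kappa> p ` cdom \<kappa> p) \<and>
          homeomorphism (cdom \<kappa> p) (cmap \<kappa> p ` cdom \<kappa> p) (cmap \<kappa> p) (cinv \<kappa> p)) \<and>
     (\<forall>p q. holo_on (cmap \<kappa> q \<circ> cinv \<kappa> p) (cmap \<kappa> p ` (cdom \<kappa> p \<inter> cdom \<kappa> q)))"

definition std_charts :: "('e, 'e) charts" where
  "std_charts p = (UNIV, id)"

definition prod_charts :: "('a, 'e) charts \<Rightarrow> ('b, 'f) charts \<Rightarrow> ('a \<times> 'b, 'e \<times> 'f) charts" where
  "prod_charts \<kappa> \<kappa>' p =
     (cdom \<kappa> (fst p) \<times> cdom \<kappa>' (snd p), map_prod (cmap \<kappa> (fst p)) (cmap \<kappa>' (snd p)))"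

definition vec_charts :: "('a, 'e) charts \<Rightarrow> ('a ^ 'l, 'e ^ 'l) charts" where
  "vec_charts \<kappa> p =
     ({q. \<forall>l. q $ l \<in> cdom \<kappa> (p $ l)}, (\<lambda>q. \<chi> l. cmap \<kappa> (p $ l) (q $ l)))"

definition holo_map :: "('a::topological_space, 'e::{real_normed_vector,complex_space}) charts
    \<Rightarrow> ('b::topological_space, 'f::{real_normed_vector,complex_space}) charts
    \<Rightarrow> ('a \<Rightarrow> 'b) \<Rightarrow> bool" where
  "holo_map \<kappa> \<kappa>' F \<longleftrightarrow> continuous_on UNIV F \<and>
     (\<forall>p q. holo_on (cmap \<kappa>' q \<circ> F \<circ> cinv \<kappa> p)
                    (cmap \<kappa> p ` (cdom \<kappa> p \<inter> F -` cdom \<kappa>' q)))"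

text \<open>The differential of \<open>F\<close> at \<open>p\<close>, from the tangent space at \<open>p\<close> to the one at \<open>F p\<close>.\<close>

definition mdiff :: "('a, 'e::real_normed_vector) charts \<Rightarrow> ('b, 'f::real_normed_vector) charts
    \<Rightarrow> ('a \<Rightarrow> 'b) \<Rightarrow> 'a \<Rightarrow> 'e \<Rightarrow> 'f" where
  "mdiff \<kappa> \<kappa>' F p =
     frechet_derivative (cmap \<kappa>' (F p) \<circ> F \<circ> cinv \<kappa> p) (at (cmap \<kappa> p p))"


section \<open>Compact Lie groups and their complexifications\<close>

definition complex_lie_group ::
    "('g::t2_space) monoid \<Rightarrow> ('g, 'e::{euclidean_space,complex_space}) charts \<Rightarrow> bool" where
  "complex_lie_group GC \<kappa> \<longleftrightarrow>
     group GC \<and> carrier GC = UNIV \<and> complex_atlas \<kappa> \<and>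
     holo_map (prod_charts \<kappa> \<kappa>) \<kappa> (\<lambda>(x, y). x \<otimes>\<^bsub>GC\<^esub> y) \<and>
     holo_map \<kappa> \<kappa> (\<lambda>x. inv\<^bsub>GC\<^esub> x)"

definition dR :: "'g monoid \<Rightarrow> ('g, 'e::real_normed_vector) charts \<Rightarrow> 'g \<Rightarrow> 'g \<Rightarrow> 'e \<Rightarrow> 'e" where
  "dR GC \<kappa> h g = mdiff \<kappa> \<kappa> (\<lambda>x. x \<otimes>\<^bsub>GC\<^esub> h) g"

definition dL :: "'g monoid \<Rightarrow> ('g, 'e::real_normed_vector) charts \<Rightarrow> 'g \<Rightarrow> 'g \<Rightarrow> 'e \<Rightarrow> 'e" where
  "dL GC \<kappa> h g = mdiff \<kappa> \<kappa> (\<lambda>x. h \<otimes>\<^bsub>GC\<^esub> x) g"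

text \<open>\<open>\<gamma>\<close> is the one-parameter subgroup with velocity \<open>X\<close> at the identity.\<close>

definition one_param :: "('g::topological_space) monoid \<Rightarrow> ('g, 'e::real_normed_vector) charts
    \<Rightarrow> 'e \<Rightarrow> (real \<Rightarrow> 'g) \<Rightarrow> bool" where
  "one_param GC \<kappa> X \<gamma> \<longleftrightarrow>
     continuous_on UNIV \<gamma> \<and> (\<forall>s t. \<gamma> (s + t) = \<gamma> s \<otimes>\<^bsub>GC\<^esub> \<gamma> t) \<and>
     ((\<lambda>t. cmap \<kappa> \<one>\<^bsub>GC\<^esub> (\<gamma> t)) has_vector_derivative X) (at 0)"

text \<open>\<open>W = exp X\<close>, the exponential map being given by its graph.\<close>

definition is_lie_exp :: "('g::topological_space) monoid \<Rightarrow> ('g, 'e::real_normed_vector) charts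
    \<Rightarrow> 'e \<Rightarrow> 'g \<Rightarrow> bool" where
  "is_lie_exp GC \<kappa> X W \<longleftrightarrow> (\<exists>\<gamma>. one_param GC \<kappa> X \<gamma> \<and> \<gamma> 1 = W)"

text \<open>The Lie algebra of a closed subgroup \<open>G\<close>, as a subset of the tangent space at the identity.\<close>

definition lie_algebra :: "('g::topological_space) monoid \<Rightarrow> ('g, 'e::real_normed_vector) charts
    \<Rightarrow> 'g set \<Rightarrow> 'e set" where
  "lie_algebra GC \<kappa> G = {X. \<exists>\<gamma>. one_param GC \<kappa> X \<gamma> \<and> range \<gamma> \<subseteq> G}"

definition exp_i :: "('g::topological_space) monoid
    \<Rightarrow> ('g, 'e::{real_normed_vector,complex_space}) charts \<Rightarrow> 'g set \<Rightarrow> 'g set" where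
  "exp_i GC \<kappa> G = {W. \<exists>X\<in>lie_algebra GC \<kappa> G. is_lie_exp GC \<kappa> (imult X) W}"

text \<open>
  \<open>GC\<close> is the complexification of the compact Lie group \<open>G\<close>. A compact subgroup of a complex
  Lie group is closed, hence an embedded real Lie subgroup, and every compact Lie group arises as
  such a \<open>G\<close> inside its complexification. In \<open>U = V exp (i X)\<close> uniqueness is required of
  \<open>(V, X)\<close> and not only of \<open>(V, exp (i X))\<close>; otherwise a circle inside an elliptic curve would
  qualify.
\<close>

definition complexification ::
    "('g::t2_space) monoid \<Rightarrow> ('g, 'e::{euclidean_space,complex_space}) charts \<Rightarrow> 'g set \<Rightarrow> bool" where
  "complexification GC \<kappa> G \<longleftrightarrow>
     complex_lie_group GC \<kappa> \<and> subgroup G GC \<and> compact G \<and>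
     (\<forall>Z. \<exists>!(X, X'). X \<in> lie_algebra GC \<kappa> G \<and> X' \<in> lie_algebra GC \<kappa> G \<and> Z = X + imult X') \<and>
     (\<forall>U. \<exists>!(V, X). V \<in> G \<and> X \<in> lie_algebra GC \<kappa> G \<and>
        (\<exists>W. is_lie_exp GC \<kappa> (imult X) W \<and> U = V \<otimes>\<^bsub>GC\<^esub> W))"


section \<open>Metrics\<close>

definition tangent_space :: "('g::topological_space) monoid \<Rightarrow> ('g, 'e::real_normed_vector) charts
    \<Rightarrow> 'g set \<Rightarrow> 'g \<Rightarrow> 'e set" where
  "tangent_space GC \<kappa> G V = dR GC \<kappa> V \<one>\<^bsub>GC\<^esub> ` lie_algebra GC \<kappa> G"

text \<open>\<open>m V\<close> is the inner product on the tangent space of \<open>G\<close> at \<open>V\<close>; smoothness in \<open>V\<close> is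
  automatic from the invariance.\<close>

definition bi_invariant_metric :: "('g::topological_space) monoid
    \<Rightarrow> ('g, 'e::real_normed_vector) charts \<Rightarrow> 'g set \<Rightarrow> ('g \<Rightarrow> 'e \<Rightarrow> 'e \<Rightarrow> real) \<Rightarrow> bool" where
  "bi_invariant_metric GC \<kappa> G m \<longleftrightarrow>
     (\<forall>V\<in>G. \<forall>u\<in>tangent_space GC \<kappa> G V. \<forall>v\<in>tangent_space GC \<kappa> G V.
        (\<forall>w\<in>tangent_space GC \<kappa> G V. \<forall>a b.
           m V (a *\<^sub>R u + b *\<^sub>R v) w = a * m V u w + b * m V v w) \<and>
        m V u v = m V v u \<and>
        (u \<noteq> 0 \<longrightarrow> 0 < m V u u) \<and>
        (\<forall>h\<in>G. m (V \<otimes>\<^bsub>GC\<^esub> h) (dR GC \<kappa> h V u) (dR GC \<kappa> h V v) = m V u v \<and>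
               m (h \<otimes>\<^bsub>GC\<^esub> V) (dL GC \<kappa> h V u) (dL GC \<kappa> h V v) = m V u v))"

definition re_part :: "('g::topological_space) monoid
    \<Rightarrow> ('g, 'e::{real_normed_vector,complex_space}) charts \<Rightarrow> 'g set \<Rightarrow> 'e \<Rightarrow> 'e" where
  "re_part GC \<kappa> G Z =
     (THE X. X \<in> lie_algebra GC \<kappa> G \<and> (\<exists>X'\<in>lie_algebra GC \<kappa> G. Z = X + imult X'))"

definition im_part :: "('g::topological_space) monoid
    \<Rightarrow> ('g, 'e::{real_normed_vector,complex_space}) charts \<Rightarrow> 'g set \<Rightarrow> 'e \<Rightarrow> 'e" where
  "im_part GC \<kappa> G Z =
     (THE X'. X' \<in> lie_algebra GC \<kappa> G \<and> (\<exists>X\<in>lie_algebra GC \<kappa> G. Z = X + imult X'))"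

definition metric_C :: "('g::topological_space) monoid
    \<Rightarrow> ('g, 'e::{real_normed_vector,complex_space}) charts \<Rightarrow> 'g set \<Rightarrow> ('g \<Rightarrow> 'e \<Rightarrow> 'e \<Rightarrow> real)
    \<Rightarrow> 'g \<Rightarrow> 'e \<Rightarrow> 'e \<Rightarrow> real" where
  "metric_C GC \<kappa> G m g Z1 Z2 =
     (let W1 = dR GC \<kappa> (inv\<^bsub>GC\<^esub> g) g Z1; W2 = dR GC \<kappa> (inv\<^bsub>GC\<^esub> g) g Z2 in
        m \<one>\<^bsub>GC\<^esub> (re_part GC \<kappa> G W1) (re_part GC \<kappa> G W2) +
        m \<one>\<^bsub>GC\<^esub> (im_part GC \<kappa> G W1) (im_part GC \<kappa> G W2))"

definition metric_N :: "('g::topological_space) monoid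
    \<Rightarrow> ('g, 'e::{real_normed_vector,complex_space}) charts \<Rightarrow> 'g set \<Rightarrow> ('g \<Rightarrow> 'e \<Rightarrow> 'e \<Rightarrow> real)
    \<Rightarrow> 'g ^ 'l \<Rightarrow> 'e ^ 'l \<Rightarrow> 'e ^ 'l \<Rightarrow> real" where
  "metric_N GC \<kappa> G m U Z1 Z2 = (\<Sum>l\<in>UNIV. metric_C GC \<kappa> G m (U $ l) (Z1 $ l) (Z2 $ l))"

definition C1_curve :: "('a::topological_space, 'e::real_normed_vector) charts
    \<Rightarrow> (real \<Rightarrow> 'a) \<Rightarrow> bool" where
  "C1_curve \<kappa> \<gamma> \<longleftrightarrow> continuous_on UNIV \<gamma> \<and>
     (\<forall>p. (\<lambda>t. cmap \<kappa> p (\<gamma> t)) C1_differentiable_on {t. \<gamma> t \<in> cdom \<kappa> p})"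

definition velocity :: "('a, 'e::real_normed_vector) charts \<Rightarrow> (real \<Rightarrow> 'a) \<Rightarrow> real \<Rightarrow> 'e" where
  "velocity \<kappa> \<gamma> t = vector_derivative (\<lambda>s. cmap \<kappa> (\<gamma> t) (\<gamma> s)) (at t)"

definition curve_length :: "('a, 'e::real_normed_vector) charts \<Rightarrow> ('a \<Rightarrow> 'e \<Rightarrow> 'e \<Rightarrow> real)
    \<Rightarrow> (real \<Rightarrow> 'a) \<Rightarrow> real" where
  "curve_length \<kappa> mt \<gamma> =
     integral {0..1} (\<lambda>t. sqrt (mt (\<gamma> t) (velocity \<kappa> \<gamma> t) (velocity \<kappa> \<gamma> t)))"

text \<open>Boundedness for the Riemannian distance, the infimum of the lengths of connecting curves.\<close>

definition riemann_bounded :: "('a::topological_space, 'e::real_normed_vector) charts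
    \<Rightarrow> ('a \<Rightarrow> 'e \<Rightarrow> 'e \<Rightarrow> real) \<Rightarrow> 'a set \<Rightarrow> bool" where
  "riemann_bounded \<kappa> mt A \<longleftrightarrow>
     (\<exists>p r. \<forall>q\<in>A. \<exists>\<gamma>. C1_curve \<kappa> \<gamma> \<and> \<gamma> 0 = p \<and> \<gamma> 1 = q \<and> curve_length \<kappa> mt \<gamma> \<le> r)"

text \<open>
  \<open>n\<close> is the outer unit normal of \<open>A\<close> at the boundary point \<open>p\<close>. This includes that the boundary
  is regular at \<open>p\<close>: near \<open>p\<close>, \<open>A = {\<rho> < 0}\<close> for a continuously differentiable \<open>\<rho>\<close> (with
  Euclidean gradient \<open>D\<close> in the chart at \<open>p\<close>) with nonzero differential at \<open>p\<close>; the Riemannian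
  gradient of \<open>\<rho>\<close> at \<open>p\<close> is \<open>c n\<close> with \<open>c > 0\<close>.
\<close>

definition outer_unit_normal :: "('a::topological_space, 'e::euclidean_space) charts
    \<Rightarrow> ('a \<Rightarrow> 'e \<Rightarrow> 'e \<Rightarrow> real) \<Rightarrow> 'a set \<Rightarrow> 'a \<Rightarrow> 'e \<Rightarrow> bool" where
  "outer_unit_normal \<kappa> mt A p n \<longleftrightarrow>
     mt p n n = 1 \<and>
     (\<exists>Q \<rho> D. open Q \<and> p \<in> Q \<and> Q \<subseteq> cdom \<kappa> p \<and>
        (\<forall>z\<in>cmap \<kappa> p ` Q. ((\<rho> \<circ> cinv \<kappa> p) has_derivative (\<lambda>v. D z \<bullet> v)) (at z)) \<and>
        continuous_on (cmap \<kappa> p ` Q) D \<and>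
        \<rho> p = (0::real) \<and> A \<inter> Q = {q\<in>Q. \<rho> q < 0} \<and>
        (\<exists>c>0. \<forall>v. D (cmap \<kappa> p p) \<bullet> v = c * mt p n v))"


section \<open>Lattice fields\<close>

definition sites :: "nat \<Rightarrow> (nat \<Rightarrow> nat) \<Rightarrow> (nat \<Rightarrow> nat) set" where
  "sites d Ns = (\<Pi>\<^sub>E i\<in>{..d}. {..<Ns i})"

definition links :: "nat \<Rightarrow> (nat \<Rightarrow> nat) \<Rightarrow> ((nat \<Rightarrow> nat) \<times> nat) set" where
  "links d Ns = sites d Ns \<times> {..d}"

text \<open>
  A field is an element of \<open>'g ^ 'l\<close>, where the finite type \<open>'l\<close> enumerates the links
  \<open>(x, \<mu>)\<close> of the lattice.
\<close>

definition link_fields :: "'g set \<Rightarrow> ('g ^ 'l) set" where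
  "link_fields A = {U. \<forall>l. U $ l \<in> A}"

definition field_mult :: "'g monoid \<Rightarrow> 'g ^ 'l \<Rightarrow> 'g ^ 'l \<Rightarrow> 'g ^ 'l" where
  "field_mult GC V W = (\<chi> l. V $ l \<otimes>\<^bsub>GC\<^esub> W $ l)"

text \<open>\<open>dR U\<^sub>l e X\<close> is the value at \<open>U\<^sub>l\<close> of the right-invariant vector field generated by \<open>X\<close>.\<close>

definition lie_deriv :: "'g monoid \<Rightarrow> ('g, 'e::real_normed_vector) charts
    \<Rightarrow> 'l \<Rightarrow> 'e \<Rightarrow> ('g ^ 'l::finite \<Rightarrow> real) \<Rightarrow> 'g ^ 'l \<Rightarrow> real" where
  "lie_deriv GC \<kappa> l X f U =
     mdiff (vec_charts \<kappa>) std_charts f U (axis l (dR GC \<kappa> (U $ l) \<one>\<^bsub>GC\<^esub> X))"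

definition drift_K :: "'g monoid \<Rightarrow> ('g, 'e::real_normed_vector) charts
    \<Rightarrow> ('g ^ 'l::finite \<Rightarrow> complex) \<Rightarrow> 'l \<Rightarrow> 'e \<Rightarrow> 'g ^ 'l \<Rightarrow> real" where
  "drift_K GC \<kappa> S l X U = - lie_deriv GC \<kappa> l X (\<lambda>U. Re (S U)) U"

definition drift_J :: "'g monoid \<Rightarrow> ('g, 'e::real_normed_vector) charts
    \<Rightarrow> ('g ^ 'l::finite \<Rightarrow> complex) \<Rightarrow> 'l \<Rightarrow> 'e \<Rightarrow> 'g ^ 'l \<Rightarrow> real" where
  "drift_J GC \<kappa> S l X U = - lie_deriv GC \<kappa> l X (\<lambda>U. Im (S U)) U"

definition velocity_field :: "'g monoid \<Rightarrow> ('g, 'e::{real_normed_vector,complex_space}) charts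
    \<Rightarrow> ('m::finite \<Rightarrow> 'e) \<Rightarrow> ('g ^ 'l::finite \<Rightarrow> complex) \<Rightarrow> 'g ^ 'l \<Rightarrow> 'e ^ 'l" where
  "velocity_field GC \<kappa> X S U =
     (\<chi> l. \<Sum>a\<in>UNIV. dR GC \<kappa> (U $ l) \<one>\<^bsub>GC\<^esub>
        (drift_K GC \<kappa> S l (X a) U *\<^sub>R X a + drift_J GC \<kappa> S l (X a) U *\<^sub>R imult (X a)))"

end

theory Submission
  imports Defs "HOL-Complex_Analysis.Conformal_Mappings"
begin

text \<open>
  Write \<open>i B\<close> for the outer normal at a boundary point \<open>U\<close>, translated to the identity; it has no
  component in the real Lie algebra because \<open>\<Omega>\<close> is invariant under \<open>G^N\<close> from the left. The inward
  condition says that \<open>Im S\<close> has nonnegative derivative along \<open>exp (t B) U\<close>. The points of this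
  curve are boundary points with the same \<open>B\<close>, since \<open>B\<close> is fixed by the adjoint action of
  \<open>exp (t B)\<close>. So \<open>Im S\<close> is monotone along the curve, hence constant, because the curve returns
  arbitrarily close to its origin in the compact group \<open>G^N\<close>.

  Now let \<open>U\<close> maximise \<open>Im S\<close> on the part of the closure of \<open>\<Omega>\<close> in a given component; the closure
  is compact because right-invariant metrics are complete. Moving inwards from \<open>exp (t B) U\<close>
  cannot increase \<open>Im S\<close>, and by the Cauchy-Riemann equations this says that \<open>Re S\<close> is monotone
  along the curve, hence also constant. The holomorphic function \<open>z \<mapsto> S (exp (z B) U)\<close> is thus
  constant, and \<open>exp (- i s B) U\<close> lies inside \<open>\<Omega>\<close> for small \<open>s > 0\<close>. So \<open>Im S\<close> attains its maximum at
  an interior point, and \<open>S\<close> is constant on the component by the maximum principle and analytic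
  continuation.
\<close>

section \<open>Holomorphic maps between complex vector spaces\<close>

text \<open>The costly object is the complex curve \<open>exp (z B) U\<close>. Membership in
  \<open>lie_algebra\<close> supplies a real one-parameter subgroup inside \<open>G\<close>, but
  nothing supplies one with velocity \<open>imult B\<close> for a prescribed \<open>B\<close>: the
  polar decomposition starts from a group element, not from a vector. The complex curve is therefore
  constructed out of the real one, from the equation
  \<open>\<gamma> t = \<gamma> (t/2) \<cdot> \<gamma> (t/2)\<close>, and only for small
  \<open>z\<close>; small inward steps need no more. The normal is given by a defining function in a
  chart centred at the boundary point, a datum that does not follow translations easily. It is
  exchanged for a test on curves: those whose velocity has negative product with the normal enter
  the interior, those with positive product leave \<Omega>. This test determines \<open>B\<close>
  and survives translation from the left up to the adjoint action. \<open>G\<close> may be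
  disconnected, so the maximum is taken in each component separately, and each component has to be
  shown to meet \<Omega>.\<close>

lemma bounded_linear_imult: "bounded_linear (imult :: 'e::{euclidean_space,complex_space} \<Rightarrow> 'e)"
  by (simp flip: linear_conv_bounded_linear add: linear_iff imult_add imult_scaleR)

lemma imult_minus: "imult (- x) = - imult (x :: 'e::complex_space)"
  using imult_scaleR[of "-1" x] by simp

lemma imult_diff: "imult (x - y) = imult x - imult (y :: 'e::complex_space)"
  using imult_add[of x "- y"] by (simp add: imult_minus)

lemma imult_0 [simp]: "imult 0 = (0 :: 'e::complex_space)"
  using imult_scaleR[of 0 "0 :: 'e"] by simp

lemma imult_sum: "imult (\<Sum>a\<in>A. f a) = (\<Sum>a\<in>A. imult (f a :: 'e::complex_space))"
  by (induction A rule: infinite_finite_induct) (auto simp: imult_add)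

definition cscale :: "complex \<Rightarrow> 'e::complex_space \<Rightarrow> 'e" where
  "cscale z v = Re z *\<^sub>R v + Im z *\<^sub>R imult v"

lemma cscale_1 [simp]: "cscale 1 v = v"
  and cscale_0 [simp]: "cscale 0 v = 0"
  and cscale_zero_right [simp]: "cscale z 0 = 0"
  by (simp_all add: cscale_def)

lemma cscale_ii: "cscale (\<i> * z) v = imult (cscale z v)"
  by (simp add: cscale_def imult_add imult_scaleR imult_imult)

lemma cscale_of_real: "cscale (of_real t) v = t *\<^sub>R v"
  by (simp add: cscale_def)

lemma bounded_linear_cscale: "bounded_linear (\<lambda>z. cscale z (v :: 'e::{euclidean_space,complex_space}))"
  by (simp flip: linear_conv_bounded_linear add: linear_iff cscale_def algebra_simps)

text \<open>The norm of \<open>'e\<close> is tied only to the real structure: \<open>imult\<close>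
  need not be an isometry, so a constant has to be carried through all estimates along complex
  lines.\<close>

lemma imult_bound:
  obtains K where "K > 0" "\<And>v::'e::{euclidean_space,complex_space}. norm (imult v) \<le> K * norm v"
proof -
  obtain K where "K > 0" "\<And>v::'e. norm (imult v) \<le> norm v * K"
    using bounded_linear.pos_bounded[OF bounded_linear_imult] by auto
  then show ?thesis using that[of K] by (simp add: mult.commute)
qed

lemma cscale_bound:
  obtains K where "K > 0" "\<And>z (v::'e::{euclidean_space,complex_space}). norm (cscale z v) \<le> K * norm z * norm v"
proof -
  obtain K where K: "K > 0" "\<And>v::'e. norm (imult v) \<le> K * norm v" using imult_bound by blast
  have "norm (cscale z v) \<le> (1 + K) * norm z * norm v" for z and v :: 'e
  proof -
    have "norm (cscale z v) \<le> \<bar>Re z\<bar> * norm v + \<bar>Im z\<bar> * norm (imult v)"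
      unfolding cscale_def by (metis norm_scaleR norm_triangle_ineq)
    also have "\<dots> \<le> norm z * norm v + norm z * (K * norm v)"
      using K by (intro add_mono mult_mono) (auto simp: abs_Re_le_cmod abs_Im_le_cmod)
    finally show ?thesis by (simp add: algebra_simps)
  qed
  then show ?thesis using that[of "1 + K"] K by simp
qed

text \<open>The complex-linear functional whose real part is the coordinate \<open>\<lambda>v. v \<bullet> b\<close>.\<close>

definition cfun :: "'e::{euclidean_space,complex_space} \<Rightarrow> 'e \<Rightarrow> complex" where
  "cfun b v = Complex (v \<bullet> b) (- (imult v \<bullet> b))"

lemma bounded_linear_cfun: "bounded_linear (cfun b)"
  by (simp flip: linear_conv_bounded_linear
      add: linear_iff cfun_def complex_eq_iff imult_add imult_scaleR inner_add_left)

lemma cfun_imult: "cfun b (imult v) = imult (cfun b v)"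
  by (simp add: cfun_def imult_complex_def complex_eq_iff imult_imult)

lemma cfun_eqI: "(\<And>b. b \<in> Basis \<Longrightarrow> cfun b u = cfun b v) \<Longrightarrow> u = v"
  by (rule euclidean_eqI) (metis cfun_def complex.sel(1))

lemma norm_le_cfun: "norm v \<le> (\<Sum>b\<in>Basis. norm (cfun b v))"
proof -
  have "norm v \<le> (\<Sum>b\<in>Basis. \<bar>v \<bullet> b\<bar>)" by (rule norm_le_l1)
  also have "\<dots> \<le> (\<Sum>b\<in>Basis. norm (cfun b v))"
    by (intro sum_mono) (metis abs_Re_le_cmod cfun_def complex.sel(1))
  finally show ?thesis .
qed

lemma holo_onD:
  assumes "holo_on f S" "z \<in> S"
  shows "(f has_derivative frechet_derivative f (at z)) (at z)"
    and "frechet_derivative f (at z) (imult v) = imult (frechet_derivative f (at z) v)"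
proof -
  obtain f' where f': "(f has_derivative f') (at z)" "\<And>v. f' (imult v) = imult (f' v)"
    using assms unfolding holo_on_def by blast
  have "frechet_derivative f (at z) = f'" using frechet_derivative_at[OF f'(1)] by simp
  then show "(f has_derivative frechet_derivative f (at z)) (at z)"
    and "frechet_derivative f (at z) (imult v) = imult (frechet_derivative f (at z) v)"
    using f' by auto
qed

lemma holo_onI:
  assumes "\<And>z. z \<in> S \<Longrightarrow> (f has_derivative f' z) (at z)"
    and "\<And>z v. z \<in> S \<Longrightarrow> f' z (imult v) = imult (f' z v)"
  shows "holo_on f S"
  using assms unfolding holo_on_def by blast

lemma holo_on_compose:
  assumes "holo_on f S" "holo_on g T" "f ` S \<subseteq> T"
  shows "holo_on (\<lambda>z. g (f z)) S"
proof (rule holo_onI)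
  fix z assume z: "z \<in> S"
  then have "f z \<in> T" using assms(3) by blast
  then show "((\<lambda>z. g (f z)) has_derivative
      (\<lambda>v. frechet_derivative g (at (f z)) (frechet_derivative f (at z) v))) (at z)"
    using has_derivative_compose[OF holo_onD(1)[OF assms(1) z] holo_onD(1)[OF assms(2)]] by blast
  show "frechet_derivative g (at (f z)) (frechet_derivative f (at z) (imult v)) =
      imult (frechet_derivative g (at (f z)) (frechet_derivative f (at z) v))" for v
    using holo_onD(2)[OF assms(1) z] holo_onD(2)[OF assms(2) \<open>f z \<in> T\<close>] by simp
qed

lemma holo_on_linear:
  assumes "bounded_linear f" "\<And>v. f (imult v) = imult (f v)"
  shows "holo_on f S"
  by (rule holo_onI[of _ _ "\<lambda>_. f"]) (auto intro: bounded_linear_imp_has_derivative assms)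

lemma holo_on_add:
  assumes "holo_on f S" "holo_on g S"
  shows "holo_on (\<lambda>z. f z + g z) S"
  by (rule holo_onI[of _ _ "\<lambda>z v. frechet_derivative f (at z) v + frechet_derivative g (at z) v"])
     (auto intro!: has_derivative_add holo_onD(1) assms simp: holo_onD(2)[OF assms(1)] holo_onD(2)[OF assms(2)] imult_add)

lemma holo_on_diff:
  assumes "holo_on f S" "holo_on g S"
  shows "holo_on (\<lambda>z. f z - g z) S"
  by (rule holo_onI[of _ _ "\<lambda>z v. frechet_derivative f (at z) v - frechet_derivative g (at z) v"])
     (auto intro!: has_derivative_diff holo_onD(1) assms simp: holo_onD(2)[OF assms(1)] holo_onD(2)[OF assms(2)] imult_diff)

lemma holo_on_const: "holo_on (\<lambda>z. c) S"
  by (rule holo_onI[of _ _ "\<lambda>_ _. 0"]) auto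

lemma holo_on_cfun: "holo_on f S \<Longrightarrow> holo_on (\<lambda>z. cfun b (f z)) S"
  by (rule holo_on_compose[OF _ holo_on_linear[OF bounded_linear_cfun cfun_imult]]) auto

lemma holo_on_line:
  fixes v :: "'e::{euclidean_space,complex_space}"
  shows "holo_on (\<lambda>z. w + cscale z v) S"
  by (intro holo_on_add holo_on_const holo_on_linear bounded_linear_cscale)
     (simp add: imult_complex_def cscale_ii)

lemma holo_on_continuous: "holo_on f S \<Longrightarrow> continuous_on S f"
  by (meson continuous_at_imp_continuous_on has_derivative_continuous holo_onD(1))

lemma complex_linear_eq:
  fixes f :: "complex \<Rightarrow> 'e::{euclidean_space,complex_space}"
  assumes "bounded_linear f" "\<And>v. f (imult v) = imult (f v)"
  shows "f z = cscale z (f 1)"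
proof -
  interpret f: bounded_linear f by fact
  have "z = Re z *\<^sub>R 1 + Im z *\<^sub>R imult 1"
    by (simp add: imult_complex_def complex_eq_iff)
  then have "f z = f (Re z *\<^sub>R 1 + Im z *\<^sub>R imult 1)" by simp
  then show ?thesis by (simp add: f.add f.scaleR assms(2) cscale_def)
qed

lemma cscale_complex: "cscale z (w::complex) = z * w"
  by (simp add: cscale_def imult_complex_def complex_eq_iff)

text \<open>A real-linear self-map of the plane that commutes with \<open>imult\<close> is
  multiplication by its value at 1. On open sets this gives access to one-variable function
  theory.\<close>

lemma holo_on_complex_iff:
  fixes f :: "complex \<Rightarrow> complex"
  assumes "open S"
  shows "holo_on f S \<longleftrightarrow> f holomorphic_on S"
proof
  assume f: "holo_on f S"
  show "f holomorphic_on S"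
    unfolding holomorphic_on_def field_differentiable_def
  proof
    fix z assume z: "z \<in> S"
    let ?D = "frechet_derivative f (at z)"
    have D: "(f has_derivative ?D) (at z)" using holo_onD(1)[OF f z] .
    have "?D h = ?D 1 * h" for h
      using complex_linear_eq[OF has_derivative_bounded_linear[OF D] holo_onD(2)[OF f z], of h]
      unfolding cscale_complex by (simp only: mult.commute)
    then have "?D = (\<lambda>h. ?D 1 * h)" by (rule ext)
    then have "(f has_field_derivative ?D 1) (at z)" unfolding has_field_derivative_def using D by simp
    then show "\<exists>f'. (f has_field_derivative f') (at z within S)"
      using has_field_derivative_at_within by blast
  qed
next
  assume f: "f holomorphic_on S"
  show "holo_on f S"
  proof (rule holo_onI)
    fix z assume "z \<in> S"
    then have "(f has_field_derivative deriv f z) (at z)"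
      using f assms holomorphic_derivI by blast
    then show "(f has_derivative (\<lambda>h. deriv f z * h)) (at z)" by (simp add: has_field_derivative_def)
  qed (simp add: imult_complex_def)
qed

text \<open>Complex linearity of the assembled derivative is not visible from its real coordinates.
  It is recovered because \<open>cfun b\<close> of it is, by uniqueness of derivatives, the
  derivative of a holomorphic function.\<close>

lemma holo_on_cfunI:
  assumes "\<And>b. b \<in> Basis \<Longrightarrow> holo_on (\<lambda>z. cfun b (f z)) S"
  shows "holo_on (f :: _ \<Rightarrow> 'e::{euclidean_space,complex_space}) S"
  unfolding holo_on_def
proof
  fix z assume z: "z \<in> S"
  define D where "D = (\<lambda>b. frechet_derivative (\<lambda>z. cfun b (f z)) (at z))"
  have D: "((\<lambda>z. cfun b (f z)) has_derivative D b) (at z)"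
    and Di: "D b (imult v) = imult (D b v)" if "b \<in> Basis" for b v
    using holo_onD[OF assms[OF that] z] unfolding D_def by auto
  define f' where "f' = (\<lambda>v. \<Sum>b\<in>Basis. Re (D b v) *\<^sub>R b)"
  have f': "(f has_derivative f') (at z)"
  proof (subst has_derivative_componentwise_within, intro ballI)
    fix b :: 'e assume b: "b \<in> Basis"
    have "((\<lambda>z. Re (cfun b (f z))) has_derivative (\<lambda>v. Re (D b v))) (at z)"
      using D[OF b] by (rule has_derivative_Re)
    moreover have "Re (cfun b (f z)) = f z \<bullet> b" for z by (simp add: cfun_def)
    moreover have "f' v \<bullet> b = Re (D b v)" for v
      using b by (simp add: f'_def inner_sum_left inner_Basis if_distrib cong: if_cong)
    ultimately show "((\<lambda>x. f x \<bullet> b) has_derivative (\<lambda>x. f' x \<bullet> b)) (at z)" by simp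
  qed
  have *: "cfun b (f' v) = D b v" if "b \<in> Basis" for b v
  proof -
    have "((\<lambda>z. cfun b (f z)) has_derivative (\<lambda>v. cfun b (f' v))) (at z)"
      by (rule bounded_linear.has_derivative[OF bounded_linear_cfun f'])
    from has_derivative_unique[OF this D[OF that]] show ?thesis by metis
  qed
  have "f' (imult v) = imult (f' v)" for v
    by (rule cfun_eqI) (simp add: * Di cfun_imult)
  then show "\<exists>f'. (f has_derivative f') (at z) \<and> (\<forall>v. f' (imult v) = imult (f' v))"
    using f' by blast
qed

text \<open>\<open>K\<close> depends on the target space alone, so that one constant serves whole
  families of functions and radii.\<close>

lemma cauchy_estimate:
  obtains K where "K \<ge> 0" "\<And>(f::complex\<Rightarrow>'e::{euclidean_space,complex_space}) f' r B.
    \<lbrakk>0 < r; holo_on f (ball 0 r); \<And>z. z \<in> ball 0 r \<Longrightarrow> norm (f z) \<le> B; (f has_derivative f') (at 0)\<rbrakk>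
    \<Longrightarrow> norm (f' 1) \<le> K * B / r"
proof -
  have "\<forall>b. \<exists>K>0. \<forall>v::'e. norm (cfun b v) \<le> norm v * K"
    using bounded_linear.pos_bounded[OF bounded_linear_cfun] by blast
  then obtain k where k: "\<And>b. k b > 0" "\<And>b (v::'e). norm (cfun b v) \<le> norm v * k b"
    by metis
  define K where "K = (\<Sum>b\<in>(Basis::'e set). 2 * k b)"
  have "norm (f' 1) \<le> K * B / r"
    if r: "0 < r" and f: "holo_on f (ball 0 r)" and B: "\<And>z. z \<in> ball 0 r \<Longrightarrow> norm (f z) \<le> B"
      and D: "(f has_derivative f') (at 0)" for f :: "complex \<Rightarrow> 'e" and f' r B
  proof -
    have "norm (cfun b (f' 1)) \<le> 2 * k b * B / r" for b :: 'e
    proof -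
      let ?g = "\<lambda>z. cfun b (f z)"
      have g: "?g holomorphic_on ball 0 r"
        using holo_on_cfun[OF f] holo_on_complex_iff[of "ball 0 r" ?g] by simp
      have "(?g has_derivative (\<lambda>v. cfun b (f' v))) (at 0)"
        by (rule bounded_linear.has_derivative[OF bounded_linear_cfun D])
      moreover have "(?g has_derivative (\<lambda>v. deriv ?g 0 * v)) (at 0)"
        using holomorphic_derivI[OF g, of 0] r by (simp add: has_field_derivative_def)
      ultimately have "cfun b (f' 1) = deriv ?g 0" by (metis has_derivative_unique mult.right_neutral)
      \<comment> \<open>The circle has radius r/2 since \<open>f\<close> is controlled on the open
        ball only; this accounts for the factor 2 in \<open>K\<close>.\<close>
      moreover have "norm ((deriv ^^ 1) ?g 0) \<le> fact 1 * (B * k b) / (r/2)^1"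
      proof (rule Cauchy_inequality)
        show "?g holomorphic_on ball 0 (r/2)" using g holomorphic_on_subset r by (metis half_gt_zero_iff less_eq_real_def field_sum_of_halves less_add_same_cancel1 subset_ball)
        show "continuous_on (cball 0 (r/2)) ?g"
          using g r by (intro holomorphic_on_imp_continuous_on holomorphic_on_subset[OF g]) auto
        show "norm (?g x) \<le> B * k b" if "norm (0 - x) = r/2" for x
          using k(2)[of b "f x"] B[of x] k(1)[of b] that r
          by (smt (verit, best) field_sum_of_halves mem_ball_0 mult_right_mono norm_minus_commute diff_zero)
      qed (use r in auto)
      ultimately show ?thesis by (simp add: field_simps)
    qed
    then have "norm (f' 1) \<le> (\<Sum>b\<in>(Basis::'e set). 2 * k b * B / r)"
      by (intro order_trans[OF norm_le_cfun[of "f' 1"] sum_mono])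
    then show ?thesis by (simp add: K_def sum_distrib_right sum_divide_distrib)
  qed
  moreover have "K \<ge> 0" unfolding K_def by (intro sum_nonneg) (use k(1) in \<open>simp add: less_imp_le\<close>)
  ultimately show ?thesis using that by blast
qed

text \<open>\<open>holo_on\<close> asks for a derivative at each point and says nothing about its
  continuity. Restricting to complex lines and applying the Cauchy estimate, first to
  \<open>f\<close> and then to a difference of translates of \<open>f\<close>, bounds the derivative
  and makes it Lipschitz in the base point.\<close>

lemma holo_on_derivative_estimates:
  fixes f :: "'e::{euclidean_space,complex_space} \<Rightarrow> 'f::{euclidean_space,complex_space}"
  assumes S: "open S" and f: "holo_on f S" and z0: "z0 \<in> S"
  obtains \<delta> C where "\<delta> > 0" "C \<ge> 0" "ball z0 \<delta> \<subseteq> S"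
    "\<And>w v. w \<in> ball z0 \<delta> \<Longrightarrow> norm (frechet_derivative f (at w) v) \<le> C * norm v"
    "\<And>w w' v. \<lbrakk>w \<in> ball z0 \<delta>; w' \<in> ball z0 \<delta>\<rbrakk> \<Longrightarrow>
      norm (frechet_derivative f (at w) v - frechet_derivative f (at w') v) \<le> C * norm (w - w') * norm v"
proof -
  define D where "D = (\<lambda>w. frechet_derivative f (at w))"
  have D: "(f has_derivative D w) (at w)" and Di: "D w (imult v) = imult (D w v)" if "w \<in> S" for w v
    using holo_onD[OF f that] by (auto simp: D_def)
  obtain r where r: "r > 0" "cball z0 r \<subseteq> S"
    using S z0 open_contains_cball by blast
  have "compact (f ` cball z0 r)"
    by (intro compact_continuous_image continuous_on_subset[OF holo_on_continuous[OF f]] r) auto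
  then obtain B where B: "\<And>z. z \<in> cball z0 r \<Longrightarrow> norm (f z) \<le> B"
    using compact_imp_bounded bounded_iff by (metis image_eqI)
  then have B0: "B \<ge> 0" using r by (metis centre_in_cball less_eq_real_def norm_ge_zero order_trans)
  obtain k where k: "k > 0" "\<And>z (v::'e). norm (cscale z v) \<le> k * norm z * norm v"
    using cscale_bound by blast
  obtain K where K: "K \<ge> 0" "\<And>(f::complex\<Rightarrow>'f) f' r B.
    \<lbrakk>0 < r; holo_on f (ball 0 r); \<And>z. z \<in> ball 0 r \<Longrightarrow> norm (f z) \<le> B; (f has_derivative f') (at 0)\<rbrakk>
    \<Longrightarrow> norm (f' 1) \<le> K * B / r" using cauchy_estimate by blast
  \<comment> \<open>For |z| < \<rho> and a unit vector \<open>v\<close> the displacement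
    \<open>cscale z v\<close> stays below r/2. The radii r, r/2, r/4 leave room for the two Cauchy
    estimates.\<close>
  define \<rho> where "\<rho> = r / (2 * k)"
  have \<rho>: "\<rho> > 0" using r k by (simp add: \<rho>_def)
  have near: "w + cscale z v \<in> ball z0 (s + k * t)" if "w \<in> ball z0 s" "norm z < t" "norm v = 1" for w z v s t
  proof -
    have "norm (cscale z v) \<le> k * norm z" using k(2)[of z v] that by simp
    also have "\<dots> < k * t" using that k(1) by simp
    finally have *: "norm (cscale z v) < k * t" .
    have "dist z0 (w + cscale z v) \<le> dist z0 w + norm (cscale z v)"
      using norm_triangle_ineq4[of "z0 - w" "cscale z v"] by (simp add: dist_norm diff_diff_eq)
    with * that(1) show ?thesis by simp
  qed

  have line: "((\<lambda>z. f (w + cscale z v)) has_derivative (\<lambda>z. D w (cscale z v))) (at 0)" if "w \<in> S" for w v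
  proof -
    have "((\<lambda>z. w + cscale z v) has_derivative (\<lambda>z. cscale z v)) (at 0)"
      by (auto intro!: derivative_eq_intros bounded_linear_imp_has_derivative bounded_linear_cscale)
    from has_derivative_compose[OF this] D[OF that] show ?thesis by simp
  qed
  have unit: "norm (T v) \<le> M * norm v"
    if T: "bounded_linear T" and M: "\<And>v. norm v = 1 \<Longrightarrow> norm (T v) \<le> M" for T :: "'e \<Rightarrow> 'f" and M v
  proof (cases "v = 0")
    case False
    interpret T: bounded_linear T by fact
    have "norm (T (v /\<^sub>R norm v)) \<le> M" using False by (intro M) simp
    then show ?thesis using False by (simp add: T.scaleR field_simps)
  qed (use linear_0[OF bounded_linear.linear[OF T]] in simp)
  have blD: "bounded_linear (D w)" if "w \<in> S" for w using D[OF that] has_derivative_bounded_linear by blast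
  define L where "L = K * B / \<rho>"
  have L0: "L \<ge> 0" using K(1) B0 \<rho> by (simp add: L_def)
  have half: "k * \<rho> = r/2" using k by (simp add: \<rho>_def)
  have "ball z0 (r/2) \<subseteq> cball z0 r" "ball z0 (r/4) \<subseteq> cball z0 r" using r by auto
  then have sub: "ball z0 (r/2) \<subseteq> S" "ball z0 (r/4) \<subseteq> S" using r by blast+
  have bd: "norm (D w v) \<le> L * norm v" if w: "w \<in> ball z0 (r/2)" for w v
  proof (rule unit[OF blD])
    show wS: "w \<in> S" using w sub by blast
    fix v :: 'e assume v: "norm v = 1"
    have mem: "w + cscale z v \<in> ball z0 r" if "z \<in> ball 0 \<rho>" for z
      using near[OF w, of z \<rho> v] that v half by simp
    have "norm (D w (cscale 1 v)) \<le> K * B / \<rho>"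
    proof (rule K(2)[OF \<rho> _ _ line[OF wS]])
      show "holo_on (\<lambda>z. f (w + cscale z v)) (ball 0 \<rho>)"
        using mem r ball_subset_cball[of z0 r] by (intro holo_on_compose[OF holo_on_line f]) blast
      show "norm (f (w + cscale z v)) \<le> B" if "z \<in> ball 0 \<rho>" for z
        using B mem[OF that] ball_subset_cball by blast
    qed
    then show "norm (D w v) \<le> L" by (simp add: L_def)
  qed
  have lip: "norm (f w - f w') \<le> L * norm (w - w')" if "w \<in> ball z0 (r/2)" "w' \<in> ball z0 (r/2)" for w w'
  proof (rule differentiable_bound[of "ball z0 (r/2)" f D])
    show "(f has_derivative D x) (at x within ball z0 (r/2))" if "x \<in> ball z0 (r/2)" for x
      using D that sub by (meson has_derivative_at_withinI subsetD)
    show "onorm (D x) \<le> L" if "x \<in> ball z0 (r/2)" for x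
      using bd[OF that] by (intro onorm_bound L0)
  qed (use that in auto)
  \<comment> \<open>The second entry is the Cauchy estimate on radius \<rho>/2 for a difference of
    translates, which is bounded by \<open>L * norm (w - w')\<close>.\<close>
  define C where "C = max L (2 * K * L / \<rho>)"
  show thesis
  proof (rule that[of "r/4" C])
    show "norm (frechet_derivative f (at w) v) \<le> C * norm v" if "w \<in> ball z0 (r/4)" for w v
    proof -
      have "norm (D w v) \<le> L * norm v" using that r by (intro bd) auto
      also have "\<dots> \<le> C * norm v" by (intro mult_right_mono) (auto simp: C_def)
      finally show ?thesis by (simp add: D_def)
    qed
    fix w w' v assume w: "w \<in> ball z0 (r/4)" and w': "w' \<in> ball z0 (r/4)"
    have S': "w \<in> S" "w' \<in> S" using w w' sub by auto
    have "norm ((\<lambda>v. D w v - D w' v) v) \<le> (C * norm (w - w')) * norm v"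
    proof (rule unit)
      show "bounded_linear (\<lambda>v. D w v - D w' v)" by (intro bounded_linear_sub blD S')
      fix v :: 'e assume v: "norm v = 1"
      have mem: "w + cscale z v \<in> ball z0 (r/2)" "w' + cscale z v \<in> ball z0 (r/2)" if "z \<in> ball 0 (\<rho>/2)" for z
        using near[OF w, of z "\<rho>/2" v] near[OF w', of z "\<rho>/2" v] that v half by auto
      have "norm (D w (cscale 1 v) - D w' (cscale 1 v)) \<le> K * (L * norm (w - w')) / (\<rho>/2)"
      proof (rule K(2)[OF _ _ _ has_derivative_diff[OF line[OF S'(1)] line[OF S'(2)]]])
        show "holo_on (\<lambda>z. f (w + cscale z v) - f (w' + cscale z v)) (ball 0 (\<rho>/2))"
          using mem sub by (intro holo_on_diff holo_on_compose[OF holo_on_line f]) auto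
        show "norm (f (w + cscale z v) - f (w' + cscale z v)) \<le> L * norm (w - w')" if "z \<in> ball 0 (\<rho>/2)" for z
          using lip[OF mem[OF that]] by simp
      qed (use \<rho> in auto)
      also have "\<dots> \<le> C * norm (w - w')"
        using mult_right_mono[of "2 * K * L / \<rho>" C "norm (w - w')"] by (simp add: C_def mult_ac)
      finally show "norm (D w v - D w' v) \<le> C * norm (w - w')" by simp
    qed
    then show "norm (frechet_derivative f (at w) v - frechet_derivative f (at w') v) \<le> C * norm (w - w') * norm v"
      by (simp add: D_def)
  qed (use r sub L0 in \<open>auto simp: C_def\<close>)
qed

section \<open>Calculus in charts\<close>

text \<open>Compatibility of charts is left out on purpose: derivatives are always taken in the
  chart centred at the point, so the chain rule never changes charts, and products and powers
  inherit this weaker notion at once.\<close>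

definition good_charts :: "('a::topological_space, 'e::real_normed_vector) charts \<Rightarrow> bool" where
  "good_charts \<kappa> \<longleftrightarrow>
     (\<forall>p. p \<in> cdom \<kappa> p \<and> open (cdom \<kappa> p) \<and> open (cmap \<kappa> p ` cdom \<kappa> p) \<and>
          homeomorphism (cdom \<kappa> p) (cmap \<kappa> p ` cdom \<kappa> p) (cmap \<kappa> p) (cinv \<kappa> p))"

lemma complex_atlas_good: "complex_atlas \<kappa> \<Longrightarrow> good_charts \<kappa>"
  unfolding complex_atlas_def good_charts_def by blast

context
  fixes \<kappa> :: "('a::topological_space, 'e::real_normed_vector) charts"
  assumes good: "good_charts \<kappa>"
begin

lemma cdom_self: "p \<in> cdom \<kappa> p"
  and open_cdom: "open (cdom \<kappa> p)"
  and open_cimage: "open (cmap \<kappa> p ` cdom \<kappa> p)"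
  and chart_homeomorphism:
    "homeomorphism (cdom \<kappa> p) (cmap \<kappa> p ` cdom \<kappa> p) (cmap \<kappa> p) (cinv \<kappa> p)"
  using good unfolding good_charts_def by blast+

lemma cinv_cmap: "q \<in> cdom \<kappa> p \<Longrightarrow> cinv \<kappa> p (cmap \<kappa> p q) = q"
  by (rule homeomorphism_apply1[OF chart_homeomorphism])

lemma cmap_cinv: "z \<in> cmap \<kappa> p ` cdom \<kappa> p \<Longrightarrow> cmap \<kappa> p (cinv \<kappa> p z) = z"
  by (rule homeomorphism_apply2[OF chart_homeomorphism])

lemma cinv_in_cdom: "z \<in> cmap \<kappa> p ` cdom \<kappa> p \<Longrightarrow> cinv \<kappa> p z \<in> cdom \<kappa> p"
  by (auto simp: cinv_cmap)

lemma continuous_on_cmap: "continuous_on (cdom \<kappa> p) (cmap \<kappa> p)"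
  by (rule homeomorphism_cont1[OF chart_homeomorphism])

lemma continuous_on_cinv: "continuous_on (cmap \<kappa> p ` cdom \<kappa> p) (cinv \<kappa> p)"
  by (rule homeomorphism_cont2[OF chart_homeomorphism])

lemma eventually_cdom: "q \<in> cdom \<kappa> p \<Longrightarrow> \<forall>\<^sub>F x in nhds q. x \<in> cdom \<kappa> p"
  using open_cdom eventually_nhds_in_open by blast

lemma eventually_cimage:
  "z \<in> cmap \<kappa> p ` cdom \<kappa> p \<Longrightarrow> \<forall>\<^sub>F z in nhds z. z \<in> cmap \<kappa> p ` cdom \<kappa> p"
  using open_cimage eventually_nhds_in_open by blast

lemma filterlim_cmap: "q \<in> cdom \<kappa> p \<Longrightarrow> filterlim (cmap \<kappa> p) (nhds (cmap \<kappa> p q)) (nhds q)"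
  using continuous_on_cmap[of p] open_cdom[of p]
  by (metis at_within_open continuous_on_def tendsto_at_iff_tendsto_nhds)

lemma filterlim_cinv:
  "z \<in> cmap \<kappa> p ` cdom \<kappa> p \<Longrightarrow> filterlim (cinv \<kappa> p) (nhds (cinv \<kappa> p z)) (nhds z)"
  using continuous_on_cinv[of p] open_cimage[of p]
  by (metis at_within_open continuous_on_def tendsto_at_iff_tendsto_nhds)

lemma filterlim_cinv_center: "filterlim (cinv \<kappa> p) (nhds p) (nhds (cmap \<kappa> p p))"
  using filterlim_cinv[of "cmap \<kappa> p p" p] cinv_cmap cdom_self by simp

end

text \<open>Charts are inverted by \<open>inv_into\<close>, which for product charts is not
  literally the product of the inverses; a continuous left inverse agrees with it on the
  image.\<close>

lemma homeomorphism_inv_into: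
  assumes "continuous_on S f" "continuous_on (f ` S) g" "\<And>x. x \<in> S \<Longrightarrow> g (f x) = x"
  shows "homeomorphism S (f ` S) f (inv_into S f)"
proof -
  have "inj_on f S" by (metis assms(3) inj_onI)
  moreover have "continuous_on (f ` S) (inv_into S f)"
    using assms(2) by (rule continuous_on_eq) (use assms(3) \<open>inj_on f S\<close> in auto)
  ultimately show ?thesis using assms(1) by (auto simp: homeomorphism_def inj_on_image_mem_iff)
qed

lemma std_cdom [simp]: "cdom std_charts p = UNIV"
  and std_cmap [simp]: "cmap std_charts p = id"
  by (simp_all add: std_charts_def)

lemma good_std_charts: "good_charts (std_charts :: ('e::real_normed_vector, 'e) charts)"
  by (auto simp: good_charts_def intro!: homeomorphismI continuous_on_id)

lemma prod_cdom: "cdom (prod_charts \<kappa> \<kappa>') p = cdom \<kappa> (fst p) \<times> cdom \<kappa>' (snd p)"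
  and prod_cmap: "cmap (prod_charts \<kappa> \<kappa>') p = map_prod (cmap \<kappa> (fst p)) (cmap \<kappa>' (snd p))"
  by (simp_all add: prod_charts_def)

lemma vec_cdom: "cdom (vec_charts \<kappa>) p = {q. \<forall>l. q $ l \<in> cdom \<kappa> (p $ l)}"
  and vec_cmap: "cmap (vec_charts \<kappa>) p = (\<lambda>q. \<chi> l. cmap \<kappa> (p $ l) (q $ l))"
  by (simp_all add: vec_charts_def)

lemma good_prod_charts:
  assumes "good_charts \<kappa>" "good_charts \<kappa>'"
  shows "good_charts (prod_charts \<kappa> \<kappa>')"
  unfolding good_charts_def
proof (intro allI conjI)
  fix p :: "'a \<times> 'c"
  obtain a b where p: "p = (a, b)" by fastforce
  let ?K = "prod_charts \<kappa> \<kappa>'"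
  have im: "cmap ?K p ` cdom ?K p = (cmap \<kappa> a ` cdom \<kappa> a) \<times> (cmap \<kappa>' b ` cdom \<kappa>' b)"
    by (auto simp: p prod_cdom prod_cmap)
  show "p \<in> cdom ?K p" by (simp add: p prod_cdom cdom_self assms)
  show "open (cdom ?K p)" by (simp add: p prod_cdom open_Times open_cdom assms)
  show "open (cmap ?K p ` cdom ?K p)" unfolding im by (intro open_Times open_cimage assms)
  show "homeomorphism (cdom ?K p) (cmap ?K p ` cdom ?K p) (cmap ?K p) (cinv ?K p)"
  proof (rule homeomorphism_inv_into[where g="map_prod (cinv \<kappa> a) (cinv \<kappa>' b)"])
    show "continuous_on (cdom ?K p) (cmap ?K p)"
      unfolding prod_cdom prod_cmap map_prod_def p split_beta
      by (intro continuous_intros continuous_on_compose2[OF continuous_on_cmap] assms) auto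
    show "continuous_on (cmap ?K p ` cdom ?K p) (map_prod (cinv \<kappa> a) (cinv \<kappa>' b))"
      unfolding im map_prod_def split_beta
      by (intro continuous_intros continuous_on_compose2[OF continuous_on_cinv] assms) auto
  qed (auto simp: p prod_cdom prod_cmap cinv_cmap assms)
qed

lemma continuous_on_vec_nth: "continuous_on S (\<lambda>x :: 'a::topological_space ^ 'l::finite. x $ l)"
  by (auto simp: continuous_on_def intro: tendsto_vec_nth tendsto_ident_at)

lemma open_vec_all: "(\<And>l. open (A l)) \<Longrightarrow> open {q :: 'a::topological_space ^ 'l::finite. \<forall>l. q $ l \<in> A l}"
  unfolding open_vec_def by blast

lemma good_vec_charts:
  assumes "good_charts \<kappa>"
  shows "good_charts (vec_charts \<kappa> :: ('a::topological_space ^ 'l::finite, 'e::real_normed_vector ^ 'l) charts)"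
  unfolding good_charts_def
proof (intro allI conjI)
  fix p :: "'a ^ 'l"
  let ?K = "vec_charts \<kappa> :: ('a ^ 'l, 'e ^ 'l) charts"
  have im: "cmap ?K p ` cdom ?K p = {z. \<forall>l. z $ l \<in> cmap \<kappa> (p $ l) ` cdom \<kappa> (p $ l)}" (is "_ = ?I")
  proof
    show "?I \<subseteq> cmap ?K p ` cdom ?K p"
    proof
      fix z assume z: "z \<in> ?I"
      then have "z = cmap ?K p (\<chi> l. cinv \<kappa> (p $ l) (z $ l))"
        by (simp add: vec_cmap vec_eq_iff cmap_cinv[OF assms])
      moreover have "(\<chi> l. cinv \<kappa> (p $ l) (z $ l)) \<in> cdom ?K p"
        using z by (simp add: vec_cdom cinv_in_cdom[OF assms])
      ultimately show "z \<in> cmap ?K p ` cdom ?K p" by blast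
    qed
  qed (auto simp: vec_cdom vec_cmap)
  show "p \<in> cdom ?K p" by (simp add: vec_cdom cdom_self assms)
  show "open (cdom ?K p)" unfolding vec_cdom by (intro open_vec_all open_cdom assms)
  show "open (cmap ?K p ` cdom ?K p)" unfolding im by (intro open_vec_all open_cimage assms)
  show "homeomorphism (cdom ?K p) (cmap ?K p ` cdom ?K p) (cmap ?K p) (cinv ?K p)"
  proof (rule homeomorphism_inv_into[where g="\<lambda>z. \<chi> l. cinv \<kappa> (p $ l) (z $ l)"])
    show "continuous_on (cdom ?K p) (cmap ?K p)"
      unfolding vec_cdom vec_cmap
      by (intro continuous_on_vec_lambda continuous_on_compose2[OF continuous_on_cmap]
          continuous_on_vec_nth assms) auto
    show "continuous_on (cmap ?K p ` cdom ?K p) (\<lambda>z. \<chi> l. cinv \<kappa> (p $ l) (z $ l))"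
      unfolding im
      by (intro continuous_on_vec_lambda continuous_on_compose2[OF continuous_on_cinv]
          continuous_on_vec_nth assms) auto
  qed (auto simp: vec_cdom vec_cmap cinv_cmap assms vec_eq_iff)
qed

text \<open>Continuity is expressed through neighbourhood filters, because the type \<open>'g ^ 'l\<close> is not an
  instance of the class of Hausdorff spaces, which \<open>isCont\<close> requires.\<close>

definition has_mderiv :: "('a::topological_space, 'e::real_normed_vector) charts
    \<Rightarrow> ('b::topological_space, 'f::real_normed_vector) charts \<Rightarrow> ('a \<Rightarrow> 'b) \<Rightarrow> 'a \<Rightarrow> ('e \<Rightarrow> 'f) \<Rightarrow> bool" where
  "has_mderiv \<kappa> \<kappa>' F p F' \<longleftrightarrow> filterlim F (nhds (F p)) (nhds p) \<and>
     ((cmap \<kappa>' (F p) \<circ> F \<circ> cinv \<kappa> p) has_derivative F') (at (cmap \<kappa> p p))"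

lemma has_mderivD:
  assumes "has_mderiv \<kappa> \<kappa>' F p F'"
  shows "filterlim F (nhds (F p)) (nhds p)"
    "((cmap \<kappa>' (F p) \<circ> F \<circ> cinv \<kappa> p) has_derivative F') (at (cmap \<kappa> p p))"
  using assms unfolding has_mderiv_def by auto

lemma has_derivative_eventually_eq:
  assumes "(f has_derivative f') (at x)" "\<forall>\<^sub>F z in nhds x. f z = g z"
  shows "(g has_derivative f') (at x)"
proof (rule has_derivative_transform_eventually[OF assms(1)])
  show "\<forall>\<^sub>F z in at x. f z = g z"
    using assms(2) by (simp add: eventually_nhds_conv_at)
  show "f x = g x" using eventually_nhds_x_imp_x[OF assms(2)] .
qed simp

lemma has_mderiv_bounded_linear: "has_mderiv \<kappa> \<kappa>' F p F' \<Longrightarrow> bounded_linear F'"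
  using has_mderivD(2) has_derivative_bounded_linear by blast

lemma has_mderiv_mdiff: "has_mderiv \<kappa> \<kappa>' F p F' \<Longrightarrow> mdiff \<kappa> \<kappa>' F p = F'"
  unfolding mdiff_def using frechet_derivative_at[OF has_mderivD(2)] by metis

lemma has_mderiv_unique:
  "has_mderiv \<kappa> \<kappa>' F p F' \<Longrightarrow> has_mderiv \<kappa> \<kappa>' F p F'' \<Longrightarrow> F' = F''"
  by (metis has_mderiv_mdiff)

lemma has_mderiv_compose:
  assumes \<kappa>: "good_charts \<kappa>" and \<kappa>': "good_charts \<kappa>'"
    and F: "has_mderiv \<kappa> \<kappa>' F p F'" and G: "has_mderiv \<kappa>' \<kappa>'' G (F p) G'"
  shows "has_mderiv \<kappa> \<kappa>'' (\<lambda>x. G (F x)) p (\<lambda>v. G' (F' v))"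
  unfolding has_mderiv_def
proof
  show "filterlim (\<lambda>x. G (F x)) (nhds (G (F p))) (nhds p)"
    using filterlim_compose[OF has_mderivD(1)[OF G] has_mderivD(1)[OF F]] .
  let ?F = "cmap \<kappa>' (F p) \<circ> F \<circ> cinv \<kappa> p" and ?G = "cmap \<kappa>'' (G (F p)) \<circ> G \<circ> cinv \<kappa>' (F p)"
  have "?F (cmap \<kappa> p p) = cmap \<kappa>' (F p) (F p)" by (simp add: cinv_cmap[OF \<kappa>] cdom_self[OF \<kappa>])
  then have "((\<lambda>z. ?G (?F z)) has_derivative (\<lambda>v. G' (F' v))) (at (cmap \<kappa> p p))"
    using has_derivative_compose[OF has_mderivD(2)[OF F]] has_mderivD(2)[OF G] by metis
  \<comment> \<open>The intermediate chart and its inverse cancel only near the point, where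
    \<open>F\<close> stays in the chart domain.\<close>
  moreover have "\<forall>\<^sub>F z in nhds (cmap \<kappa> p p). F (cinv \<kappa> p z) \<in> cdom \<kappa>' (F p)"
    by (intro eventually_compose_filterlim[OF eventually_cdom[OF \<kappa>' cdom_self[OF \<kappa>']]]
        filterlim_compose[OF has_mderivD(1)[OF F] filterlim_cinv_center[OF \<kappa>]])
  then have "\<forall>\<^sub>F z in nhds (cmap \<kappa> p p). ?G (?F z) = (cmap \<kappa>'' (G (F p)) \<circ> (\<lambda>x. G (F x)) \<circ> cinv \<kappa> p) z"
    by eventually_elim (simp add: cinv_cmap[OF \<kappa>'])
  ultimately show "((cmap \<kappa>'' (G (F p)) \<circ> (\<lambda>x. G (F x)) \<circ> cinv \<kappa> p) has_derivative (\<lambda>v. G' (F' v)))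
      (at (cmap \<kappa> p p))"
    by (rule has_derivative_eventually_eq)
qed

lemma has_mderiv_eventually_eq:
  assumes \<kappa>: "good_charts \<kappa>" and F: "has_mderiv \<kappa> \<kappa>' F p F'"
    and eq: "\<forall>\<^sub>F x in nhds p. F x = G x"
  shows "has_mderiv \<kappa> \<kappa>' G p F'"
  unfolding has_mderiv_def
proof
  have p: "F p = G p" using eventually_nhds_x_imp_x[OF eq] .
  show "filterlim G (nhds (G p)) (nhds p)"
    using has_mderivD(1)[OF F] eq p by (metis (mono_tags, lifting) filterlim_cong)
  have "\<forall>\<^sub>F z in nhds (cmap \<kappa> p p). F (cinv \<kappa> p z) = G (cinv \<kappa> p z)"
    by (rule eventually_compose_filterlim[OF eq filterlim_cinv_center[OF \<kappa>]])
  then have "\<forall>\<^sub>F z in nhds (cmap \<kappa> p p). (cmap \<kappa>' (F p) \<circ> F \<circ> cinv \<kappa> p) z = (cmap \<kappa>' (G p) \<circ> G \<circ> cinv \<kappa> p) z"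
    by eventually_elim (simp add: p)
  then show "((cmap \<kappa>' (G p) \<circ> G \<circ> cinv \<kappa> p) has_derivative F') (at (cmap \<kappa> p p))"
    using has_derivative_eventually_eq[OF has_mderivD(2)[OF F]] by blast
qed

lemma has_mderiv_const:
  "has_mderiv \<kappa> \<kappa>' (\<lambda>_. c) p (\<lambda>_. 0)"
  unfolding has_mderiv_def by (simp add: o_def)

lemma has_mderiv_ident:
  assumes \<kappa>: "good_charts \<kappa>"
  shows "has_mderiv \<kappa> \<kappa> (\<lambda>x. x) p (\<lambda>v. v)"
  unfolding has_mderiv_def
proof
  have "((\<lambda>z. z) has_derivative (\<lambda>v. v)) (at (cmap \<kappa> p p))" by (rule has_derivative_ident)
  moreover have "\<forall>\<^sub>F z in nhds (cmap \<kappa> p p). z = (cmap \<kappa> p \<circ> (\<lambda>x. x) \<circ> cinv \<kappa> p) z"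
    using eventually_cimage[OF \<kappa>, of "cmap \<kappa> p p" p] cdom_self[OF \<kappa>, of p]
    by (auto elim!: eventually_mono simp: cmap_cinv[OF \<kappa>])
  ultimately show "((cmap \<kappa> p \<circ> (\<lambda>x. x) \<circ> cinv \<kappa> p) has_derivative (\<lambda>v. v)) (at (cmap \<kappa> p p))"
    by (rule has_derivative_eventually_eq)
qed (simp add: filterlim_ident)

lemma has_mderiv_Pair:
  assumes "has_mderiv \<kappa> \<kappa>' F p F'" "has_mderiv \<kappa> \<kappa>'' G p G'"
  shows "has_mderiv \<kappa> (prod_charts \<kappa>' \<kappa>'') (\<lambda>x. (F x, G x)) p (\<lambda>v. (F' v, G' v))"
  unfolding has_mderiv_def
proof
  show "((\<lambda>x. (F x, G x)) \<longlongrightarrow> (F p, G p)) (nhds p)"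
    by (intro tendsto_Pair has_mderivD(1)[OF assms(1)] has_mderivD(1)[OF assms(2)])
  show "((cmap (prod_charts \<kappa>' \<kappa>'') (F p, G p) \<circ> (\<lambda>x. (F x, G x)) \<circ> cinv \<kappa> p) has_derivative
      (\<lambda>v. (F' v, G' v))) (at (cmap \<kappa> p p))"
    using has_derivative_Pair[OF has_mderivD(2)[OF assms(1)] has_mderivD(2)[OF assms(2)]]
    by (simp add: prod_cmap o_def)
qed

text \<open>The entries lie in an arbitrary normed space, so the vector is reassembled as a sum of
  \<open>axis\<close> vectors, each a bounded linear image of one entry.\<close>

lemma has_derivative_vec:
  assumes "\<And>l. ((\<lambda>x. f x $ l) has_derivative (\<lambda>v. f' v $ l)) F"
  shows "(f has_derivative (f' :: _ \<Rightarrow> 'b::real_normed_vector ^ 'l::finite)) F"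
proof -
  have bl: "bounded_linear (\<lambda>v. axis l v :: 'b ^ 'l)" for l
    by (rule bounded_linear_intro[of _ 1])
       (auto simp: axis_def vec_eq_iff norm_vec_def L2_set_def if_distrib[of norm] if_distrib[of "\<lambda>x. x ^ 2"] cong: if_cong)
  have *: "z = (\<Sum>l\<in>UNIV. axis l (z $ l))" for z :: "'b ^ 'l"
    by (simp add: vec_eq_iff sum_component axis_def if_distrib cong: if_cong)
  have "((\<lambda>x. \<Sum>l\<in>UNIV. axis l (f x $ l) :: 'b ^ 'l) has_derivative (\<lambda>v. \<Sum>l\<in>UNIV. axis l (f' v $ l))) F"
    by (intro has_derivative_sum bounded_linear.has_derivative[OF bl] assms)
  then show ?thesis using * by (metis (no_types, lifting) has_derivative_eq_rhs ext)
qed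

lemma has_mderiv_vec:
  assumes "\<And>l. has_mderiv \<kappa> \<kappa>' (\<lambda>x. F x $ l) p (\<lambda>v. F' v $ l)"
  shows "has_mderiv \<kappa> (vec_charts \<kappa>') (F :: 'a::topological_space \<Rightarrow> 'b::topological_space ^ 'l::finite) p F'"
  unfolding has_mderiv_def
proof
  show "(F \<longlongrightarrow> F p) (nhds p)"
    by (rule vec_tendstoI) (rule has_mderivD(1)[OF assms])
  show "((cmap (vec_charts \<kappa>') (F p) \<circ> F \<circ> cinv \<kappa> p) has_derivative F') (at (cmap \<kappa> p p))"
    by (rule has_derivative_vec) (use has_mderivD(2)[OF assms] in \<open>simp add: vec_cmap o_def\<close>)
qed

lemma has_mderiv_std_iff:
  "has_mderiv std_charts std_charts f x f' \<longleftrightarrow> (f has_derivative f') (at x)"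
proof
  assume f: "(f has_derivative f') (at x)"
  then have "filterlim f (nhds (f x)) (nhds x)"
    using has_derivative_continuous[OF f] by (simp add: isCont_def tendsto_at_iff_tendsto_nhds)
  with f show "has_mderiv std_charts std_charts f x f'" by (simp add: has_mderiv_def)
qed (simp add: has_mderiv_def)

lemma holo_map_has_mderiv:
  assumes \<kappa>: "good_charts \<kappa>" and \<kappa>': "good_charts \<kappa>'" and F: "holo_map \<kappa> \<kappa>' F"
  shows "has_mderiv \<kappa> \<kappa>' F p (mdiff \<kappa> \<kappa>' F p)"
    and "mdiff \<kappa> \<kappa>' F p (imult v) = imult (mdiff \<kappa> \<kappa>' F p v)"
proof -
  have "holo_on (cmap \<kappa>' (F p) \<circ> F \<circ> cinv \<kappa> p) (cmap \<kappa> p ` (cdom \<kappa> p \<inter> F -` cdom \<kappa>' (F p)))"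
    using F unfolding holo_map_def by blast
  moreover have "cmap \<kappa> p p \<in> cmap \<kappa> p ` (cdom \<kappa> p \<inter> F -` cdom \<kappa>' (F p))"
    using cdom_self[OF \<kappa>] cdom_self[OF \<kappa>'] by blast
  moreover have "filterlim F (nhds (F p)) (nhds p)"
    using F unfolding holo_map_def continuous_on_def by (metis UNIV_I tendsto_at_iff_tendsto_nhds)
  ultimately show "has_mderiv \<kappa> \<kappa>' F p (mdiff \<kappa> \<kappa>' F p)"
    and "mdiff \<kappa> \<kappa>' F p (imult v) = imult (mdiff \<kappa> \<kappa>' F p v)"
    unfolding has_mderiv_def mdiff_def by (auto intro: holo_onD)
qed

text \<open>Here holomorphy of the transition maps enters: off its centre, the chart at
  \<open>q\<close> differs from the chart at \<open>x\<close> by such a map.\<close>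

lemma has_mderiv_cmap:
  assumes \<kappa>: "complex_atlas \<kappa>" and x: "x \<in> cdom \<kappa> q"
  obtains T where "has_mderiv \<kappa> std_charts (cmap \<kappa> q) x T" "\<And>v. T (imult v) = imult (T v)"
proof -
  note g = complex_atlas_good[OF \<kappa>]
  have "holo_on (cmap \<kappa> q \<circ> cinv \<kappa> x) (cmap \<kappa> x ` (cdom \<kappa> x \<inter> cdom \<kappa> q))"
    using \<kappa> unfolding complex_atlas_def by blast
  moreover have "cmap \<kappa> x x \<in> cmap \<kappa> x ` (cdom \<kappa> x \<inter> cdom \<kappa> q)" using x cdom_self[OF g] by blast
  ultimately obtain T where "((cmap \<kappa> q \<circ> cinv \<kappa> x) has_derivative T) (at (cmap \<kappa> x x))"
    "\<And>v. T (imult v) = imult (T v)" unfolding holo_on_def by blast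
  then show ?thesis using that[of T] filterlim_cmap[OF g x] by (simp add: has_mderiv_def)
qed

lemma has_mderiv_cinv:
  assumes \<kappa>: "complex_atlas \<kappa>" and z: "z \<in> cmap \<kappa> q ` cdom \<kappa> q"
  obtains T where "has_mderiv std_charts \<kappa> (cinv \<kappa> q) z T" "\<And>v. T (imult v) = imult (T v)"
proof -
  note g = complex_atlas_good[OF \<kappa>]
  define x where "x = cinv \<kappa> q z"
  have x: "x \<in> cdom \<kappa> q" "cmap \<kappa> q x = z" using cinv_in_cdom[OF g z] cmap_cinv[OF g z] by (auto simp: x_def)
  have "holo_on (cmap \<kappa> x \<circ> cinv \<kappa> q) (cmap \<kappa> q ` (cdom \<kappa> q \<inter> cdom \<kappa> x))"
    using \<kappa> unfolding complex_atlas_def by blast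
  moreover have "z \<in> cmap \<kappa> q ` (cdom \<kappa> q \<inter> cdom \<kappa> x)" using x cdom_self[OF g] by blast
  ultimately obtain T where "((cmap \<kappa> x \<circ> cinv \<kappa> q) has_derivative T) (at z)"
    "\<And>v. T (imult v) = imult (T v)" unfolding holo_on_def by blast
  then show ?thesis using that[of T] filterlim_cinv[OF g z] by (simp add: has_mderiv_def x_def)
qed

section \<open>Complexification of curves fixed by squaring\<close>

text \<open>The map \<open>sq w - 2 *\<^sub>R w\<close> has derivative 0 at the fixed point, and its
  derivative is Lipschitz; on a ball of radius \<rho> it is therefore Lipschitz with a constant of
  order \<rho>.\<close>

lemma holo_near_doubling:
  fixes sq :: "'e::{euclidean_space,complex_space} \<Rightarrow> 'e"
  assumes S: "open S" "holo_on sq S" "z0 \<in> S" and z0: "sq z0 = z0"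
    and D: "frechet_derivative sq (at z0) = (\<lambda>v. 2 *\<^sub>R v)"
  obtains \<delta> C where "\<delta> > 0" "C > 0" "ball z0 \<delta> \<subseteq> S"
    "\<And>w w' \<rho>. \<lbrakk>w \<in> cball z0 \<rho>; w' \<in> cball z0 \<rho>; \<rho> < \<delta>\<rbrakk> \<Longrightarrow>
       norm (sq w - sq w' - 2 *\<^sub>R (w - w')) \<le> C * \<rho> * norm (w - w')"
proof -
  obtain \<delta> C where \<delta>: "\<delta> > 0" "C \<ge> 0" "ball z0 \<delta> \<subseteq> S"
    and est: "\<And>w w' v. \<lbrakk>w \<in> ball z0 \<delta>; w' \<in> ball z0 \<delta>\<rbrakk> \<Longrightarrow>
      norm (frechet_derivative sq (at w) v - frechet_derivative sq (at w') v) \<le> C * norm (w - w') * norm v"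
    using holo_on_derivative_estimates[OF S] by metis
  have "norm (sq w - sq w' - 2 *\<^sub>R (w - w')) \<le> (C + 1) * \<rho> * norm (w - w')"
    if w: "w \<in> cball z0 \<rho>" "w' \<in> cball z0 \<rho>" and \<rho>: "\<rho> < \<delta>" for w w' \<rho>
  proof -
    let ?g = "\<lambda>w. sq w - 2 *\<^sub>R w" and ?g' = "\<lambda>w v. frechet_derivative sq (at w) v - 2 *\<^sub>R v"
    have \<rho>0: "\<rho> \<ge> 0" using w by (metis dist_not_less_zero mem_cball not_le order_trans)
    have "norm (?g w - ?g w') \<le> (C + 1) * \<rho> * norm (w - w')"
    proof (rule differentiable_bound[of "cball z0 \<rho>" ?g ?g'])
      fix x assume x: "x \<in> cball z0 \<rho>"
      then have x': "x \<in> ball z0 \<delta>" using \<rho> by auto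
      then have "(sq has_derivative frechet_derivative sq (at x)) (at x within cball z0 \<rho>)"
        using holo_onD(1)[OF S(2)] \<delta>(3) by (blast intro: has_derivative_at_withinI)
      then show "(?g has_derivative ?g' x) (at x within cball z0 \<rho>)"
        by (auto intro!: derivative_eq_intros)
      show "onorm (?g' x) \<le> (C + 1) * \<rho>"
      proof (rule onorm_bound)
        fix v
        have "norm (?g' x v) \<le> C * norm (x - z0) * norm v"
          using est[OF x', of z0 v] \<delta>(1) by (simp add: D)
        also have "\<dots> \<le> (C + 1) * \<rho> * norm v"
          using x \<delta>(2) by (intro mult_right_mono mult_mono) (auto simp: dist_norm norm_minus_commute)
        finally show "norm (?g' x v) \<le> (C + 1) * \<rho> * norm v" .
      qed (use \<delta> \<rho>0 in simp)
    qed (use w in auto)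
    then show ?thesis by (simp add: algebra_simps)
  qed
  then show ?thesis using that[of \<delta> "C + 1"] \<delta> by auto
qed

text \<open>Iterating \<open>y \<mapsto> sq (y (z/2))\<close> from an affine curve preserves holomorphy. It contracts the
  weighted distance \<open>sup \<bar>y - y'\<bar> / \<bar>z\<bar>^2\<close>, since \<open>sq\<close> doubles and \<open>(1/2)^2 \<cdot> 2 < 1\<close>; a curve with
  \<open>x t = sq (x (t/2))\<close> is therefore the restriction of the limit to the real axis.\<close>

lemma complexify_squaring_curve:
  fixes sq :: "'e::{euclidean_space,complex_space} \<Rightarrow> 'e" and x :: "real \<Rightarrow> 'e"
  assumes S: "open S" "holo_on sq S" "z0 \<in> S" and z0: "sq z0 = z0"
    and D: "frechet_derivative sq (at z0) = (\<lambda>v. 2 *\<^sub>R v)"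
    and x: "x 0 = z0" "(x has_vector_derivative B) (at 0)"
    and sq: "\<forall>\<^sub>F t in nhds 0. x t = sq (x (t / 2))"
  obtains \<epsilon> and y :: "complex \<Rightarrow> 'e" where "\<epsilon> > 0" "holo_on y (ball 0 \<epsilon>)" "\<And>t. \<bar>t\<bar> < \<epsilon> \<Longrightarrow> y (of_real t) = x t"
proof -
  obtain \<delta>0 C where \<delta>0: "\<delta>0 > 0" and C: "C > 0" and sub: "ball z0 \<delta>0 \<subseteq> S"
    and dbl: "\<And>w w' \<rho>. \<lbrakk>w \<in> cball z0 \<rho>; w' \<in> cball z0 \<rho>; \<rho> < \<delta>0\<rbrakk> \<Longrightarrow>
       norm (sq w - sq w' - 2 *\<^sub>R (w - w')) \<le> C * \<rho> * norm (w - w')"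
    using holo_near_doubling[OF S z0 D] by metis
  have lip: "norm (sq w - sq w') \<le> (2 + C * \<rho>) * norm (w - w')"
    if "w \<in> cball z0 \<rho>" "w' \<in> cball z0 \<rho>" "\<rho> < \<delta>0" for w w' \<rho>
  proof -
    have "norm (sq w - sq w') \<le> norm (sq w - sq w' - 2 *\<^sub>R (w - w')) + norm (2 *\<^sub>R (w - w'))"
      by (metis diff_add_cancel norm_triangle_ineq)
    moreover have "norm (2 *\<^sub>R (w - w')) = 2 * norm (w - w')" by simp
    ultimately show ?thesis using dbl[OF that] unfolding distrib_right by linarith
  qed
  \<comment> \<open>Within this radius \<open>sq\<close> is Lipschitz with constant 2 + C\<delta>
    \<le> 3. Any constant below 4 would do: halving the argument gains a factor 1/4 on quadratic
    bounds, which leaves the ratio 3/4.\<close>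
  define \<delta> where "\<delta> = min (\<delta>0 / 2) (1 / C)"
  have \<delta>: "\<delta> > 0" "\<delta> < \<delta>0" "C * \<delta> \<le> 1" using \<delta>0 C by (auto simp: \<delta>_def min_def field_simps)
  have lip3: "norm (sq w - sq w') \<le> 3 * norm (w - w')" if "w \<in> ball z0 \<delta>" "w' \<in> ball z0 \<delta>" for w w'
  proof -
    have "norm (sq w - sq w') \<le> (2 + C * \<delta>) * norm (w - w')" using that \<delta> by (intro lip) auto
    also have "\<dots> \<le> 3 * norm (w - w')" using \<delta>(3) by (intro mult_right_mono) auto
    finally show ?thesis .
  qed
  obtain k where k: "k > 0" "\<And>z (v::'e). norm (cscale z v) \<le> k * norm z * norm v"
    using cscale_bound by blast
  \<comment> \<open>One constant for both curves: \<open>M * norm z\<close> bounds the distance from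
    \<open>z0\<close> of the affine complex curve, and near 0 also that of the given curve
    \<open>x\<close>.\<close>
  define M where "M = max (k * norm B) (norm B + 1)"
  have "norm B + 1 \<le> M" by (simp add: M_def)
  then have M: "M \<ge> 1" "norm B + 1 \<le> M" using norm_ge_zero[of B] by linarith+
  have MB: "norm (cscale z B) \<le> M * norm z" for z
  proof -
    have "norm (cscale z B) \<le> (k * norm B) * norm z" using k(2)[of z B] by (simp add: mult_ac)
    also have "\<dots> \<le> M * norm z" by (intro mult_right_mono) (auto simp: M_def)
    finally show ?thesis .
  qed
  define y where "y = rec_nat (\<lambda>z. z0 + cscale z B) (\<lambda>_ f z. sq (f (z / 2)))"
  have y0: "y 0 z = z0 + cscale z B" and ySuc: "y (Suc n) z = sq (y n (z / 2))" for n z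
    by (simp_all add: y_def)
  \<comment> \<open>The first iteration step has size at most \<open>A * (norm z)\<^sup>2\<close>:
    the doubling error of \<open>sq\<close> is quadratic in the distance from the fixed point, here
    at most \<open>M * norm (z/2)\<close>.\<close>
  define A where "A = C * M\<^sup>2"
  have A: "A > 0" using C M by (simp add: A_def)

  have xder: "\<forall>\<^sub>F t in nhds 0. norm (x t - z0 - t *\<^sub>R B) \<le> \<eta> * \<bar>t\<bar>" if "\<eta> > 0" for \<eta>
  proof -
    have "\<forall>e>0. \<exists>d>0. \<forall>t. norm (t - 0) < d \<longrightarrow> norm (x t - x 0 - (t - 0) *\<^sub>R B) \<le> e * norm (t - 0)"
      using x(2) unfolding has_vector_derivative_def has_derivative_at_alt by (rule conjunct2)
    then obtain d where "d > 0" "\<forall>t. norm (t - 0) < d \<longrightarrow> norm (x t - x 0 - (t - 0) *\<^sub>R B) \<le> \<eta> * norm (t - 0)"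
      using \<open>\<eta> > 0\<close> by meson
    then have "d > 0" "\<forall>t. \<bar>t\<bar> < d \<longrightarrow> norm (x t - z0 - t *\<^sub>R B) \<le> \<eta> * \<bar>t\<bar>"
      by (simp_all only: diff_zero real_norm_def x(1))
    then show ?thesis unfolding eventually_nhds_metric dist_norm diff_zero real_norm_def by blast
  qed
  obtain \<epsilon>1 where \<epsilon>1: "\<epsilon>1 > 0" "\<And>t. \<bar>t\<bar> < \<epsilon>1 \<Longrightarrow> x t = sq (x (t/2))"
    "\<And>t. \<bar>t\<bar> < \<epsilon>1 \<Longrightarrow> norm (x t - z0 - t *\<^sub>R B) \<le> 1 * \<bar>t\<bar>"
  proof -
    obtain d where d: "d > 0" "\<forall>t. dist t 0 < d \<longrightarrow> x t = sq (x (t/2)) \<and> norm (x t - z0 - t *\<^sub>R B) \<le> 1 * \<bar>t\<bar>"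
      using eventually_conj[OF sq xder[OF zero_less_one]] unfolding eventually_nhds_metric by meson
    show ?thesis by (rule that[of d]) (use d(1) d(2)[unfolded dist_norm diff_zero real_norm_def] in blast)+
  qed
  \<comment> \<open>All iterates differ from the affine curve by at most A(1 + 3/4 + (3/4)^2 + ...)
    = 4A times the squared norm of \<open>z\<close>; for |z| < \<epsilon> \<le> 1 this and
    \<open>M * norm z\<close> together stay below \<delta>.\<close>
  define \<epsilon> where "\<epsilon> = min (min \<epsilon>1 1) (\<delta> / (2 * (M + 4 * A)))"
  have MA: "M + 4 * A > 0" using M A by simp
  have \<epsilon>: "\<epsilon> > 0" "\<epsilon> \<le> \<epsilon>1" "\<epsilon> \<le> 1" "\<epsilon> * (M + 4 * A) < \<delta>"
  proof -
    show "\<epsilon> > 0" "\<epsilon> \<le> \<epsilon>1" "\<epsilon> \<le> 1" using \<epsilon>1(1) \<delta> MA by (auto simp: \<epsilon>_def)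
    have "\<epsilon> \<le> \<delta> / (2 * (M + 4 * A))" by (simp add: \<epsilon>_def)
    then have "\<epsilon> * (M + 4 * A) \<le> \<delta> / 2" using MA by (simp add: field_simps)
    then show "\<epsilon> * (M + 4 * A) < \<delta>" using \<delta> by simp
  qed
  have small: "M * r + 4 * A * r\<^sup>2 < \<delta>" if "0 \<le> r" "r < \<epsilon>" for r
  proof -
    have "r\<^sup>2 \<le> r" using that \<epsilon>(3) by (simp add: power2_eq_square mult_left_le)
    then have "4 * A * r\<^sup>2 \<le> 4 * A * r" using A by simp
    then have "M * r + 4 * A * r\<^sup>2 \<le> r * (M + 4 * A)" by (simp add: algebra_simps)
    also have "\<dots> \<le> \<epsilon> * (M + 4 * A)" using that MA by simp
    finally show ?thesis using \<epsilon>(4) by simp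
  qed
  have small': "M * r < \<delta>" if "0 \<le> r" "r < \<epsilon>" for r
    using small[OF that] A by (smt (verit) mult_nonneg_nonneg zero_le_power2)
  have in_ball: "w \<in> ball z0 \<delta>" if "norm (w - y 0 z) \<le> 4 * A * (norm z)\<^sup>2" "norm z < \<epsilon>" for w z
  proof -
    have "w - z0 = (w - y 0 z) + cscale z B" by (simp add: y0)
    then have "norm (w - z0) \<le> norm (w - y 0 z) + norm (cscale z B)"
      by (simp only: norm_triangle_ineq)
    then have "norm (w - z0) \<le> 4 * A * (norm z)\<^sup>2 + M * norm z"
      using that(1) MB[of z] by linarith
    then have "norm (w - z0) < \<delta>" using small[of "norm z"] that(2) by simp
    then show ?thesis by (simp add: dist_norm norm_minus_commute)
  qed
  have first: "norm (y 1 z - y 0 z) \<le> A * (norm z)\<^sup>2" if z: "norm z < \<epsilon>" for z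
  proof -
    let ?w = "z0 + cscale (z/2) B" and ?\<rho> = "M * norm (z/2)"
    have *: "norm (cscale (z/2) B) \<le> ?\<rho>" by (rule MB)
    have "?\<rho> < \<delta>" using small'[of "norm (z/2)"] z \<epsilon>(1) by (simp add: norm_divide)
    then have "norm (sq ?w - sq z0 - 2 *\<^sub>R (?w - z0)) \<le> C * ?\<rho> * norm (?w - z0)"
      using * M(1) \<delta>(2) by (intro dbl) (auto simp: dist_norm)
    also have "\<dots> \<le> C * ?\<rho> * ?\<rho>" using * C M(1) by (intro mult_left_mono) auto
    also have "\<dots> \<le> A * (norm z)\<^sup>2"
    proof -
      have "C * ?\<rho> * ?\<rho> = A * (norm z)\<^sup>2 / 4" by (simp add: A_def norm_divide power2_eq_square)
      moreover have "0 \<le> A * (norm z)\<^sup>2" using A by simp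
      ultimately show ?thesis by linarith
    qed
    also have "sq ?w - sq z0 - 2 *\<^sub>R (?w - z0) = y 1 z - y 0 z"
      by (simp add: y0 ySuc z0 cscale_def scaleR_add_right)
    finally show ?thesis .
  qed
  \<comment> \<open>Both bounds must be carried together: the second keeps the iterates in the ball
    where \<open>lip3\<close> applies, and \<open>lip3\<close> yields the first.\<close>
  have PQ: "\<forall>z. norm z < \<epsilon> \<longrightarrow> norm (y (Suc n) z - y n z) \<le> (3/4)^n * A * (norm z)\<^sup>2 \<and>
      norm (y n z - y 0 z) \<le> 4 * A * (1 - (3/4)^n) * (norm z)\<^sup>2" for n
  proof (induction n)
    case 0 then show ?case using first by simp
  next
    case (Suc n)
    have Q: "norm (y (Suc n) z - y 0 z) \<le> 4 * A * (1 - (3/4)^(Suc n)) * (norm z)\<^sup>2" if "norm z < \<epsilon>" for z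
    proof -
      have "norm (y (Suc n) z - y 0 z) \<le> norm (y (Suc n) z - y n z) + norm (y n z - y 0 z)"
        by (metis diff_add_cancel diff_add_eq diff_diff_eq2 norm_triangle_ineq)
      also have "\<dots> \<le> (3/4)^n * A * (norm z)\<^sup>2 + 4 * A * (1 - (3/4)^n) * (norm z)\<^sup>2"
        using Suc that by (intro add_mono) blast+
      finally show ?thesis by (simp add: algebra_simps)
    qed
    have le: "4 * A * (1 - (3/4)^j) * s\<^sup>2 \<le> 4 * A * s\<^sup>2" for j and s :: real
      using A by (intro mult_right_mono) auto
    have "norm (y (Suc (Suc n)) z - y (Suc n) z) \<le> (3/4)^(Suc n) * A * (norm z)\<^sup>2" if z: "norm z < \<epsilon>" for z
    proof -
      have z2: "norm (z/2) < \<epsilon>" using z \<epsilon>(1) by (simp add: norm_divide)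
      have "norm (sq (y (Suc n) (z/2)) - sq (y n (z/2))) \<le> 3 * norm (y (Suc n) (z/2) - y n (z/2))"
        using z2 Suc.IH Q[OF z2] le by (intro lip3 in_ball[of _ "z/2"]) (blast intro: order_trans)+
      also have "\<dots> \<le> 3 * ((3/4)^n * A * (norm (z/2))\<^sup>2)"
        by (rule mult_left_mono) (use z2 Suc.IH in blast, simp)
      finally show ?thesis by (simp add: ySuc norm_divide power2_eq_square field_simps)
    qed
    with Q show ?case by blast
  qed
  have yball: "y n z \<in> ball z0 \<delta>" if "norm z < \<epsilon>" for n z
  proof (rule in_ball[OF _ that])
    have "norm (y n z - y 0 z) \<le> 4 * A * (1 - (3/4)^n) * (norm z)\<^sup>2" using PQ that by blast
    also have "\<dots> \<le> 4 * A * (norm z)\<^sup>2" using A by (intro mult_right_mono) auto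
    finally show "norm (y n z - y 0 z) \<le> 4 * A * (norm z)\<^sup>2" .
  qed
  have yholo: "holo_on (y n) (ball 0 \<epsilon>)" for n
  proof (induction n)
    case 0
    have "y 0 = (\<lambda>z. z0 + cscale z B)" by (auto simp: y0)
    then show ?case using holo_on_line by metis
  next
    case (Suc n)
    have half: "holo_on (\<lambda>z::complex. z / 2) (ball 0 \<epsilon>)"
      by (rule holo_on_linear) (auto simp: imult_complex_def bounded_linear_divide)
    have "holo_on (\<lambda>z. y n (z/2)) (ball 0 \<epsilon>)"
      by (rule holo_on_compose[OF half Suc]) (use \<epsilon>(1) in \<open>auto simp: norm_divide\<close>)
    moreover have "(\<lambda>z. y n (z/2)) ` ball 0 \<epsilon> \<subseteq> S"
    proof (clarify)
      fix z :: complex assume "z \<in> ball 0 \<epsilon>"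
      then have "norm (z/2) < \<epsilon>" using \<epsilon>(1) by (simp add: norm_divide)
      then have "y n (z/2) \<in> ball z0 \<delta>" by (rule yball)
      then show "y n (z/2) \<in> S" using sub \<delta>(2) by auto
    qed
    ultimately have "holo_on (\<lambda>z. sq (y n (z/2))) (ball 0 \<epsilon>)" using holo_on_compose S(2) by blast
    moreover have "y (Suc n) = (\<lambda>z. sq (y n (z/2)))" by (auto simp: ySuc)
    ultimately show ?case by simp
  qed
  \<comment> \<open>As a telescoping series the iteration is dominated by a geometric one, so it
    converges uniformly and the limit is holomorphic.\<close>
  define f where "f = (\<lambda>i z. y (Suc i) z - y i z)"
  define g where "g = (\<lambda>z. y 0 z + (\<Sum>i. f i z))"
  have "uniform_limit (ball 0 \<epsilon>) (\<lambda>n z. \<Sum>i<n. f i z) (\<lambda>z. \<Sum>i. f i z) sequentially"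
  proof (rule Weierstrass_m_test)
    show "norm (f n z) \<le> (3/4)^n * (A * \<epsilon>\<^sup>2)" if "z \<in> ball 0 \<epsilon>" for n z
    proof -
      have "norm (f n z) \<le> (3/4)^n * A * (norm z)\<^sup>2" using PQ that by (simp add: f_def)
      also have "\<dots> \<le> (3/4)^n * A * \<epsilon>\<^sup>2" using that A by (intro mult_left_mono power_mono) auto
      finally show ?thesis by (simp add: mult.assoc)
    qed
    show "summable (\<lambda>n. (3/4)^n * (A * \<epsilon>\<^sup>2))" by (intro summable_mult2 summable_geometric) simp
  qed
  then have "uniform_limit (ball 0 \<epsilon>) (\<lambda>n z. y 0 z + (\<Sum>i<n. f i z)) g sequentially"
    unfolding g_def by (intro uniform_limit_add uniform_limit_const)
  moreover have "y 0 z + (\<Sum>i<n. f i z) = y n z" for n z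
    unfolding f_def by (subst sum_lessThan_telescope) simp
  ultimately have ul: "uniform_limit (ball 0 \<epsilon>) y g sequentially" by simp
  have gholo: "holo_on g (ball 0 \<epsilon>)"
  proof (rule holo_on_cfunI)
    fix b :: 'e
    have ul': "uniform_limit (ball 0 \<epsilon>) (\<lambda>n z. cfun b (y n z)) (\<lambda>z. cfun b (g z)) sequentially"
      using bounded_linear.uniform_limit[OF bounded_linear_cfun ul] .
    have "(\<lambda>z. cfun b (g z)) holomorphic_on ball 0 \<epsilon>"
    proof (rule holomorphic_uniform_sequence[where f="\<lambda>n z. cfun b (y n z)"])
      show "(\<lambda>z. cfun b (y n z)) holomorphic_on ball 0 \<epsilon>" for n
        using holo_on_cfun[OF yholo, of b n] holo_on_complex_iff by blast
      show "\<exists>d>0. cball z d \<subseteq> ball 0 \<epsilon> \<and>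
          uniform_limit (cball z d) (\<lambda>n z. cfun b (y n z)) (\<lambda>z. cfun b (g z)) sequentially"
        if "z \<in> ball 0 \<epsilon>" for z
        using open_contains_cball[of "ball (0::complex) \<epsilon>"] that uniform_limit_on_subset[OF ul']
        by (meson open_ball)
    qed simp
    then show "holo_on (\<lambda>z. cfun b (g z)) (ball 0 \<epsilon>)" using holo_on_complex_iff by blast
  qed
  have "g (of_real t) = x t" if t: "\<bar>t\<bar> < \<epsilon>" for t
  proof -
    \<comment> \<open>Differentiability of \<open>x\<close> at 0 gives only e(s) = o(s), whereas the
      contraction requires a quadratic bound. The equation for \<open>x\<close> gives e(s) \<le> 2
      e(s/2) + 2A s^2; iterated, the term 2^n e(s/2^n) vanishes in the limit and the quadratic terms
      sum to 4A s^2.\<close>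
    define e where "e = (\<lambda>t. norm (x t - y 0 (of_real t)))"
    have e_alt: "e s = norm (x s - z0 - s *\<^sub>R B)" for s
      by (simp add: e_def y0 cscale_of_real diff_diff_eq)
    have xM: "norm (x s - z0) \<le> M * \<bar>s\<bar>" if "\<bar>s\<bar> < \<epsilon>" for s
    proof -
      have "norm (x s - z0) \<le> norm (x s - z0 - s *\<^sub>R B) + norm (s *\<^sub>R B)"
        by (metis diff_add_cancel norm_triangle_ineq)
      also have "\<dots> \<le> (norm B + 1) * \<bar>s\<bar>" using \<epsilon>1(3)[of s] that \<epsilon>(2) by (simp add: algebra_simps)
      also have "\<dots> \<le> M * \<bar>s\<bar>" using M by (intro mult_right_mono) auto
      finally show ?thesis .
    qed
    have erec: "e s \<le> 2 * e (s/2) + 2 * A * s\<^sup>2" if s: "\<bar>s\<bar> < \<epsilon>" for s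
    proof -
      let ?\<rho> = "M * \<bar>s/2\<bar>"
      have s2: "\<bar>s/2\<bar> < \<epsilon>" using s by simp
      have "?\<rho> < \<delta>0" using small'[of "\<bar>s/2\<bar>"] s2 \<delta>(2) by simp
      moreover have "norm (cscale (of_real (s/2)) B) \<le> ?\<rho>" using MB[of "of_real (s/2)"] by simp
      ultimately have "norm (sq (x (s/2)) - sq (y 0 (of_real (s/2)))) \<le> (2 + C * ?\<rho>) * e (s/2)"
        unfolding e_def using xM[OF s2] by (intro lip) (auto simp: dist_norm norm_minus_commute y0)
      also have "\<dots> = 2 * e (s/2) + C * ?\<rho> * e (s/2)" by (simp add: algebra_simps)
      also have "e (s/2) \<le> \<bar>s/2\<bar>" using \<epsilon>1(3)[of "s/2"] s2 \<epsilon>(2) by (simp add: e_alt)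
      then have "C * ?\<rho> * e (s/2) \<le> C * ?\<rho> * \<bar>s/2\<bar>" using C M by (intro mult_left_mono) auto
      also have "\<dots> \<le> A * s\<^sup>2"
      proof -
        have "M * s\<^sup>2 \<le> 4 * (M\<^sup>2 * s\<^sup>2)"
          using M(1) by (intro order_trans[OF mult_right_mono[of M "M\<^sup>2" "s\<^sup>2"]]) (auto simp: power2_eq_square)
        then have "C * (M * s\<^sup>2) \<le> C * (4 * (M\<^sup>2 * s\<^sup>2))" using C by simp
        moreover have "C * ?\<rho> * \<bar>s/2\<bar> = C * (M * (\<bar>s\<bar> * \<bar>s\<bar>)) / 4" by simp
        then have "C * ?\<rho> * \<bar>s/2\<bar> = C * (M * s\<^sup>2) / 4"
          by (simp only: abs_mult_self_eq power2_eq_square)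
        moreover have "A * s\<^sup>2 = C * (4 * (M\<^sup>2 * s\<^sup>2)) / 4" by (simp add: A_def)
        ultimately show ?thesis by linarith
      qed
      finally have "norm (sq (x (s/2)) - sq (y 0 (of_real (s/2)))) \<le> 2 * e (s/2) + A * s\<^sup>2" by simp
      moreover have "x s = sq (x (s/2))" by (rule \<epsilon>1(2)) (use s \<epsilon>(2) in linarith)
      ultimately have "norm (x s - y 1 (of_real s)) \<le> 2 * e (s/2) + A * s\<^sup>2"
        using ySuc[of 0 "of_real s"] by simp
      moreover have "norm (y 1 (of_real s) - y 0 (of_real s)) \<le> A * s\<^sup>2"
        using first[of "of_real s"] s by simp
      moreover have "e s \<le> norm (x s - y 1 (of_real s)) + norm (y 1 (of_real s) - y 0 (of_real s))"
        unfolding e_def by (metis diff_add_cancel diff_add_eq diff_diff_eq2 norm_triangle_ineq)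
      ultimately show ?thesis by simp
    qed
    have eiter: "e s \<le> 2^n * e (s / 2^n) + 4 * A * s\<^sup>2 * (1 - (1/2)^n)" if s: "\<bar>s\<bar> < \<epsilon>" for n s
      using s
    proof (induction n arbitrary: s)
      case (Suc n)
      have "e s \<le> 2 * e (s/2) + 2 * A * s\<^sup>2" by (rule erec[OF Suc.prems])
      also have "\<dots> \<le> 2 * (2^n * e (s/2/2^n) + 4 * A * (s/2)\<^sup>2 * (1 - (1/2)^n)) + 2 * A * s\<^sup>2"
        using Suc.IH[of "s/2"] Suc.prems by (intro add_right_mono mult_left_mono) simp_all
      also have "\<dots> = 2^Suc n * e (s / 2^Suc n) + 4 * A * s\<^sup>2 * (1 - (1/2)^Suc n)"
        by (simp add: power2_eq_square field_simps)
      finally show ?case .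
    qed simp
    have e2: "e s \<le> 4 * A * s\<^sup>2" if s: "\<bar>s\<bar> < \<epsilon>" for s
    proof (rule field_le_epsilon)
      fix \<eta> :: real assume \<eta>: "\<eta> > 0"
      have "(\<lambda>n. s * (1/2)^n) \<longlonglongrightarrow> s * 0" by (intro tendsto_intros LIMSEQ_power_zero) simp
      then have "filterlim (\<lambda>n. s / 2^n) (nhds 0) sequentially" by (simp add: power_divide)
      then have "\<forall>\<^sub>F n in sequentially. norm (x (s/2^n) - z0 - (s/2^n) *\<^sub>R B) \<le> \<eta> * \<bar>s/2^n\<bar>"
        by (rule eventually_compose_filterlim[OF xder[OF \<eta>]])
      then obtain n where "norm (x (s/2^n) - z0 - (s/2^n) *\<^sub>R B) \<le> \<eta> * \<bar>s/2^n\<bar>"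
        using eventually_happens'[OF sequentially_bot] by blast
      then have "e (s/2^n) \<le> \<eta> * \<bar>s/2^n\<bar>" by (simp only: e_alt)
      then have "2^n * e (s/2^n) \<le> \<eta> * \<bar>s\<bar>" by (simp add: abs_divide field_simps)
      also have "\<dots> \<le> \<eta>" using s \<epsilon>(3) \<eta> by (simp add: mult_left_le)
      finally have "e s \<le> \<eta> + 4 * A * s\<^sup>2 * (1 - (1/2)^n)" using eiter[OF s, of n] by simp
      also have "4 * A * s\<^sup>2 * (1 - (1/2)^n) \<le> 4 * A * s\<^sup>2 * 1" using A by (intro mult_left_mono) auto
      finally show "e s \<le> 4 * A * s\<^sup>2 + \<eta>" by simp
    qed
    \<comment> \<open>\<open>x\<close> is fixed by the map that is iterated to produce
      \<open>y n\<close>, so each step shrinks their quadratically weighted distance by 3/4.\<close>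
    have conv: "\<forall>s. \<bar>s\<bar> < \<epsilon> \<longrightarrow> norm (x s - y n (of_real s)) \<le> (3/4)^n * (4 * A) * s\<^sup>2" for n
    proof (induction n)
      case 0 then show ?case using e2 by (simp add: e_def)
    next
      case (Suc n)
      show ?case
      proof (intro allI impI)
        fix s :: real assume s: "\<bar>s\<bar> < \<epsilon>"
        then have s2: "\<bar>s/2\<bar> < \<epsilon>" by simp
        have "x (s/2) \<in> ball z0 \<delta>"
          using xM[OF s2] small'[of "\<bar>s/2\<bar>"] s2 by (simp add: dist_norm norm_minus_commute)
        moreover have "y n (of_real (s/2)) \<in> ball z0 \<delta>" using s2 by (intro yball) simp
        ultimately have "norm (sq (x (s/2)) - sq (y n (of_real (s/2)))) \<le> 3 * norm (x (s/2) - y n (of_real (s/2)))"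
          by (rule lip3)
        also have "\<dots> \<le> 3 * ((3/4)^n * (4 * A) * (s/2)\<^sup>2)"           by (rule mult_left_mono) (use s2 Suc.IH in blast, simp)
        finally show "norm (x s - y (Suc n) (of_real s)) \<le> (3/4)^Suc n * (4 * A) * s\<^sup>2"
          using \<epsilon>1(2)[of s] s \<epsilon>(2) by (simp add: ySuc power2_eq_square field_simps)
      qed
    qed
    have "(\<lambda>n. (3/4)^n * (4 * A) * t\<^sup>2) \<longlonglongrightarrow> 0 * (4 * A) * t\<^sup>2"
      by (intro tendsto_intros LIMSEQ_power_zero) simp
    then have "(\<lambda>n. (3/4)^n * (4 * A) * t\<^sup>2) \<longlonglongrightarrow> 0" by simp
    then have "(\<lambda>n. x t - y n (of_real t)) \<longlonglongrightarrow> 0"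
      by (rule Lim_null_comparison[rotated]) (intro always_eventually allI conv[rule_format] t)
    then have "(\<lambda>n. x t - (x t - y n (of_real t))) \<longlonglongrightarrow> x t - 0" by (intro tendsto_intros)
    then have "(\<lambda>n. y n (of_real t)) \<longlonglongrightarrow> x t" by simp
    moreover have "(\<lambda>n. y n (of_real t)) \<longlonglongrightarrow> g (of_real t)"
      using tendsto_uniform_limitI[OF ul] t by simp
    ultimately show ?thesis using LIMSEQ_unique by blast
  qed
  with gholo \<epsilon>(1) show ?thesis by (intro that[of \<epsilon> g])
qed

section \<open>Right-invariant calculus on the complexified group\<close>

locale complexified_group =
  fixes GC :: "('g::t2_space) monoid"
    and \<kappa> :: "('g, 'e::{euclidean_space,complex_space}) charts"
    and G :: "'g set"
    and m :: "'g \<Rightarrow> 'e \<Rightarrow> 'e \<Rightarrow> real"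
    and X :: "'m::finite \<Rightarrow> 'e"
  assumes complexification: "complexification GC \<kappa> G"
    and metric: "bi_invariant_metric GC \<kappa> G m"
    and basis_span: "span (range X) = lie_algebra GC \<kappa> G"
    and basis_ortho: "\<And>a b. m \<one>\<^bsub>GC\<^esub> (X a) (X b) = (if a = b then 1 else 0)"
begin

abbreviation gmult :: "'g \<Rightarrow> 'g \<Rightarrow> 'g" (infixl "\<cdot>" 70) where "x \<cdot> y \<equiv> x \<otimes>\<^bsub>GC\<^esub> y"
abbreviation ginv :: "'g \<Rightarrow> 'g" where "ginv x \<equiv> inv\<^bsub>GC\<^esub> x"
abbreviation gone :: "'g" ("\<e>") where "\<e> \<equiv> \<one>\<^bsub>GC\<^esub>"
abbreviation Lie :: "'e set" where "Lie \<equiv> lie_algebra GC \<kappa> G"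

lemma clg: "complex_lie_group GC \<kappa>" and sub_G: "subgroup G GC" and compact_G: "compact G"
  using complexification unfolding complexification_def by blast+

lemma group_GC: "group GC" and carrier_UNIV: "carrier GC = UNIV" and atlas: "complex_atlas \<kappa>"
  and holo_mult: "holo_map (prod_charts \<kappa> \<kappa>) \<kappa> (\<lambda>(x, y). x \<cdot> y)"
  and holo_inv: "holo_map \<kappa> \<kappa> ginv"
  using clg unfolding complex_lie_group_def by blast+

lemma good: "good_charts \<kappa>"
  by (rule complex_atlas_good[OF atlas])

lemma in_carrier [simp]: "x \<in> carrier GC"
  by (simp add: carrier_UNIV)

lemma gmult_assoc: "x \<cdot> y \<cdot> z = x \<cdot> (y \<cdot> z)"
  and one_gmult [simp]: "\<e> \<cdot> x = x"
  and gmult_one [simp]: "x \<cdot> \<e> = x"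
  and ginv_gmult [simp]: "ginv x \<cdot> x = \<e>"
  and gmult_ginv [simp]: "x \<cdot> ginv x = \<e>"
  and ginv_gmult_cancel [simp]: "ginv x \<cdot> (x \<cdot> y) = y"
  and gmult_ginv_cancel [simp]: "x \<cdot> (ginv x \<cdot> y) = y"
proof -
  interpret group GC by (rule group_GC)
  show "x \<cdot> y \<cdot> z = x \<cdot> (y \<cdot> z)" "\<e> \<cdot> x = x" "x \<cdot> \<e> = x" "ginv x \<cdot> x = \<e>" "x \<cdot> ginv x = \<e>"
    by (simp_all add: m_assoc)
  show "ginv x \<cdot> (x \<cdot> y) = y" "x \<cdot> (ginv x \<cdot> y) = y"
    by (simp_all flip: m_assoc)
qed

lemma G_one: "\<e> \<in> G" and G_mult: "x \<in> G \<Longrightarrow> y \<in> G \<Longrightarrow> x \<cdot> y \<in> G" and G_inv: "x \<in> G \<Longrightarrow> ginv x \<in> G"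
  using sub_G by (auto simp: subgroup.one_closed subgroup.m_closed subgroup.m_inv_closed)

lemma continuous_on_gmult:
  assumes "continuous_on S f" "continuous_on S g"
  shows "continuous_on S (\<lambda>x. f x \<cdot> g x)"
proof -
  have "continuous_on UNIV (\<lambda>(x, y). x \<cdot> y)" using holo_mult unfolding holo_map_def by blast
  from continuous_on_compose2[OF this continuous_on_Pair[OF assms]] show ?thesis by simp
qed

lemma continuous_on_ginv: "continuous_on S f \<Longrightarrow> continuous_on S (\<lambda>x. ginv (f x))"
  using continuous_on_compose2[of UNIV ginv S f] holo_inv unfolding holo_map_def by blast

subsection \<open>Translations\<close>

lemma good_prod: "good_charts (prod_charts \<kappa> \<kappa>)"
  by (rule good_prod_charts[OF good good])

text \<open>Both translations are restrictions of this one differential: the product rule is its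
  additivity, and complex linearity of \<open>dR\<close> and \<open>dL\<close> is inherited from
  holomorphy of the multiplication.\<close>

definition dmult :: "'g \<Rightarrow> 'g \<Rightarrow> 'e \<times> 'e \<Rightarrow> 'e" where
  "dmult x y = mdiff (prod_charts \<kappa> \<kappa>) \<kappa> (\<lambda>(x, y). x \<cdot> y) (x, y)"

lemma has_mderiv_dmult: "has_mderiv (prod_charts \<kappa> \<kappa>) \<kappa> (\<lambda>(x, y). x \<cdot> y) (x, y) (dmult x y)"
  and dmult_imult: "dmult x y (imult v) = imult (dmult x y v)"
  unfolding dmult_def
  by (rule holo_map_has_mderiv(1)[OF good_prod good holo_mult], rule holo_map_has_mderiv(2)[OF good_prod good holo_mult])

lemma has_mderiv_gmult_Pair:
  assumes "good_charts \<kappa>'" "has_mderiv \<kappa>' \<kappa> F p F'" "has_mderiv \<kappa>' \<kappa> H p H'"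
  shows "has_mderiv \<kappa>' \<kappa> (\<lambda>x. F x \<cdot> H x) p (\<lambda>v. dmult (F p) (H p) (F' v, H' v))"
  using has_mderiv_compose[OF assms(1) good_prod has_mderiv_Pair[OF assms(2,3)] has_mderiv_dmult] by simp

lemma dR_eq: "dR GC \<kappa> h g v = dmult g h (v, 0)"
  unfolding dR_def
  by (simp add: has_mderiv_mdiff[OF has_mderiv_gmult_Pair[OF good has_mderiv_ident[OF good] has_mderiv_const]])

lemma dL_eq: "dL GC \<kappa> h g v = dmult h g (0, v)"
  unfolding dL_def
  by (simp add: has_mderiv_mdiff[OF has_mderiv_gmult_Pair[OF good has_mderiv_const has_mderiv_ident[OF good]]])

lemma dmult_split: "dmult x y (u, v) = dR GC \<kappa> y x u + dL GC \<kappa> x y v"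
  using linear_add[OF bounded_linear.linear[OF has_mderiv_bounded_linear[OF has_mderiv_dmult]], of x y "(u, 0)" "(0, v)"]
  by (simp add: dR_eq dL_eq)

lemma has_mderiv_gmult:
  assumes "good_charts \<kappa>'" "has_mderiv \<kappa>' \<kappa> F p F'" "has_mderiv \<kappa>' \<kappa> H p H'"
  shows "has_mderiv \<kappa>' \<kappa> (\<lambda>x. F x \<cdot> H x) p (\<lambda>v. dR GC \<kappa> (H p) (F p) (F' v) + dL GC \<kappa> (F p) (H p) (H' v))"
  using has_mderiv_gmult_Pair[OF assms] by (simp add: dmult_split)

lemma has_mderiv_dR: "has_mderiv \<kappa> \<kappa> (\<lambda>x. x \<cdot> h) g (dR GC \<kappa> h g)"
  using has_mderiv_gmult_Pair[OF good has_mderiv_ident[OF good] has_mderiv_const]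
  by (simp flip: dR_eq add: eta_contract_eq)

lemma has_mderiv_dL: "has_mderiv \<kappa> \<kappa> (\<lambda>x. h \<cdot> x) g (dL GC \<kappa> h g)"
  using has_mderiv_gmult_Pair[OF good has_mderiv_const has_mderiv_ident[OF good]]
  by (simp flip: dL_eq add: eta_contract_eq)

lemma linear_dR: "linear (dR GC \<kappa> h g)"
  using bounded_linear.linear has_mderiv_bounded_linear has_mderiv_dR by blast

lemma linear_dL: "linear (dL GC \<kappa> h g)"
  using bounded_linear.linear has_mderiv_bounded_linear has_mderiv_dL by blast

lemma dR_imult: "dR GC \<kappa> h g (imult v) = imult (dR GC \<kappa> h g v)"
  using dmult_imult[of g h "(v, 0)"] by (simp add: dR_eq imult_prod_def)

lemma dL_imult: "dL GC \<kappa> h g (imult v) = imult (dL GC \<kappa> h g v)"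
  using dmult_imult[of h g "(0, v)"] by (simp add: dL_eq imult_prod_def)

lemma has_mderiv_right_gmult:
  assumes "good_charts \<kappa>'" "has_mderiv \<kappa>' \<kappa> F p F'"
  shows "has_mderiv \<kappa>' \<kappa> (\<lambda>x. F x \<cdot> h) p (\<lambda>v. dR GC \<kappa> h (F p) (F' v))"
  by (rule has_mderiv_compose[OF assms(1) good assms(2) has_mderiv_dR])

lemma has_mderiv_left_gmult:
  assumes "good_charts \<kappa>'" "has_mderiv \<kappa>' \<kappa> F p F'"
  shows "has_mderiv \<kappa>' \<kappa> (\<lambda>x. h \<cdot> F x) p (\<lambda>v. dL GC \<kappa> h (F p) (F' v))"
  by (rule has_mderiv_compose[OF assms(1) good assms(2) has_mderiv_dL])

lemma dR_one: "dR GC \<kappa> \<e> g v = v"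
  using has_mderiv_unique[OF has_mderiv_dR[of \<e> g]] has_mderiv_ident[OF good] by (metis gmult_one ext)

lemma dR_dR: "dR GC \<kappa> k (g \<cdot> h) (dR GC \<kappa> h g v) = dR GC \<kappa> (h \<cdot> k) g v"
  using has_mderiv_unique[OF has_mderiv_right_gmult[OF good has_mderiv_dR[of h g], of k]]
    has_mderiv_dR[of "h \<cdot> k" g] by (metis (no_types, lifting) gmult_assoc ext)

lemma dR_inverse: "dR GC \<kappa> (ginv g) g (dR GC \<kappa> g \<e> v) = v"
  using dR_dR[of "ginv g" \<e> g v] by (simp add: dR_one)

subsection \<open>One-parameter subgroups and the adjoint action\<close>

lemma one_param_zero: "one_param GC \<kappa> Y \<gamma> \<Longrightarrow> \<gamma> 0 = \<e>"
proof -
  assume "one_param GC \<kappa> Y \<gamma>"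
  then have "\<gamma> 0 = \<gamma> 0 \<cdot> \<gamma> 0" unfolding one_param_def by (metis add_0)
  then show ?thesis by (metis ginv_gmult ginv_gmult_cancel)
qed

lemma one_param_add: "one_param GC \<kappa> Y \<gamma> \<Longrightarrow> \<gamma> (s + t) = \<gamma> s \<cdot> \<gamma> t"
  unfolding one_param_def by blast

lemma one_param_minus: "one_param GC \<kappa> Y \<gamma> \<Longrightarrow> \<gamma> (- t) = ginv (\<gamma> t)"
  using one_param_add[of Y \<gamma> t "- t"] one_param_zero[of Y \<gamma>] by (metis add.right_inverse ginv_gmult_cancel gmult_one)

lemma one_param_continuous: "one_param GC \<kappa> Y \<gamma> \<Longrightarrow> continuous_on UNIV \<gamma>"
  unfolding one_param_def by blast

lemma one_param_has_mderiv:
  assumes "one_param GC \<kappa> Y \<gamma>"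
  shows "has_mderiv std_charts \<kappa> \<gamma> 0 (\<lambda>s. s *\<^sub>R Y)"
proof -
  have "(\<gamma> \<longlongrightarrow> \<gamma> 0) (nhds 0)"
    using one_param_continuous[OF assms] by (metis UNIV_I continuous_on_def tendsto_at_iff_tendsto_nhds)
  then show ?thesis using assms one_param_zero[OF assms]
    by (simp add: has_mderiv_def one_param_def has_vector_derivative_def o_def)
qed

definition Ad :: "'g \<Rightarrow> 'e \<Rightarrow> 'e" where
  "Ad k v = dL GC \<kappa> k (ginv k) (dR GC \<kappa> (ginv k) \<e> v)"

lemma has_mderiv_conj:
  assumes "good_charts \<kappa>'" "has_mderiv \<kappa>' \<kappa> F p F'" "F p = \<e>"
  shows "has_mderiv \<kappa>' \<kappa> (\<lambda>x. k \<cdot> (F x \<cdot> ginv k)) p (\<lambda>v. Ad k (F' v))"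
  using has_mderiv_left_gmult[OF assms(1) has_mderiv_right_gmult[OF assms(1,2), of "ginv k"], of k]
  by (simp add: Ad_def assms(3))

lemma linear_Ad: "linear (Ad k)"
  unfolding Ad_def using linear_compose[OF linear_dR linear_dL] by (simp add: o_def)

lemma Ad_imult: "Ad k (imult v) = imult (Ad k v)"
  by (simp add: Ad_def dR_imult dL_imult)

text \<open>From k x g = (k x k^-1)(k g): translation from the left carries right-invariant vector
  fields to right-invariant ones, with the generator changed by \<open>Ad k\<close>.\<close>

lemma dL_dR: "dL GC \<kappa> k g (dR GC \<kappa> g \<e> v) = dR GC \<kappa> (k \<cdot> g) \<e> (Ad k v)"
proof -
  have 1: "has_mderiv \<kappa> \<kappa> (\<lambda>x. k \<cdot> (x \<cdot> g)) \<e> (\<lambda>v. dL GC \<kappa> k g (dR GC \<kappa> g \<e> v))"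
    using has_mderiv_left_gmult[OF good has_mderiv_dR[of g \<e>], of k] by simp
  have "has_mderiv \<kappa> \<kappa> (\<lambda>x. (k \<cdot> (x \<cdot> ginv k)) \<cdot> (k \<cdot> g)) \<e> (\<lambda>v. dR GC \<kappa> (k \<cdot> g) \<e> (Ad k v))"
    using has_mderiv_right_gmult[OF good has_mderiv_conj[OF good has_mderiv_ident[OF good], of \<e> k], of "k \<cdot> g"] by simp
  then have 2: "has_mderiv \<kappa> \<kappa> (\<lambda>x. k \<cdot> (x \<cdot> g)) \<e> (\<lambda>v. dR GC \<kappa> (k \<cdot> g) \<e> (Ad k v))"
    by (simp add: gmult_assoc)
  show ?thesis by (rule fun_cong[OF has_mderiv_unique[OF 1 2]])
qed

lemma one_param_conj:
  assumes "one_param GC \<kappa> Y \<gamma>"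
  shows "one_param GC \<kappa> (Ad k Y) (\<lambda>t. k \<cdot> (\<gamma> t \<cdot> ginv k))"
  unfolding one_param_def
proof (intro conjI allI)
  show "continuous_on UNIV (\<lambda>t. k \<cdot> (\<gamma> t \<cdot> ginv k))"
    by (intro continuous_on_gmult continuous_on_const one_param_continuous[OF assms])
  show "k \<cdot> (\<gamma> (s + t) \<cdot> ginv k) = k \<cdot> (\<gamma> s \<cdot> ginv k) \<cdot> (k \<cdot> (\<gamma> t \<cdot> ginv k))" for s t
    by (simp add: one_param_add[OF assms] gmult_assoc)
  have "has_mderiv std_charts \<kappa> (\<lambda>t. k \<cdot> (\<gamma> t \<cdot> ginv k)) 0 (\<lambda>s. Ad k (s *\<^sub>R Y))"
    by (rule has_mderiv_conj[OF good_std_charts one_param_has_mderiv[OF assms] one_param_zero[OF assms]])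
  then show "((\<lambda>t. cmap \<kappa> \<e> (k \<cdot> (\<gamma> t \<cdot> ginv k))) has_vector_derivative Ad k Y) (at 0)"
    by (simp add: has_mderiv_def has_vector_derivative_def o_def one_param_zero[OF assms] linear_scale[OF linear_Ad])
qed

lemma Ad_Lie:
  assumes "k \<in> G" "Y \<in> Lie"
  shows "Ad k Y \<in> Lie"
proof -
  obtain \<gamma> where \<gamma>: "one_param GC \<kappa> Y \<gamma>" "range \<gamma> \<subseteq> G" using assms(2) unfolding lie_algebra_def by blast
  have "range (\<lambda>t. k \<cdot> (\<gamma> t \<cdot> ginv k)) \<subseteq> G" using \<gamma>(2) assms(1) G_mult G_inv by blast
  then show ?thesis unfolding lie_algebra_def using one_param_conj[OF \<gamma>(1)] by blast
qed

text \<open>The elements of a one-parameter subgroup commute, so conjugation by one of them returns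
  the same curve and hence the same velocity at 0.\<close>

lemma Ad_fix:
  assumes "one_param GC \<kappa> Y \<gamma>"
  shows "Ad (\<gamma> t) Y = Y"
proof -
  have "\<gamma> t \<cdot> (\<gamma> s \<cdot> ginv (\<gamma> t)) = \<gamma> s" for s
    by (simp flip: one_param_minus[OF assms] one_param_add[OF assms])
  then have "one_param GC \<kappa> (Ad (\<gamma> t) Y) \<gamma>" using one_param_conj[OF assms, of "\<gamma> t"] by simp
  then show ?thesis using assms unfolding one_param_def using vector_derivative_unique_at by blast
qed

subsection \<open>The inner product on the Lie algebra\<close>

lemma subspace_Lie: "subspace Lie"
  using basis_span subspace_span by metis

lemma basis_in_Lie: "X a \<in> Lie"
  using basis_span span_base[of "X a" "range X"] by blast

lemma tangent_one: "tangent_space GC \<kappa> G \<e> = Lie"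
  unfolding tangent_space_def by (simp add: dR_one)

abbreviation ip :: "'e \<Rightarrow> 'e \<Rightarrow> real" where "ip \<equiv> m \<e>"

lemma ip_combine: "\<lbrakk>u \<in> Lie; v \<in> Lie; w \<in> Lie\<rbrakk> \<Longrightarrow> ip (a *\<^sub>R u + b *\<^sub>R v) w = a * ip u w + b * ip v w"
  and ip_commute: "\<lbrakk>u \<in> Lie; v \<in> Lie\<rbrakk> \<Longrightarrow> ip u v = ip v u"
  and ip_pos: "\<lbrakk>u \<in> Lie; u \<noteq> 0\<rbrakk> \<Longrightarrow> 0 < ip u u"
  using metric G_one unfolding bi_invariant_metric_def tangent_one[symmetric] by blast+

lemma ip_add: "\<lbrakk>u \<in> Lie; v \<in> Lie; w \<in> Lie\<rbrakk> \<Longrightarrow> ip (u + v) w = ip u w + ip v w"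
  using ip_combine[of u v w 1 1] by simp

lemma ip_diff: "\<lbrakk>u \<in> Lie; v \<in> Lie; w \<in> Lie\<rbrakk> \<Longrightarrow> ip (u - v) w = ip u w - ip v w"
  using ip_combine[of u v w 1 "-1"] by simp

lemma ip_scale: "\<lbrakk>u \<in> Lie; w \<in> Lie\<rbrakk> \<Longrightarrow> ip (a *\<^sub>R u) w = a * ip u w"
  using ip_combine[of u u w a 0] by simp

lemma ip_zero_left: "w \<in> Lie \<Longrightarrow> ip 0 w = 0"
  using ip_scale[of w w 0] by simp

lemma ip_zero_right: "w \<in> Lie \<Longrightarrow> ip w 0 = 0"
  using ip_zero_left ip_commute[of w 0] subspace_0[OF subspace_Lie] by simp

lemma ip_nonneg: "u \<in> Lie \<Longrightarrow> 0 \<le> ip u u"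
  using ip_pos[of u] ip_zero_left[of u] by (cases "u = 0") auto

lemma ip_sum: "(\<And>a. a \<in> A \<Longrightarrow> f a \<in> Lie) \<Longrightarrow> w \<in> Lie \<Longrightarrow> ip (\<Sum>a\<in>A. f a) w = (\<Sum>a\<in>A. ip (f a) w)"
proof (induction A rule: infinite_finite_induct)
  case (insert a A)
  have "ip (f a + sum f A) w = ip (f a) w + ip (sum f A) w"
    by (rule ip_add) (use insert.prems in \<open>auto intro: subspace_sum[OF subspace_Lie]\<close>)
  with insert show ?case by simp
qed (auto simp: ip_zero_left)

text \<open>Bi-invariance: left and right translation by \<open>k\<close> are both isometries onto
  the tangent space at \<open>k\<close>, and \<open>Ad k\<close> is the first followed by the
  inverse of the second.\<close>

lemma Ad_ip:
  assumes "k \<in> G" "u \<in> Lie" "v \<in> Lie"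
  shows "ip (Ad k u) (Ad k v) = ip u v"
proof -
  have L: "m k (dL GC \<kappa> k \<e> u) (dL GC \<kappa> k \<e> v) = ip u v" if "u \<in> Lie" "v \<in> Lie" for u v
  proof -
    have "m (k \<cdot> \<e>) (dL GC \<kappa> k \<e> u) (dL GC \<kappa> k \<e> v) = ip u v"
      using metric G_one that assms(1) unfolding bi_invariant_metric_def tangent_one[symmetric] by blast
    then show ?thesis by simp
  qed
  have R: "m k (dR GC \<kappa> k \<e> u) (dR GC \<kappa> k \<e> v) = ip u v" if "u \<in> Lie" "v \<in> Lie" for u v
  proof -
    have "m (\<e> \<cdot> k) (dR GC \<kappa> k \<e> u) (dR GC \<kappa> k \<e> v) = ip u v"
      using metric G_one that assms(1) unfolding bi_invariant_metric_def tangent_one[symmetric] by blast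
    then show ?thesis by simp
  qed
  have "dL GC \<kappa> k \<e> w = dR GC \<kappa> k \<e> (Ad k w)" for w
    using dL_dR[of k \<e> w] by (simp add: dR_one)
  then show ?thesis using L[OF assms(2,3)] R[OF Ad_Lie[OF assms(1,2)] Ad_Lie[OF assms(1,3)]] by simp
qed

lemma basis_expand:
  assumes "B \<in> Lie"
  shows "B = (\<Sum>a\<in>UNIV. ip (X a) B *\<^sub>R X a)"
proof -
  have "B \<in> span (range X)" using assms basis_span by simp
  then obtain u where "B = (\<Sum>v\<in>range X. u v *\<^sub>R v)"
    by (auto simp: span_finite)
  \<comment> \<open>Orthonormality makes the members of the family distinct, so a sum over its range
    may be indexed by \<open>a\<close>.\<close>
  moreover have "inj X"
    by (rule injI) (metis basis_ortho zero_neq_one)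
  ultimately have "B = (\<Sum>a\<in>UNIV. u (X a) *\<^sub>R X a)" by (simp add: sum.reindex)
  then obtain c where c: "B = (\<Sum>a\<in>UNIV. c a *\<^sub>R X a)" by (rule that)
  have "ip B (X b) = c b" for b
    unfolding c using basis_in_Lie
    by (simp add: ip_sum subspace_scale[OF subspace_Lie] ip_scale basis_ortho if_distrib cong: if_cong)
  then have "ip (X b) B = c b" for b using ip_commute[OF basis_in_Lie assms] by simp
  then show ?thesis using c by simp
qed

definition rp :: "'e \<Rightarrow> 'e" where "rp = re_part GC \<kappa> G"
definition jp :: "'e \<Rightarrow> 'e" where "jp = im_part GC \<kappa> G"

lemma decompose: "\<exists>!p. fst p \<in> Lie \<and> snd p \<in> Lie \<and> Z = fst p + imult (snd p)"
  using complexification unfolding complexification_def by (simp add: case_prod_unfold)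

lemma decompose_unique:
  assumes "A \<in> Lie" "B \<in> Lie" "A' \<in> Lie" "B' \<in> Lie" "A + imult B = A' + imult B'"
  shows "A = A' \<and> B = B'"
  using decompose[of "A + imult B"] assms by (metis fst_conv snd_conv)

lemma rp_eq: "A \<in> Lie \<Longrightarrow> B \<in> Lie \<Longrightarrow> rp (A + imult B) = A"
  unfolding rp_def re_part_def using decompose_unique by (intro the_equality) blast+

lemma jp_eq: "A \<in> Lie \<Longrightarrow> B \<in> Lie \<Longrightarrow> jp (A + imult B) = B"
  unfolding jp_def im_part_def using decompose_unique by (intro the_equality) blast+

lemma rp_Lie: "rp Z \<in> Lie" and jp_Lie: "jp Z \<in> Lie" and rp_jp: "Z = rp Z + imult (jp Z)"
  using decompose[of Z] rp_eq jp_eq by (metis)+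

text \<open>For \<open>k\<close> in \<open>G\<close>, \<open>Ad k\<close> is complex linear and
  preserves the real form, so it respects the decomposition into real and imaginary part.\<close>

lemma jp_Ad: "k \<in> G \<Longrightarrow> jp (Ad k v) = Ad k (jp v)"
proof -
  assume k: "k \<in> G"
  have "Ad k v = Ad k (rp v + imult (jp v))" using rp_jp[of v] by simp
  also have "\<dots> = Ad k (rp v) + imult (Ad k (jp v))" by (simp add: linear_add[OF linear_Ad] Ad_imult)
  finally have "jp (Ad k v) = jp (Ad k (rp v) + imult (Ad k (jp v)))" by (rule arg_cong)
  then show ?thesis by (simp add: jp_eq Ad_Lie[OF k] rp_Lie jp_Lie)
qed

lemma metric_C_eq:
  "metric_C GC \<kappa> G m g Z1 Z2 =
     ip (rp (dR GC \<kappa> (ginv g) g Z1)) (rp (dR GC \<kappa> (ginv g) g Z2)) +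
     ip (jp (dR GC \<kappa> (ginv g) g Z1)) (jp (dR GC \<kappa> (ginv g) g Z2))"
  by (simp add: metric_C_def rp_def jp_def Let_def)

end

text \<open>Joint continuity in base point and vector, from the Lipschitz bound on the derivative;
  it serves for the velocity of a curve read in a fixed chart.\<close>

lemma holo_derivative_tendsto:
  fixes f :: "'e::{euclidean_space,complex_space} \<Rightarrow> 'f::{euclidean_space,complex_space}"
  assumes S: "open S" "holo_on f S" "z0 \<in> S" and w: "(w \<longlongrightarrow> z0) F" and v: "(v \<longlongrightarrow> v0) F"
  shows "((\<lambda>s. frechet_derivative f (at (w s)) (v s)) \<longlongrightarrow> frechet_derivative f (at z0) v0) F"
proof -
  let ?D = "\<lambda>w. frechet_derivative f (at w)"
  obtain \<delta> C where \<delta>: "\<delta> > 0" "C \<ge> 0" "ball z0 \<delta> \<subseteq> S"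
    and lip: "\<And>w w' v. \<lbrakk>w \<in> ball z0 \<delta>; w' \<in> ball z0 \<delta>\<rbrakk> \<Longrightarrow> norm (?D w v - ?D w' v) \<le> C * norm (w - w') * norm v"
    using holo_on_derivative_estimates[OF S] by metis
  have bl: "bounded_linear (?D z0)" using holo_onD(1)[OF S(2,3)] has_derivative_bounded_linear by blast
  have "((\<lambda>s. ?D (w s) (v s) - ?D z0 (v s)) \<longlongrightarrow> 0) F"
  proof (rule Lim_null_comparison)
    have "\<forall>\<^sub>F s in F. w s \<in> ball z0 \<delta>" using w \<delta>(1) by (intro topological_tendstoD) auto
    then show "\<forall>\<^sub>F s in F. norm (?D (w s) (v s) - ?D z0 (v s)) \<le> C * norm (w s - z0) * norm (v s)"
      by eventually_elim (use lip \<delta>(1) in auto)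
    have "((\<lambda>s. C * norm (w s - z0) * norm (v s)) \<longlongrightarrow> C * norm (z0 - z0) * norm v0) F"
      by (intro tendsto_intros w v)
    then show "((\<lambda>s. C * norm (w s - z0) * norm (v s)) \<longlongrightarrow> 0) F" by simp
  qed
  from tendsto_add[OF this bounded_linear.tendsto[OF bl v]] show ?thesis by simp
qed

context complexified_group
begin

subsection \<open>Bounded sets are relatively compact\<close>

text \<open>\<open>\<iota>\<close> is instantiated by the identity and by inversion.\<close>

lemma chart_mult_holo:
  fixes \<iota> :: "'g \<Rightarrow> 'g" and a b q :: 'g
  assumes \<iota>: "\<And>p. \<exists>T. has_mderiv \<kappa> \<kappa> \<iota> p T \<and> (\<forall>v. T (imult v) = imult (T v))"
  defines "P \<equiv> \<lambda>z. cinv \<kappa> a (fst z) \<cdot> \<iota> (cinv \<kappa> b (snd z))"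
  defines "O' \<equiv> {z \<in> (cmap \<kappa> a ` cdom \<kappa> a) \<times> (cmap \<kappa> b ` cdom \<kappa> b). P z \<in> cdom \<kappa> q}"
  shows "open O'" and "holo_on (\<lambda>z. cmap \<kappa> q (P z)) O'"
proof -
  let ?I = "(cmap \<kappa> a ` cdom \<kappa> a) \<times> (cmap \<kappa> b ` cdom \<kappa> b)"
  have ex: "\<exists>T. has_mderiv std_charts \<kappa> P z T \<and> (\<forall>v. T (imult v) = imult (T v))" if z: "z \<in> ?I" for z
  proof -
    have z': "fst z \<in> cmap \<kappa> a ` cdom \<kappa> a" "snd z \<in> cmap \<kappa> b ` cdom \<kappa> b" using z by auto
    obtain A where A: "has_mderiv std_charts \<kappa> (cinv \<kappa> a) (fst z) A" "\<And>v. A (imult v) = imult (A v)"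
      using has_mderiv_cinv[OF atlas z'(1)] by metis
    obtain B where B: "has_mderiv std_charts \<kappa> (cinv \<kappa> b) (snd z) B" "\<And>v. B (imult v) = imult (B v)"
      using has_mderiv_cinv[OF atlas z'(2)] by metis
    obtain T where T: "has_mderiv \<kappa> \<kappa> \<iota> (cinv \<kappa> b (snd z)) T" "\<And>v. T (imult v) = imult (T v)"
      using \<iota> by metis
    have f: "has_mderiv std_charts std_charts fst z fst" and s: "has_mderiv std_charts std_charts snd z snd"
      unfolding has_mderiv_std_iff by (auto intro!: derivative_eq_intros)
    note A' = has_mderiv_compose[OF good_std_charts good_std_charts f A(1)]
    note B' = has_mderiv_compose[OF good_std_charts good
        has_mderiv_compose[OF good_std_charts good_std_charts s B(1)] T(1)]
    show ?thesis
      by (rule exI, rule conjI, unfold P_def, rule has_mderiv_gmult_Pair[OF good_std_charts A' B'])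
         (simp add: A(2) B(2) T(2) dmult_imult[symmetric] imult_prod_def)
  qed
  have "continuous_on ?I P"
    unfolding continuous_on_def
  proof
    fix z assume "z \<in> ?I"
    then have "(P \<longlongrightarrow> P z) (nhds z)" using ex has_mderivD(1) by blast
    then show "(P \<longlongrightarrow> P z) (at z within ?I)" by (rule tendsto_mono[OF at_within_le_nhds])
  qed
  then have "open (?I \<inter> P -` cdom \<kappa> q)"
    by (intro continuous_open_preimage open_Times open_cimage[OF good] open_cdom[OF good])
  moreover have "O' = ?I \<inter> P -` cdom \<kappa> q" by (auto simp: O'_def)
  ultimately show "open O'" by simp
  show "holo_on (\<lambda>z. cmap \<kappa> q (P z)) O'"
    unfolding holo_on_def
  proof
    fix z assume z: "z \<in> O'"
    then obtain T where T: "has_mderiv std_charts \<kappa> P z T" "\<And>v. T (imult v) = imult (T v)"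
      using ex[of z] unfolding O'_def by blast
    obtain R where R: "has_mderiv \<kappa> std_charts (cmap \<kappa> q) (P z) R" "\<And>v. R (imult v) = imult (R v)"
      using has_mderiv_cmap[OF atlas, of "P z" q] z unfolding O'_def by blast
    show "\<exists>f'. ((\<lambda>z. cmap \<kappa> q (P z)) has_derivative f') (at z) \<and> (\<forall>v. f' (imult v) = imult (f' v))"
      using has_mderiv_compose[OF good_std_charts good T(1) R(1)] T(2) R(2)
      unfolding has_mderiv_std_iff by auto
  qed
qed

lemma ident_holo: "\<exists>T. has_mderiv \<kappa> \<kappa> (\<lambda>x. x) p T \<and> (\<forall>v. T (imult v) = imult (T v))"
  using has_mderiv_ident[OF good] by blast

lemma ginv_holo: "\<exists>T. has_mderiv \<kappa> \<kappa> ginv p T \<and> (\<forall>v. T (imult v) = imult (T v))"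
  using holo_map_has_mderiv[OF good good holo_inv] by blast

text \<open>Right translation moves any piece of a curve to the identity without changing its length, so a
  single chart there controls all short pieces; this replaces completeness of the metric.\<close>

lemma short_curve_confined:
  obtains K \<theta> where "compact K" "\<e> \<in> K" "\<theta> > 0"
    "\<And>\<beta> W \<phi> \<phi>' a b. \<lbrakk>a \<le> b; continuous_on UNIV \<beta>;
      \<And>t. has_mderiv std_charts \<kappa> (\<lambda>s. \<beta> s \<cdot> ginv (\<beta> t)) t (\<lambda>s. s *\<^sub>R W t);
      continuous_on {a..b} \<phi>;
      \<And>t. a < t \<Longrightarrow> t < b \<Longrightarrow> (\<phi> has_vector_derivative \<phi>' t) (at t);
      \<And>t. a < t \<Longrightarrow> t < b \<Longrightarrow> norm (W t) \<le> \<phi>' t;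
      \<And>t. t \<in> {a..b} \<Longrightarrow> \<phi> t - \<phi> a < \<theta>\<rbrakk> \<Longrightarrow> \<beta> b \<cdot> ginv (\<beta> a) \<in> K"
proof -
  let ?f = "\<lambda>z. cmap \<kappa> \<e> (cinv \<kappa> \<e> (fst z) \<cdot> cinv \<kappa> \<e> (snd z))"
  let ?I = "cmap \<kappa> \<e> ` cdom \<kappa> \<e>"
  let ?O = "{z \<in> ?I \<times> ?I. cinv \<kappa> \<e> (fst z) \<cdot> cinv \<kappa> \<e> (snd z) \<in> cdom \<kappa> \<e>}"
  define z0 where "z0 = cmap \<kappa> \<e> \<e>"
  have e0: "\<e> \<in> cdom \<kappa> \<e>" by (rule cdom_self[OF good])
  have z0: "cinv \<kappa> \<e> z0 = \<e>" "z0 \<in> ?I" using e0 by (simp_all add: z0_def cinv_cmap[OF good])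
  have O: "open ?O" "holo_on ?f ?O" by (rule chart_mult_holo[OF ident_holo])+
  have mem: "(z0, z0) \<in> ?O" using z0 e0 by simp
  obtain \<delta>1 C where \<delta>1: "\<delta>1 > 0" "C \<ge> 0" "ball (z0, z0) \<delta>1 \<subseteq> ?O"
    and bd: "\<And>w v. w \<in> ball (z0, z0) \<delta>1 \<Longrightarrow> norm (frechet_derivative ?f (at w) v) \<le> C * norm v"
    by (rule holo_on_derivative_estimates[OF O mem]) (rule that; assumption)
  define \<delta> where "\<delta> = \<delta>1 / 2"
  have \<delta>: "\<delta> > 0" using \<delta>1 by (simp add: \<delta>_def)
  have pair: "(z0, z) \<in> ball (z0, z0) \<delta>1" if "z \<in> cball z0 \<delta>" for z
    using that \<delta>1 by (simp add: \<delta>_def dist_Pair_Pair)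
  have cb: "cball z0 \<delta> \<subseteq> ?I" using pair \<delta>1(3) by blast
  define K where "K = cinv \<kappa> \<e> ` cball z0 \<delta>"
  define U where "U = cinv \<kappa> \<e> ` ball z0 \<delta>"
  have K: "compact K" unfolding K_def
    by (rule compact_continuous_image[OF continuous_on_subset[OF continuous_on_cinv[OF good] cb]]) simp
  have Kdom: "K \<subseteq> cdom \<kappa> \<e>" using cb cinv_in_cdom[OF good] unfolding K_def by blast
  have Kc: "cmap \<kappa> \<e> x \<in> cball z0 \<delta>" if "x \<in> K" for x
    using that cb cmap_cinv[OF good] unfolding K_def by auto
  have UK: "U \<subseteq> K" unfolding U_def K_def by (simp add: image_mono)
  have "U = cdom \<kappa> \<e> \<inter> cmap \<kappa> \<e> -` ball z0 \<delta>"
  proof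
    have "ball z0 \<delta> \<subseteq> ?I" using cb by auto
    then show "U \<subseteq> cdom \<kappa> \<e> \<inter> cmap \<kappa> \<e> -` ball z0 \<delta>"
      using cinv_in_cdom[OF good] cmap_cinv[OF good] unfolding U_def by fastforce
    show "cdom \<kappa> \<e> \<inter> cmap \<kappa> \<e> -` ball z0 \<delta> \<subseteq> U"
      unfolding U_def using cinv_cmap[OF good] by (metis IntE image_eqI subsetI vimageE)
  qed
  then have U: "open U" "\<And>x. x \<in> cdom \<kappa> \<e> \<Longrightarrow> cmap \<kappa> \<e> x \<in> ball z0 \<delta> \<Longrightarrow> x \<in> U"
    using continuous_open_preimage[OF continuous_on_cmap[OF good] open_cdom[OF good] open_ball] by auto
  \<comment> \<open>The chart speed is at most \<open>C\<close> times the translated speed, so a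
    curve of length below this bound moves by less than \<delta> in the chart; \<open>C + 1\<close>
    covers the case C = 0.\<close>
  show thesis
  proof (rule that[of K "\<delta> / (C + 1)"])
    show "compact K" by (rule K)
    show "\<e> \<in> K" unfolding K_def using z0 \<delta> by (metis centre_in_cball image_eqI less_imp_le)
    show "\<delta> / (C + 1) > 0" using \<delta> \<delta>1 by simp
    fix \<beta> W and \<phi> \<phi>' :: "real \<Rightarrow> real" and a b :: real
    assume ab: "a \<le> b" and \<beta>: "continuous_on UNIV \<beta>"
      and W: "\<And>t. has_mderiv std_charts \<kappa> (\<lambda>s. \<beta> s \<cdot> ginv (\<beta> t)) t (\<lambda>s. s *\<^sub>R W t)"
      and \<phi>: "continuous_on {a..b} \<phi>" "\<And>t. a < t \<Longrightarrow> t < b \<Longrightarrow> (\<phi> has_vector_derivative \<phi>' t) (at t)"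
      and bnd: "\<And>t. a < t \<Longrightarrow> t < b \<Longrightarrow> norm (W t) \<le> \<phi>' t"
      and len: "\<And>t. t \<in> {a..b} \<Longrightarrow> \<phi> t - \<phi> a < \<delta> / (C + 1)"
    define \<alpha> where "\<alpha> = (\<lambda>s. \<beta> s \<cdot> ginv (\<beta> a))"
    have \<alpha>: "continuous_on UNIV \<alpha>" unfolding \<alpha>_def by (intro continuous_on_gmult \<beta> continuous_on_const)
    \<comment> \<open>Since \<open>\<alpha> s = (\<beta> s \<cdot> ginv (\<beta> t)) \<cdot>
      \<alpha> t\<close>, the coordinate velocity of \<alpha> at \<open>t\<close> is the partial
      derivative of the multiplication in its first factor, taken at the identity and applied to
      \<open>W t\<close>.\<close>
    have der: "((\<lambda>s. cmap \<kappa> \<e> (\<alpha> s)) has_vector_derivative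
        frechet_derivative ?f (at (z0, cmap \<kappa> \<e> (\<alpha> t))) (W t, 0)) (at t)" if t: "\<alpha> t \<in> K" for t
    proof -
      let ?g = "\<lambda>s. cmap \<kappa> \<e> (\<beta> s \<cdot> ginv (\<beta> t))" and ?z = "cmap \<kappa> \<e> (\<alpha> t)"
      have g: "(?g has_derivative (\<lambda>s. s *\<^sub>R W t)) (at t)"
        using has_mderivD(2)[OF W[of t]] by (simp add: o_def)
      have "(z0, ?z) \<in> ?O" using pair[OF Kc[OF t]] \<delta>1(3) by blast
      then have D: "(?f has_derivative frechet_derivative ?f (at (z0, ?z))) (at (z0, ?z))"
        by (rule holo_onD(1)[OF O(2)])
      have "((\<lambda>s. (?g s, ?z)) has_derivative (\<lambda>s. (s *\<^sub>R W t, 0))) (at t)"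
        by (intro has_derivative_Pair g has_derivative_const)
      moreover have "(?f has_derivative frechet_derivative ?f (at (z0, ?z))) (at (?g t, ?z))"
        using D by (simp add: z0_def)
      ultimately have D2: "((\<lambda>s. ?f (?g s, ?z)) has_derivative
          (\<lambda>s. frechet_derivative ?f (at (z0, ?z)) (s *\<^sub>R W t, 0))) (at t)"
        by (rule has_derivative_compose)
      have lin: "frechet_derivative ?f (at (z0, ?z)) (s *\<^sub>R W t, 0) =
          s *\<^sub>R frechet_derivative ?f (at (z0, ?z)) (W t, 0)" for s
        using linear_scale[OF has_derivative_linear[OF D], of s "(W t, 0)"] by simp
      have ev: "\<forall>\<^sub>F s in nhds t. ?f (?g s, ?z) = cmap \<kappa> \<e> (\<alpha> s)"
      proof -
        have "filterlim (\<lambda>s. \<beta> s \<cdot> ginv (\<beta> t)) (nhds \<e>) (nhds t)"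
          using has_mderivD(1)[OF W[of t]] by simp
        then have "\<forall>\<^sub>F s in nhds t. \<beta> s \<cdot> ginv (\<beta> t) \<in> cdom \<kappa> \<e>"
          using eventually_cdom[OF good e0] by (rule eventually_compose_filterlim[rotated])
        then show ?thesis
        proof eventually_elim
          case (elim s)
          have "\<alpha> t \<in> cdom \<kappa> \<e>" using t Kdom by blast
          with elim show ?case
            by (simp add: cinv_cmap[OF good]) (simp add: \<alpha>_def gmult_assoc)
        qed
      qed
      show ?thesis
        using has_derivative_eventually_eq[OF D2 ev] unfolding has_vector_derivative_def lin .
    qed
    show "\<beta> b \<cdot> ginv (\<beta> a) \<in> K"
    proof (rule ccontr)
      assume "\<beta> b \<cdot> ginv (\<beta> a) \<notin> K"
      \<comment> \<open>The times spent outside the open ball form a compact set, and its least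
        element is the exit time. Up to it the curve stays in \<open>K\<close>, so the speed bound
        holds and keeps the curve strictly inside, a contradiction.\<close>
      define B where "B = {a..b} - \<alpha> -` U"
      have "B \<noteq> {}" using \<open>_ \<notin> K\<close> UK ab by (auto simp: B_def \<alpha>_def)
      moreover have "compact B"
        unfolding B_def using open_vimage[OF U(1) \<alpha>] by (intro compact_diff compact_Icc)
      ultimately have "\<exists>s\<in>B. \<forall>t\<in>B. s \<le> t" by (intro compact_attains_inf)
      then obtain s where s: "s \<in> B" "\<And>t. t \<in> B \<Longrightarrow> s \<le> t" by blast
      have "\<alpha> a \<in> U" unfolding \<alpha>_def using U(2)[OF e0] \<delta> by (simp add: z0_def)
      then have "a \<noteq> s" using s(1) by (auto simp: B_def)
      moreover have "a \<le> s" using s(1) by (simp add: B_def)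
      ultimately have as: "a < s" by simp
      have sb: "s \<le> b" using s(1) by (simp add: B_def)
      have "\<alpha> t \<in> K" if "t \<in> {a..<s}" for t
      proof -
        have "t \<notin> B" using s(2)[of t] that by auto
        then have "\<alpha> t \<in> U" using that sb by (simp add: B_def)
        then show ?thesis using UK by blast
      qed
      \<comment> \<open>\<open>K\<close> is closed because the group is Hausdorff; this extends
        containment to the exit time itself.\<close>
      moreover have "closed (\<alpha> -` K)" using closed_vimage[OF compact_imp_closed[OF K] \<alpha>] .
      ultimately have "closure {a..<s} \<subseteq> \<alpha> -` K" by (intro closure_minimal) auto
      then have inK: "\<alpha> t \<in> K" if "t \<in> {a..s}" for t using that as by (auto simp: closure_atLeastLessThan)
      have "norm (cmap \<kappa> \<e> (\<alpha> s) - cmap \<kappa> \<e> (\<alpha> a)) \<le> C * \<phi> s - C * \<phi> a"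
      proof (rule differentiable_bound_general[OF as])
        show "continuous_on {a..s} (\<lambda>s. cmap \<kappa> \<e> (\<alpha> s))"
          by (rule continuous_on_compose2[OF continuous_on_cmap[OF good] continuous_on_subset[OF \<alpha>]])
             (use inK Kdom in auto)
        show "continuous_on {a..s} (\<lambda>s. C * \<phi> s)"
          using sb by (intro continuous_intros continuous_on_subset[OF \<phi>(1)]) auto
        fix t assume t: "a < t" "t < s"
        show "((\<lambda>s. C * \<phi> s) has_vector_derivative C * \<phi>' t) (at t)"
          using \<phi>(2)[of t] t sb by (auto intro!: derivative_eq_intros)
        have tK: "\<alpha> t \<in> K" using inK t by simp
        show "((\<lambda>s. cmap \<kappa> \<e> (\<alpha> s)) has_vector_derivative
          frechet_derivative ?f (at (z0, cmap \<kappa> \<e> (\<alpha> t))) (W t, 0)) (at t)"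
          by (rule der[OF tK])
        have "norm (frechet_derivative ?f (at (z0, cmap \<kappa> \<e> (\<alpha> t))) (W t, 0)) \<le> C * norm (W t, 0::'e)"
          by (rule bd[OF pair[OF Kc[OF tK]]])
        also have "\<dots> \<le> C * \<phi>' t" using bnd[of t] t sb \<delta>1(2) by (intro mult_left_mono) (auto simp: norm_Pair)
        finally show "norm (frechet_derivative ?f (at (z0, cmap \<kappa> \<e> (\<alpha> t))) (W t, 0)) \<le> C * \<phi>' t" .
      qed
      also have "\<dots> = C * (\<phi> s - \<phi> a)" by (simp add: algebra_simps)
      also have "\<dots> \<le> C * (\<delta> / (C + 1))" using len[of s] as sb \<delta>1(2) by (intro mult_left_mono) auto
      also have "\<dots> < \<delta>" using \<delta> \<delta>1(2) by (simp add: field_simps)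
      finally have "cmap \<kappa> \<e> (\<alpha> s) \<in> ball z0 \<delta>"
        by (simp add: \<alpha>_def z0_def dist_norm norm_minus_commute)
      then have "\<alpha> s \<in> U" using U(2) inK[of s] as Kdom by auto
      then show False using s(1) by (simp add: B_def)
    qed
  qed
qed

text \<open>A curve of length below \<open>real k * \<theta>\<close> is cut into \<open>k\<close>
  pieces shorter than \<theta>. Each contributes a factor from one compact set, and
  \<open>K k\<close> consists of the \<open>k\<close>-fold products.\<close>

lemma curve_in_compact:
  obtains K :: "nat \<Rightarrow> 'g set" and \<theta> where "\<And>k. compact (K k)" "\<theta> > 0"
    "\<And>\<beta> W \<phi> \<phi>' k. \<lbrakk>continuous_on UNIV \<beta>;
      \<And>t. has_mderiv std_charts \<kappa> (\<lambda>s. \<beta> s \<cdot> ginv (\<beta> t)) t (\<lambda>s. s *\<^sub>R W t);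
      continuous_on {0..1} \<phi>;
      \<And>t. 0 < t \<Longrightarrow> t < 1 \<Longrightarrow> (\<phi> has_vector_derivative \<phi>' t) (at t);
      \<And>t. 0 < t \<Longrightarrow> t < 1 \<Longrightarrow> norm (W t) \<le> \<phi>' t;
      \<And>s t. \<lbrakk>0 \<le> s; s \<le> t; t \<le> 1\<rbrakk> \<Longrightarrow> \<phi> s \<le> \<phi> t; \<phi> 0 = 0; \<phi> 1 < real k * \<theta>\<rbrakk> \<Longrightarrow> \<beta> 1 \<cdot> ginv (\<beta> 0) \<in> K k"
proof -
  obtain K0 \<theta> where K0: "compact K0" "\<e> \<in> K0" and \<theta>: "\<theta> > 0"
    and short: "\<And>\<beta> W \<phi> \<phi>' a b. \<lbrakk>a \<le> b; continuous_on UNIV \<beta>;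
      \<And>t. has_mderiv std_charts \<kappa> (\<lambda>s. \<beta> s \<cdot> ginv (\<beta> t)) t (\<lambda>s. s *\<^sub>R W t);
      continuous_on {a..b} \<phi>;
      \<And>t. a < t \<Longrightarrow> t < b \<Longrightarrow> (\<phi> has_vector_derivative \<phi>' t) (at t);
      \<And>t. a < t \<Longrightarrow> t < b \<Longrightarrow> norm (W t) \<le> \<phi>' t;
      \<And>t. t \<in> {a..b} \<Longrightarrow> \<phi> t - \<phi> a < \<theta>\<rbrakk> \<Longrightarrow> \<beta> b \<cdot> ginv (\<beta> a) \<in> K0"
  proof (rule short_curve_confined, goal_cases)
    case (1 K \<theta>)
    show ?case by (rule 1(1)[OF 1(2-5)])
  qed
  define K where "K = rec_nat {\<e>} (\<lambda>_ A. (\<lambda>(x, y). x \<cdot> y) ` (K0 \<times> A))"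
  have K_0: "K 0 = {\<e>}" and K_Suc: "K (Suc k) = (\<lambda>(x, y). x \<cdot> y) ` (K0 \<times> K k)" for k
    by (simp_all add: K_def)
  have Kc: "compact (K k)" for k
  proof (induction k)
    case (Suc k)
    have "continuous_on (K0 \<times> K k) (\<lambda>(x, y). x \<cdot> y)"
      using holo_mult unfolding holo_map_def using continuous_on_subset by blast
    then show ?case unfolding K_Suc using K0(1) Suc by (intro compact_continuous_image compact_Times)
  qed (simp add: K_0)
  have Ke: "\<e> \<in> K k" for k
    by (induction k) (use K0(2) in \<open>force simp: K_0 K_Suc\<close>)+
  show thesis
  proof (rule that[of K \<theta>])
    fix \<beta> W and \<phi> \<phi>' :: "real \<Rightarrow> real" and k
    assume \<beta>: "continuous_on UNIV \<beta>"
      and W: "\<And>t. has_mderiv std_charts \<kappa> (\<lambda>s. \<beta> s \<cdot> ginv (\<beta> t)) t (\<lambda>s. s *\<^sub>R W t)"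
      and \<phi>: "continuous_on {0..1} \<phi>"
      and d: "\<And>t. 0 < t \<Longrightarrow> t < 1 \<Longrightarrow> (\<phi> has_vector_derivative \<phi>' t) (at t)"
      and bnd: "\<And>t. 0 < t \<Longrightarrow> t < 1 \<Longrightarrow> norm (W t) \<le> \<phi>' t"
      and mono: "\<And>s t. \<lbrakk>0 \<le> s; s \<le> t; t \<le> 1\<rbrakk> \<Longrightarrow> \<phi> s \<le> \<phi> t" and \<phi>0: "\<phi> 0 = 0" and \<phi>1: "\<phi> 1 < real k * \<theta>"
    have step: "\<beta> t \<cdot> ginv (\<beta> s) \<in> K0" if st: "0 \<le> s" "s \<le> t" "t \<le> 1" "\<phi> t - \<phi> s < \<theta>" for s t
    proof (rule short[where \<phi>'=\<phi>', OF st(2) \<beta> W])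
      show "continuous_on {s..t} \<phi>" using st by (intro continuous_on_subset[OF \<phi>]) auto
      show "\<phi> u - \<phi> s < \<theta>" if "u \<in> {s..t}" for u
        using mono[of u t] st that by auto
    qed (use d bnd st in auto)
    have "\<beta> t \<cdot> ginv (\<beta> 0) \<in> K k" if "t \<in> {0..1}" "\<phi> t < real k * \<theta>" for t
      using that
    proof (induction k arbitrary: t)
      case 0
      then show ?case using mono[of 0 t] \<phi>0 by auto
    next
      case (Suc k)
      have nn: "0 \<le> \<phi> t" using mono[of 0 t] \<phi>0 Suc.prems by auto
      have lt: "\<phi> t < real k * \<theta> + \<theta>" using Suc.prems(2) by (simp add: algebra_simps)
      show ?case
      proof (cases "\<phi> t < \<theta>")
        case True
        then have "\<beta> t \<cdot> ginv (\<beta> 0) \<in> K0" using step[of 0 t] Suc.prems \<phi>0 by simp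
        then show ?thesis unfolding K_Suc using Ke by (force intro!: image_eqI[of _ _ "(\<beta> t \<cdot> ginv (\<beta> 0), \<e>)"])
      next
        case False
        \<comment> \<open>A length strictly between \<open>\<phi> t - \<theta>\<close> and
          \<open>real k * \<theta>\<close>: the last piece is then shorter than \<theta>, and the
          remainder falls under the induction hypothesis.\<close>
        define y where "y = (\<phi> t - \<theta> + min (real k * \<theta>) (\<phi> t)) / 2"
        have y: "\<phi> t - \<theta> < y" "0 \<le> y" "y \<le> \<phi> t" "y < real k * \<theta>"
          using False lt \<theta> nn by (auto simp: y_def min_def field_simps)
        have "continuous_on {0..t} \<phi>" using Suc.prems by (intro continuous_on_subset[OF \<phi>]) auto
        then obtain s where s: "0 \<le> s" "s \<le> t" "\<phi> s = y"
          using IVT'[of \<phi> 0 y t] y Suc.prems \<phi>0 by auto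
        have "\<beta> s \<cdot> ginv (\<beta> 0) \<in> K k" using Suc.IH[of s] s y Suc.prems by auto
        moreover have "\<beta> t \<cdot> ginv (\<beta> s) \<in> K0" using step[of s t] s y Suc.prems by auto
        moreover have "\<beta> t \<cdot> ginv (\<beta> 0) = (\<beta> t \<cdot> ginv (\<beta> s)) \<cdot> (\<beta> s \<cdot> ginv (\<beta> 0))" by (simp add: gmult_assoc)
        ultimately show ?thesis unfolding K_Suc by force
      qed
    qed
    then show "\<beta> 1 \<cdot> ginv (\<beta> 0) \<in> K k" using \<phi>1 by simp
  qed (use Kc \<theta> in auto)
qed

end

section \<open>The invariant metric against the coordinate norm, and bounded sets of fields\<close>

context complexified_group
begin

lemma linear_rp: "linear rp" and linear_jp: "linear jp"
proof -
  have add: "rp (u + v) = rp u + rp v \<and> jp (u + v) = jp u + jp v" for u v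
  proof -
    have "u + v = (rp u + imult (jp u)) + (rp v + imult (jp v))" using rp_jp by metis
    also have "\<dots> = (rp u + rp v) + imult (jp u + jp v)" by (simp add: imult_add)
    finally show ?thesis using subspace_add[OF subspace_Lie] rp_Lie jp_Lie by (metis rp_eq jp_eq)
  qed
  have scale: "rp (r *\<^sub>R u) = r *\<^sub>R rp u \<and> jp (r *\<^sub>R u) = r *\<^sub>R jp u" for r u
  proof -
    have "r *\<^sub>R u = r *\<^sub>R (rp u + imult (jp u))" using rp_jp by metis
    also have "\<dots> = r *\<^sub>R rp u + imult (r *\<^sub>R jp u)" by (simp add: scaleR_add_right imult_scaleR)
    finally show ?thesis using subspace_scale[OF subspace_Lie] rp_Lie jp_Lie by (metis rp_eq jp_eq)
  qed
  show "linear rp" "linear jp" using add scale by (auto intro!: linearI)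
qed

text \<open>The squared length of a tangent vector of the complexified group after right translation
  to the identity.\<close>

definition Qf :: "'e \<Rightarrow> real" where "Qf w = ip (rp w) (rp w) + ip (jp w) (jp w)"

lemma ip_self_sum: "B \<in> Lie \<Longrightarrow> ip B B = (\<Sum>a\<in>UNIV. (ip (X a) B)\<^sup>2)"
proof -
  assume B: "B \<in> Lie"
  have "ip B B = ip (\<Sum>a\<in>UNIV. ip (X a) B *\<^sub>R X a) B" using basis_expand[OF B] by simp
  also have "\<dots> = (\<Sum>a\<in>UNIV. ip (ip (X a) B *\<^sub>R X a) B)"
    by (rule ip_sum) (auto intro: subspace_scale[OF subspace_Lie] basis_in_Lie B)
  also have "\<dots> = (\<Sum>a\<in>UNIV. (ip (X a) B)\<^sup>2)"
    by (simp add: ip_scale[OF basis_in_Lie B] power2_eq_square)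
  finally show ?thesis .
qed

lemma Qf_nonneg: "Qf w \<ge> 0"
  unfolding Qf_def using ip_nonneg rp_Lie jp_Lie by (metis add_nonneg_nonneg)

text \<open>By Parseval's identity \<open>Qf\<close> is a sum of squares of linear
  functionals.\<close>

lemma continuous_Qf: "continuous_on UNIV Qf"
proof -
  have lin: "linear (\<lambda>w. ip (X a) (f w))" if f: "linear f" "\<And>w. f w \<in> Lie" for f :: "'e \<Rightarrow> 'e" and a
  proof (rule linearI)
    show "ip (X a) (f (u + v)) = ip (X a) (f u) + ip (X a) (f v)" for u v
      using ip_add[OF f(2) f(2) basis_in_Lie] ip_commute[OF basis_in_Lie] subspace_add[OF subspace_Lie f(2) f(2)] f(2)
      by (simp add: linear_add[OF f(1)])
    show "ip (X a) (f (r *\<^sub>R u)) = r *\<^sub>R ip (X a) (f u)" for r u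
      using ip_scale[OF f(2) basis_in_Lie] ip_commute[OF basis_in_Lie] subspace_scale[OF subspace_Lie f(2)] f(2)
      by (simp add: linear_scale[OF f(1)])
  qed
  have c: "continuous_on UNIV (\<lambda>w. ip (X a) (rp w))" "continuous_on UNIV (\<lambda>w. ip (X a) (jp w))" for a
    using lin[OF linear_rp rp_Lie] lin[OF linear_jp jp_Lie]
    by (auto intro!: linear_continuous_on simp: linear_conv_bounded_linear)
  have "Qf = (\<lambda>w. (\<Sum>a\<in>UNIV. (ip (X a) (rp w))\<^sup>2) + (\<Sum>a\<in>UNIV. (ip (X a) (jp w))\<^sup>2))"
    by (rule ext) (simp only: Qf_def ip_self_sum[OF rp_Lie] ip_self_sum[OF jp_Lie])
  then show ?thesis by (auto intro!: continuous_intros c)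
qed

text \<open>Equivalence of norms in finite dimension: coefficients in the orthonormal basis are at
  most the length, for the real and the imaginary part separately.\<close>

lemma norm_le_Qf:
  obtains c where "c > 0" "\<And>w. norm w \<le> c * sqrt (Qf w)"
proof -
  define M where "M = (\<Sum>a\<in>UNIV. norm (X a))"
  have M: "M \<ge> 0" by (simp add: M_def sum_nonneg)
  have bd: "norm B \<le> M * sqrt (ip B B)" if B: "B \<in> Lie" for B
  proof -
    have "\<bar>ip (X a) B\<bar> \<le> sqrt (ip B B)" for a
    proof -
      have "(ip (X a) B)\<^sup>2 \<le> ip B B"
        unfolding ip_self_sum[OF B] by (rule member_le_sum) auto
      then show ?thesis by (metis real_sqrt_abs real_sqrt_le_mono)
    qed
    moreover have "norm B \<le> (\<Sum>a\<in>UNIV. norm (ip (X a) B *\<^sub>R X a))"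
      using norm_sum[of "\<lambda>a. ip (X a) B *\<^sub>R X a" UNIV] basis_expand[OF B] by simp
    ultimately have "norm B \<le> (\<Sum>a\<in>UNIV. norm (X a) * sqrt (ip B B))"
      by (smt (verit, best) mult.commute mult_left_mono norm_ge_zero norm_scaleR sum_mono)
    then show ?thesis by (simp add: M_def sum_distrib_right)
  qed
  obtain k where k: "k > 0" "\<And>v::'e. norm (imult v) \<le> k * norm v" using imult_bound by blast
  have "norm w \<le> ((1 + k) * M + 1) * sqrt (Qf w)" for w
  proof -
    have le: "sqrt (ip (rp w) (rp w)) \<le> sqrt (Qf w)" "sqrt (ip (jp w) (jp w)) \<le> sqrt (Qf w)"
      using ip_nonneg[OF rp_Lie] ip_nonneg[OF jp_Lie] by (auto simp: Qf_def)
    have "norm w \<le> norm (rp w) + norm (imult (jp w))" using rp_jp norm_triangle_ineq by metis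
    also have "\<dots> \<le> norm (rp w) + k * norm (jp w)" using k by simp
    also have "\<dots> \<le> M * sqrt (Qf w) + k * (M * sqrt (Qf w))"
      using bd[OF rp_Lie, of w] bd[OF jp_Lie, of w] le M k(1)
      by (intro add_mono mult_left_mono) (auto intro: order_trans[OF _ mult_left_mono])
    also have "\<dots> \<le> ((1 + k) * M + 1) * sqrt (Qf w)" using Qf_nonneg[of w] by (simp add: algebra_simps)
    finally show ?thesis .
  qed
  moreover have "(1 + k) * M + 1 > 0" using k M by (simp add: add_nonneg_pos)
  ultimately show ?thesis using that by blast
qed

lemma metric_N_Qf:
  "metric_N GC \<kappa> G m U Z Z = (\<Sum>l\<in>UNIV. Qf (dR GC \<kappa> (ginv (U $ l)) (U $ l) (Z $ l)))"
  by (simp add: metric_N_def metric_C_eq Qf_def)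

text \<open>The velocity of one link translated to the identity, where all velocities live in one
  space; the squared speed of a field is the sum of \<open>Qf\<close> of these over the
  links.\<close>

definition tvel :: "(real \<Rightarrow> 'g ^ 'l::finite) \<Rightarrow> 'l \<Rightarrow> real \<Rightarrow> 'e" where
  "tvel \<gamma> l t = dR GC \<kappa> (ginv (\<gamma> t $ l)) (\<gamma> t $ l) (velocity (vec_charts \<kappa>) \<gamma> t $ l)"

lemma C1_curveE:
  fixes \<gamma> :: "real \<Rightarrow> 'g ^ 'l::finite"
  assumes "C1_curve (vec_charts \<kappa>) \<gamma>"
  obtains D where "\<And>t. \<gamma> t \<in> cdom (vec_charts \<kappa>) p \<Longrightarrow>
      ((\<lambda>s. cmap (vec_charts \<kappa>) p (\<gamma> s)) has_vector_derivative D t) (at t)"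
    "continuous_on {t. \<gamma> t \<in> cdom (vec_charts \<kappa>) p} D"
  using assms unfolding C1_curve_def C1_differentiable_on_def by (metis (mono_tags, lifting) mem_Collect_eq)

lemma velocity_has_mderiv:
  fixes \<gamma> :: "real \<Rightarrow> 'g ^ 'l::finite"
  assumes C1: "C1_curve (vec_charts \<kappa>) \<gamma>"
  shows "has_mderiv std_charts \<kappa> (\<lambda>s. \<gamma> s $ l) t (\<lambda>s. s *\<^sub>R velocity (vec_charts \<kappa>) \<gamma> t $ l)"
proof -
  have "continuous_on UNIV \<gamma>" using C1 unfolding C1_curve_def by blast
  then have "(\<gamma> \<longlongrightarrow> \<gamma> t) (nhds t)" by (metis UNIV_I continuous_on_def tendsto_at_iff_tendsto_nhds)
  then have lim: "((\<lambda>s. \<gamma> s $ l) \<longlongrightarrow> \<gamma> t $ l) (nhds t)" by (rule tendsto_vec_nth)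
  obtain D where D: "\<And>s. \<gamma> s \<in> cdom (vec_charts \<kappa>) (\<gamma> t) \<Longrightarrow>
      ((\<lambda>s. cmap (vec_charts \<kappa>) (\<gamma> t) (\<gamma> s)) has_vector_derivative D s) (at s)"
    "continuous_on {s. \<gamma> s \<in> cdom (vec_charts \<kappa>) (\<gamma> t)} D"
    by (rule C1_curveE[OF C1, where p="\<gamma> t"]) blast
  have d: "((\<lambda>s. cmap (vec_charts \<kappa>) (\<gamma> t) (\<gamma> s)) has_vector_derivative D t) (at t)"
    by (rule D(1)[OF cdom_self[OF good_vec_charts[OF good]]])
  then have "velocity (vec_charts \<kappa>) \<gamma> t = D t" unfolding velocity_def by (rule vector_derivative_at)
  moreover have "((\<lambda>s. cmap (vec_charts \<kappa>) (\<gamma> t) (\<gamma> s) $ l) has_vector_derivative D t $ l) (at t)"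
    by (rule bounded_linear.has_vector_derivative[OF bounded_linear_vec_nth d])
  ultimately show ?thesis using lim
    by (simp add: has_mderiv_def vec_cmap has_vector_derivative_def o_def)
qed

lemma tvel_has_mderiv:
  fixes \<gamma> :: "real \<Rightarrow> 'g ^ 'l::finite"
  assumes C1: "C1_curve (vec_charts \<kappa>) \<gamma>"
  shows "has_mderiv std_charts \<kappa> (\<lambda>s. \<gamma> s $ l \<cdot> ginv (\<gamma> t $ l)) t (\<lambda>s. s *\<^sub>R tvel \<gamma> l t)"
  using has_mderiv_right_gmult[OF good_std_charts velocity_has_mderiv[OF C1, of l t], of "ginv (\<gamma> t $ l)"]
  by (simp add: tvel_def linear_scale[OF linear_dR])

text \<open>\<open>velocity\<close> at \<open>t\<close> is read in the chart at
  \<open>\<gamma> t\<close>, and charts need not depend continuously on their centre. Near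
  \<open>t0\<close> the translated velocity is therefore expressed in the chart at
  \<open>\<gamma> t0\<close>, as a partial derivative of (x, y) \<mapsto> x y^-1 applied to the
  continuous coordinate velocity.\<close>

lemma continuous_tvel:
  fixes \<gamma> :: "real \<Rightarrow> 'g ^ 'l::finite"
  assumes C1: "C1_curve (vec_charts \<kappa>) \<gamma>"
  shows "continuous_on UNIV (tvel \<gamma> l)"
proof (rule continuous_at_imp_continuous_on, rule ballI)
  fix t0 :: real
  define a where "a = \<gamma> t0 $ l"
  obtain D where D: "\<And>s. \<gamma> s \<in> cdom (vec_charts \<kappa>) (\<gamma> t0) \<Longrightarrow>
      ((\<lambda>s. cmap (vec_charts \<kappa>) (\<gamma> t0) (\<gamma> s)) has_vector_derivative D s) (at s)"
    and Dc: "continuous_on {s. \<gamma> s \<in> cdom (vec_charts \<kappa>) (\<gamma> t0)} D"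
    by (rule C1_curveE[OF C1, where p="\<gamma> t0"]) blast
  let ?A = "{s. \<gamma> s \<in> cdom (vec_charts \<kappa>) (\<gamma> t0)}"
  have \<gamma>: "continuous_on UNIV \<gamma>" using C1 unfolding C1_curve_def by blast
  have A: "open ?A" using open_vimage[OF open_cdom[OF good_vec_charts[OF good]] \<gamma>] by (simp add: vimage_def)
  have t0: "t0 \<in> ?A" using cdom_self[OF good_vec_charts[OF good]] by simp
  define \<xi> where "\<xi> = (\<lambda>s. cmap \<kappa> a (\<gamma> s $ l))"
  have dom: "\<gamma> s $ l \<in> cdom \<kappa> a" if "s \<in> ?A" for s using that by (simp add: vec_cdom a_def)
  have \<xi>: "(\<xi> has_vector_derivative D s $ l) (at s)" if "s \<in> ?A" for s
    using bounded_linear.has_vector_derivative[OF bounded_linear_vec_nth[of l] D[of s]] that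
    by (simp add: vec_cmap \<xi>_def a_def)
  let ?f = "\<lambda>z. cmap \<kappa> \<e> (cinv \<kappa> a (fst z) \<cdot> ginv (cinv \<kappa> a (snd z)))"
  let ?I = "cmap \<kappa> a ` cdom \<kappa> a"
  let ?O = "{z \<in> ?I \<times> ?I. cinv \<kappa> a (fst z) \<cdot> ginv (cinv \<kappa> a (snd z)) \<in> cdom \<kappa> \<e>}"
  have O: "open ?O" "holo_on ?f ?O" by (rule chart_mult_holo[OF ginv_holo])+
  have \<xi>O: "(\<xi> s, \<xi> s) \<in> ?O" if "s \<in> ?A" for s
    using dom[OF that] cdom_self[OF good] by (simp add: \<xi>_def cinv_cmap[OF good])
  have eq: "tvel \<gamma> l s = frechet_derivative ?f (at (\<xi> s, \<xi> s)) (D s $ l, 0)" if s: "s \<in> ?A" for s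
  proof -
    let ?F = "frechet_derivative ?f (at (\<xi> s, \<xi> s))"
    have F: "(?f has_derivative ?F) (at (\<xi> s, \<xi> s))" by (rule holo_onD(1)[OF O(2) \<xi>O[OF s]])
    have "((\<lambda>u. (\<xi> u, \<xi> s)) has_derivative (\<lambda>u. (u *\<^sub>R (D s $ l), 0))) (at s)"
      using \<xi>[OF s] unfolding has_vector_derivative_def by (intro has_derivative_Pair has_derivative_const)
    then have D2: "((\<lambda>u. ?f (\<xi> u, \<xi> s)) has_derivative (\<lambda>u. ?F (u *\<^sub>R (D s $ l), 0))) (at s)"
      using F by (rule has_derivative_compose)
    have ev: "\<forall>\<^sub>F u in nhds s. ?f (\<xi> u, \<xi> s) = cmap \<kappa> \<e> (\<gamma> u $ l \<cdot> ginv (\<gamma> s $ l))"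
      using eventually_nhds_in_open[OF A s]
      by eventually_elim (simp add: \<xi>_def cinv_cmap[OF good dom] cinv_cmap[OF good dom[OF s]] del: mem_Collect_eq)
    have "((\<lambda>u. cmap \<kappa> \<e> (\<gamma> u $ l \<cdot> ginv (\<gamma> s $ l))) has_derivative (\<lambda>u. u *\<^sub>R tvel \<gamma> l s)) (at s)"
      using has_mderivD(2)[OF tvel_has_mderiv[OF C1, of l s]] by (simp add: o_def)
    from has_derivative_unique[OF has_derivative_eventually_eq[OF D2 ev] this]
    have "?F (1 *\<^sub>R (D s $ l), 0) = 1 *\<^sub>R tvel \<gamma> l s" by metis
    then show ?thesis by simp
  qed
  have "(D \<longlongrightarrow> D t0) (at t0)"
    using Dc A t0 by (metis continuous_on_def at_within_open)
  then have Dl: "((\<lambda>s. (D s $ l, 0::'e)) \<longlongrightarrow> (D t0 $ l, 0)) (at t0)"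
    by (intro tendsto_Pair tendsto_vec_nth tendsto_const)
  have "isCont \<xi> t0" using \<xi>[OF t0] has_vector_derivative_continuous by blast
  then have "(\<xi> \<longlongrightarrow> \<xi> t0) (at t0)" by (simp add: isCont_def)
  then have \<xi>l: "((\<lambda>s. (\<xi> s, \<xi> s)) \<longlongrightarrow> (\<xi> t0, \<xi> t0)) (at t0)" by (intro tendsto_Pair)
  have "((\<lambda>s. frechet_derivative ?f (at (\<xi> s, \<xi> s)) (D s $ l, 0)) \<longlongrightarrow>
      frechet_derivative ?f (at (\<xi> t0, \<xi> t0)) (D t0 $ l, 0)) (at t0)"
    by (rule holo_derivative_tendsto[OF O \<xi>O[OF t0] \<xi>l Dl])
  moreover have "\<forall>\<^sub>F s in at t0. frechet_derivative ?f (at (\<xi> s, \<xi> s)) (D s $ l, 0) = tvel \<gamma> l s"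
    using eventually_at_in_open'[OF A t0] by eventually_elim (simp add: eq del: mem_Collect_eq)
  ultimately have "(tvel \<gamma> l \<longlongrightarrow> frechet_derivative ?f (at (\<xi> t0, \<xi> t0)) (D t0 $ l, 0)) (at t0)"
    by (rule Lim_transform_eventually)
  then show "isCont (tvel \<gamma> l) t0" by (simp add: isCont_def eq[OF t0])
qed

text \<open>Up to the factor \<open>c\<close>, the curve of a single link is no longer than the
  curve of the whole field; the quotient of its end points therefore lies in one compact set, the
  same for all fields of \<open>A\<close>.\<close>

lemma riemann_bounded_in_compact:
  fixes A :: "('g ^ 'l::finite) set"
  assumes "riemann_bounded (vec_charts \<kappa>) (metric_N GC \<kappa> G m) A"
  obtains C :: "'l \<Rightarrow> 'g set" where "\<And>l. compact (C l)" "\<And>U l. U \<in> A \<Longrightarrow> U $ l \<in> C l"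
proof -
  obtain p r where pr: "\<And>q. q \<in> A \<Longrightarrow> \<exists>\<gamma>. C1_curve (vec_charts \<kappa>) \<gamma> \<and> \<gamma> 0 = p \<and> \<gamma> 1 = q \<and>
      curve_length (vec_charts \<kappa>) (metric_N GC \<kappa> G m) \<gamma> \<le> r"
    using assms unfolding riemann_bounded_def by blast
  obtain c where c: "c > 0" "\<And>w. norm w \<le> c * sqrt (Qf w)" using norm_le_Qf by blast
  obtain K :: "nat \<Rightarrow> 'g set" and \<theta> where K: "\<And>k. compact (K k)" and \<theta>: "\<theta> > 0"
    and conf: "\<And>\<beta> W \<phi> \<phi>' k. \<lbrakk>continuous_on UNIV \<beta>;
      \<And>t. has_mderiv std_charts \<kappa> (\<lambda>s. \<beta> s \<cdot> ginv (\<beta> t)) t (\<lambda>s. s *\<^sub>R W t);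
      continuous_on {0..1} \<phi>;
      \<And>t. 0 < t \<Longrightarrow> t < 1 \<Longrightarrow> (\<phi> has_vector_derivative \<phi>' t) (at t);
      \<And>t. 0 < t \<Longrightarrow> t < 1 \<Longrightarrow> norm (W t) \<le> \<phi>' t;
      \<And>s t. \<lbrakk>0 \<le> s; s \<le> t; t \<le> 1\<rbrakk> \<Longrightarrow> \<phi> s \<le> \<phi> t; \<phi> 0 = 0; \<phi> 1 < real k * \<theta>\<rbrakk> \<Longrightarrow> \<beta> 1 \<cdot> ginv (\<beta> 0) \<in> K k"
  proof (rule curve_in_compact, goal_cases)
    case (1 K \<theta>)
    show ?case by (rule 1(1)[OF 1(2-4)])
  qed
  obtain k where k: "c * r < real k * \<theta>" using reals_Archimedean3[OF \<theta>] by blast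
  define C where "C = (\<lambda>l. (\<lambda>x. x \<cdot> p $ l) ` K k)"
  have "compact (C l)" for l
    unfolding C_def by (intro compact_continuous_image K continuous_on_gmult continuous_on_id continuous_on_const)
  moreover have "U $ l \<in> C l" if U: "U \<in> A" for U l
  proof -
    obtain \<gamma> where C1: "C1_curve (vec_charts \<kappa>) \<gamma>" and \<gamma>: "\<gamma> 0 = p" "\<gamma> 1 = U"
      and len: "curve_length (vec_charts \<kappa>) (metric_N GC \<kappa> G m) \<gamma> \<le> r" using pr[OF U] by blast
    define \<sigma> where "\<sigma> = (\<lambda>t. sqrt (\<Sum>l\<in>UNIV. Qf (tvel \<gamma> l t)))"
    have len': "integral {0..1} \<sigma> \<le> r"
      using len by (simp add: curve_length_def metric_N_Qf \<sigma>_def tvel_def)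
    have \<sigma>c: "continuous_on S \<sigma>" for S
      unfolding \<sigma>_def
      by (intro continuous_intros continuous_on_compose2[OF continuous_Qf]
          continuous_on_subset[OF continuous_tvel[OF C1]]) auto
    have \<sigma>0: "\<sigma> t \<ge> 0" for t unfolding \<sigma>_def by (simp add: sum_nonneg Qf_nonneg)
    \<comment> \<open>\<open>c\<close> times the arc length: its derivative dominates the coordinate
      norm of the translated velocity of each link, as \<open>curve_in_compact\<close>
      demands.\<close>
    define \<phi> where "\<phi> = (\<lambda>t. c * integral {0..t} \<sigma>)"
    have int: "\<sigma> integrable_on {a..b}" for a b by (rule integrable_continuous_real[OF \<sigma>c])
    have "U $ l \<cdot> ginv (p $ l) \<in> K k"
      unfolding \<gamma>[symmetric]
    proof (rule conf[of "\<lambda>t. \<gamma> t $ l" "tvel \<gamma> l" \<phi> "\<lambda>t. c * \<sigma> t" k])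
      show "continuous_on UNIV (\<lambda>t. \<gamma> t $ l)"
        using C1 unfolding C1_curve_def by (intro continuous_on_compose2[OF continuous_on_vec_nth]) auto
      show "has_mderiv std_charts \<kappa> (\<lambda>s. \<gamma> s $ l \<cdot> ginv (\<gamma> t $ l)) t (\<lambda>s. s *\<^sub>R tvel \<gamma> l t)" for t
        by (rule tvel_has_mderiv[OF C1])
      show "continuous_on {0..1} \<phi>"
        unfolding \<phi>_def by (intro continuous_intros indefinite_integral_continuous_1 int)
      show "(\<phi> has_vector_derivative c * \<sigma> t) (at t)" if t: "0 < t" "t < 1" for t
      proof -
        have "((\<lambda>u. integral {0..u} \<sigma>) has_vector_derivative \<sigma> t) (at t within {0..1})"
          using t by (intro integral_has_vector_derivative \<sigma>c) auto
        moreover have "at t within {0..1} = at t" using t by (intro at_within_interior) auto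
        ultimately have "((\<lambda>u. integral {0..u} \<sigma>) has_vector_derivative \<sigma> t) (at t)" by simp
        then show ?thesis unfolding \<phi>_def by (auto intro!: derivative_eq_intros)
      qed
      show "norm (tvel \<gamma> l t) \<le> c * \<sigma> t" for t
      proof -
        have "Qf (tvel \<gamma> l t) \<le> (\<Sum>l\<in>UNIV. Qf (tvel \<gamma> l t))"
          by (rule member_le_sum) (auto simp: Qf_nonneg)
        then have "sqrt (Qf (tvel \<gamma> l t)) \<le> \<sigma> t" unfolding \<sigma>_def by simp
        then show ?thesis using c(2)[of "tvel \<gamma> l t"] c(1)
          by (meson less_imp_le mult_left_mono order_trans)
      qed
      show "\<phi> s \<le> \<phi> t" if "0 \<le> s" "s \<le> t" for s t
        unfolding \<phi>_def using c(1) that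
        by (intro mult_left_mono integral_subset_le int) (auto simp: \<sigma>0)
      show "\<phi> 0 = 0" by (simp add: \<phi>_def)
      have "\<phi> 1 \<le> c * r" unfolding \<phi>_def using c(1) len' by (intro mult_left_mono) auto
      then show "\<phi> 1 < real k * \<theta>" using k by simp
    qed
    then show ?thesis unfolding C_def by (force simp: gmult_assoc intro!: image_eqI[of _ _ "U $ l \<cdot> ginv (p $ l)"])
  qed
  ultimately show ?thesis using that by blast
qed

end

section \<open>Recurrence, maximum principle and analytic continuation\<close>

text \<open>A cluster point of \<open>\<gamma> (n T)\<close> yields arbitrarily good returns, which a monotone
  function that has increased on \<open>[0, T]\<close> does not allow.\<close>

lemma recurrent_mono_const:
  fixes \<Phi> :: "'a::topological_space \<times> 'a \<Rightarrow> real" and \<gamma> :: "real \<Rightarrow> 'a"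
  assumes K: "compact K" "\<And>t. \<gamma> t \<in> K"
    and \<Phi>: "continuous_on UNIV \<Phi>" "\<And>y. \<Phi> (y, y) = g 0" "\<And>s t. \<Phi> (\<gamma> s, \<gamma> t) = g (s - t)"
    and mono: "\<And>s t. 0 \<le> s \<Longrightarrow> s \<le> t \<Longrightarrow> g s \<le> g t"
    and T: "0 \<le> T"
  shows "g T = g 0"
proof (rule ccontr)
  assume "g T \<noteq> g 0"
  then have gT: "g 0 < g T" using mono[of 0 T] T by simp
  \<comment> \<open>A cluster point of this filter replaces the limit of a subsequence:
    \<open>'a\<close> is only a topological space.\<close>
  let ?F = "filtermap (\<lambda>n::nat. \<gamma> (real n * T)) sequentially"
  have "\<forall>\<^sub>F y in ?F. y \<in> K" using K(2) by (simp add: eventually_filtermap)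
  moreover have "?F \<noteq> bot" by (simp add: filtermap_bot_iff)
  ultimately have "\<exists>x\<in>K. inf (nhds x) ?F \<noteq> bot"
    using K(1)[unfolded compact_filter, rule_format, of ?F] by simp
  then obtain x where x: "inf (nhds x) ?F \<noteq> bot" by blast
  \<comment> \<open>On the diagonal \<Phi> equals \<open>g 0\<close>, which is below
    \<open>g T\<close>. So two visits of the orbit near \<open>x\<close> give \<Phi> below
    \<open>g T\<close>, although their times can be chosen to differ by at least
    \<open>T\<close>.\<close>
  have "open {z. \<Phi> z < g T}" using open_Collect_less[OF \<Phi>(1) continuous_on_const] .
  moreover have "(x, x) \<in> {z. \<Phi> z < g T}" using \<Phi>(2) gT by simp
  ultimately obtain A B where AB: "open A" "open B" "x \<in> A" "x \<in> B" "A \<times> B \<subseteq> {z. \<Phi> z < g T}"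
    by (auto elim!: open_prod_elim)
  define N where "N = A \<inter> B"
  have N: "open N" "x \<in> N" using AB by (auto simp: N_def)
  have freq: "\<exists>n\<ge>k. \<gamma> (real n * T) \<in> N" for k
  proof (rule ccontr)
    assume "\<not> ?thesis"
    then have "\<forall>\<^sub>F n in sequentially. \<gamma> (real n * T) \<notin> N" unfolding eventually_sequentially by blast
    then have "\<forall>\<^sub>F y in ?F. y \<notin> N" by (simp add: eventually_filtermap)
    moreover have "\<forall>\<^sub>F y in nhds x. y \<in> N" using N by (rule eventually_nhds_in_open)
    ultimately have "\<forall>\<^sub>F y in inf (nhds x) ?F. False" unfolding eventually_inf by blast
    then show False using x by (simp add: eventually_False)
  qed
  obtain n where n: "\<gamma> (real n * T) \<in> N" using freq[of 0] by blast
  obtain k where k: "k \<ge> Suc n" "\<gamma> (real k * T) \<in> N" using freq[of "Suc n"] by blast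
  have "\<Phi> (\<gamma> (real k * T), \<gamma> (real n * T)) < g T" using AB(5) n k unfolding N_def by blast
  then have "g (real k * T - real n * T) < g T" using \<Phi>(3) by simp
  moreover have "T \<le> real k * T - real n * T"
  proof -
    have "1 * T \<le> (real k - real n) * T" using k(1) T by (intro mult_right_mono) auto
    then show ?thesis by (simp add: algebra_simps)
  qed
  ultimately show False using mono[OF T] by fastforce
qed

text \<open>A nonconstant holomorphic function maps the disc onto an open set, which would contain
  points straight above \<open>f 0\<close>.\<close>

lemma Im_max_constant:
  assumes f: "f holomorphic_on ball 0 r" and max: "\<And>z. z \<in> ball 0 r \<Longrightarrow> Im (f z) \<le> Im (f 0)"
    and z: "z \<in> ball 0 r"
  shows "f z = f 0"
proof -
  have r: "0 < r" using z by (metis ball_eq_empty empty_iff not_le)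
  have "f constant_on ball 0 r"
  proof (rule ccontr)
    assume "\<not> f constant_on ball 0 r"
    then have "open (f ` ball 0 r)" using open_mapping_thm[OF f] by auto
    moreover have "f 0 \<in> f ` ball 0 r" using r by simp
    ultimately obtain e where e: "e > 0" "ball (f 0) e \<subseteq> f ` ball 0 r" using open_contains_ball by metis
    have "f 0 + \<i> * of_real (e/2) \<in> ball (f 0) e" using e by (simp add: dist_norm norm_mult)
    then obtain w where "w \<in> ball 0 r" "f w = f 0 + \<i> * of_real (e/2)" using e by (metis imageE subsetD)
    with max[of w] e(1) show False by simp
  qed
  then show ?thesis unfolding constant_on_def using z r by (metis centre_in_ball)
qed

section \<open>Maximum principle and identity theorem on a complex manifold\<close>

context
  fixes \<kappa> :: "('a::topological_space, 'e::{euclidean_space,complex_space}) charts" and S :: "'a \<Rightarrow> complex"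
  assumes good: "good_charts \<kappa>" and S: "holo_map \<kappa> std_charts S"
begin

lemma holo_chart: "holo_on (\<lambda>z. S (cinv \<kappa> p z)) (cmap \<kappa> p ` cdom \<kappa> p)"
  using S unfolding holo_map_def by (simp add: o_def)

lemma holo_chart_line:
  assumes "\<And>\<zeta>. \<zeta> \<in> D \<Longrightarrow> w + cscale \<zeta> v \<in> cmap \<kappa> p ` cdom \<kappa> p" "open D"
  shows "(\<lambda>\<zeta>. S (cinv \<kappa> p (w + cscale \<zeta> v))) holomorphic_on D"
  using holo_on_compose[OF holo_on_line holo_chart, of w v D p] assms holo_on_complex_iff by blast

lemma eventually_in_chart_ball:
  assumes "r > 0" shows "\<forall>\<^sub>F x in nhds p. x \<in> cdom \<kappa> p \<and> cmap \<kappa> p x \<in> ball (cmap \<kappa> p p) r"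
proof (rule eventually_conj[OF eventually_cdom[OF good cdom_self[OF good]]])
  show "\<forall>\<^sub>F x in nhds p. cmap \<kappa> p x \<in> ball (cmap \<kappa> p p) r"
    by (rule topological_tendstoD[OF filterlim_cmap[OF good cdom_self[OF good]]]) (use assms in auto)
qed

lemma chart_ball:
  obtains r where "r > 0" "ball (cmap \<kappa> p p) r \<subseteq> cmap \<kappa> p ` cdom \<kappa> p"
proof -
  have "open (cmap \<kappa> p ` cdom \<kappa> p)" by (rule open_cimage[OF good])
  moreover have "cmap \<kappa> p p \<in> cmap \<kappa> p ` cdom \<kappa> p" using cdom_self[OF good] by blast
  ultimately show ?thesis using that open_contains_ball by metis
qed

text \<open>Reduced to one variable along complex lines through the centre of the chart. The
  parameter runs over a disc of radius 2 so that the target point, at parameter 1, is interior;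
  \<open>r / (2 * k)\<close> keeps these discs in the ball of radius \<open>r\<close>.\<close>

lemma Im_max_locally_constant:
  assumes max: "\<forall>\<^sub>F x in nhds p. Im (S x) \<le> Im (S p)"
  shows "\<forall>\<^sub>F x in nhds p. S x = S p"
proof -
  let ?z0 = "cmap \<kappa> p p" and ?I = "cmap \<kappa> p ` cdom \<kappa> p"
  obtain r1 where r1: "r1 > 0" "ball ?z0 r1 \<subseteq> ?I" by (rule chart_ball)
  have "\<forall>\<^sub>F z in nhds ?z0. Im (S (cinv \<kappa> p z)) \<le> Im (S p)"
    by (rule eventually_compose_filterlim[OF max filterlim_cinv_center[OF good]])
  then obtain r2 where r2: "r2 > 0" "\<And>z. z \<in> ball ?z0 r2 \<Longrightarrow> Im (S (cinv \<kappa> p z)) \<le> Im (S p)"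
    unfolding eventually_nhds_metric by (auto simp: dist_commute)
  obtain k where k: "k > 0" "\<And>z (v::'e). norm (cscale z v) \<le> k * norm z * norm v"
    using cscale_bound by blast
  define r where "r = min r1 r2"
  have r: "r > 0" using r1 r2 by (simp add: r_def)
  have const: "S (cinv \<kappa> p z) = S p" if z: "z \<in> ball ?z0 (r / (2 * k))" for z
  proof -
    let ?f = "\<lambda>\<zeta>. S (cinv \<kappa> p (?z0 + cscale \<zeta> (z - ?z0)))"
    have mem: "?z0 + cscale \<zeta> (z - ?z0) \<in> ball ?z0 r" if "\<zeta> \<in> ball 0 2" for \<zeta>
    proof -
      have "norm (cscale \<zeta> (z - ?z0)) \<le> k * norm \<zeta> * norm (z - ?z0)" by (rule k)
      also have "\<dots> \<le> k * 2 * norm (z - ?z0)" using that k(1) by (intro mult_right_mono mult_left_mono) auto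
      also have "\<dots> < k * 2 * (r / (2 * k))"
        using z k(1) by (intro mult_strict_left_mono) (auto simp: dist_norm norm_minus_commute)
      also have "\<dots> = r" using k(1) by simp
      finally show ?thesis by (simp add: dist_norm)
    qed
    have "?f holomorphic_on ball 0 2"
      using mem r1 by (intro holo_chart_line) (auto simp: r_def)
    moreover have "Im (?f \<zeta>) \<le> Im (?f 0)" if "\<zeta> \<in> ball 0 2" for \<zeta>
      using r2(2)[of "?z0 + cscale \<zeta> (z - ?z0)"] mem[OF that]
      by (simp add: r_def cinv_cmap[OF good] cdom_self[OF good])
    ultimately have "?f 1 = ?f 0" by (rule Im_max_constant[of _ 2]) (simp_all add: dist_norm)
    then show ?thesis by (simp add: cinv_cmap[OF good] cdom_self[OF good])
  qed
  have "r / (2 * k) > 0" using r k by simp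
  from eventually_in_chart_ball[OF this, of p] show ?thesis
  proof eventually_elim
    case (elim x)
    then have "S (cinv \<kappa> p (cmap \<kappa> p x)) = S p" using const by blast
    then show ?case using elim by (simp add: cinv_cmap[OF good])
  qed
qed

text \<open>The set where \<open>S\<close> equals \<open>c\<close> nearby is open and closed: if a
  small chart ball contains one of its points, analytic continuation on the complex line from that
  point to any other point of the ball shows that the whole ball belongs to it.\<close>

lemma holo_identity_connected:
  assumes C: "connected C" "p \<in> C" "x \<in> C" and loc: "\<forall>\<^sub>F x in nhds p. S x = c"
  shows "S x = c"
proof -
  define A where "A = {x. \<forall>\<^sub>F y in nhds x. S y = c}"
  have "open A"
  proof (subst open_subopen, rule ballI)
    fix x assume "x \<in> A"
    then obtain T where T: "open T" "x \<in> T" "\<forall>y\<in>T. S y = c" unfolding A_def eventually_nhds by blast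
    then have "T \<subseteq> A" unfolding A_def eventually_nhds by blast
    then show "\<exists>T. open T \<and> x \<in> T \<and> T \<subseteq> A" using T by blast
  qed
  moreover have "open (- A)"
  proof (subst open_subopen, rule ballI)
    fix q assume q: "q \<in> - A"
    let ?z0 = "cmap \<kappa> q q" and ?I = "cmap \<kappa> q ` cdom \<kappa> q"
    obtain r where r: "r > 0" "ball ?z0 r \<subseteq> ?I" by (rule chart_ball)
    obtain k where k: "k > 0" "\<And>z (v::'e). norm (cscale z v) \<le> k * norm z * norm v"
      using cscale_bound by blast
    \<comment> \<open>Two points of the ball of radius \<rho> are at most 2\<rho> apart, so a line
      with parameter in the disc of radius 2 moves away from its start by at most 4k\<rho>; hence
      the requirement \<rho> + 4k\<rho> = r.\<close>
    define \<rho> where "\<rho> = r / (1 + 4 * k)"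
    have \<rho>: "\<rho> > 0" using r k by (simp add: \<rho>_def)
    have "\<rho> * (1 + 4 * k) = r" using k(1) by (simp add: \<rho>_def)
    then have \<rho>r: "\<rho> + 4 * k * \<rho> = r" by (simp add: algebra_simps)
    define W where "W = cdom \<kappa> q \<inter> cmap \<kappa> q -` ball ?z0 \<rho>"
    have W: "open W" unfolding W_def
      by (intro continuous_open_preimage continuous_on_cmap[OF good] open_cdom[OF good] open_ball)
    have qW: "q \<in> W" using \<rho> by (simp add: W_def cdom_self[OF good])
    have "W \<subseteq> A" if y: "y \<in> W" "y \<in> A" for y
    proof -
      let ?w = "cmap \<kappa> q y"
      have const: "S x = c" if x: "x \<in> W" for x
      proof -
        let ?u = "cmap \<kappa> q x"
        let ?f = "\<lambda>\<zeta>. S (cinv \<kappa> q (?w + cscale \<zeta> (?u - ?w)))"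
        have mem: "?w + cscale \<zeta> (?u - ?w) \<in> ball ?z0 r" if "\<zeta> \<in> ball 0 2" for \<zeta>
        proof -
          have "norm (?u - ?w) \<le> norm (?u - ?z0) + norm (?z0 - ?w)"
            using norm_triangle_ineq[of "?u - ?z0" "?z0 - ?w"] by simp
          then have zw: "norm (?u - ?w) \<le> 2 * \<rho>"
            using x y by (simp add: W_def dist_norm norm_minus_commute)
          have "norm (cscale \<zeta> (?u - ?w)) \<le> k * norm \<zeta> * norm (?u - ?w)" by (rule k)
          also have "\<dots> \<le> k * 2 * (2 * \<rho>)" using that k(1) zw by (intro mult_mono mult_left_mono) auto
          finally have "norm (cscale \<zeta> (?u - ?w)) \<le> 4 * k * \<rho>" by simp
          moreover have "dist ?z0 (?w + cscale \<zeta> (?u - ?w)) \<le> dist ?z0 ?w + norm (cscale \<zeta> (?u - ?w))"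
            using norm_triangle_ineq4[of "?z0 - ?w" "cscale \<zeta> (?u - ?w)"] by (simp add: dist_norm diff_diff_eq)
          moreover have "dist ?z0 ?w < \<rho>" using y by (simp add: W_def)
          ultimately show ?thesis using \<rho>r by simp
        qed
        have f: "?f holomorphic_on ball 0 2" using mem r by (intro holo_chart_line) auto
        have yd: "y \<in> cdom \<kappa> q" using y by (simp add: W_def)
        have "((\<lambda>\<zeta>. ?w + cscale \<zeta> (?u - ?w)) \<longlongrightarrow> ?w + cscale 0 (?u - ?w)) (nhds 0)"
          by (intro tendsto_add tendsto_const bounded_linear.tendsto[OF bounded_linear_cscale] filterlim_ident)
        then have "filterlim (\<lambda>\<zeta>. ?w + cscale \<zeta> (?u - ?w)) (nhds ?w) (nhds 0)" by simp
        then have lim: "filterlim (\<lambda>\<zeta>. cinv \<kappa> q (?w + cscale \<zeta> (?u - ?w))) (nhds y) (nhds 0)"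
          using filterlim_compose[OF filterlim_cinv[OF good imageI[OF yd]]] by (simp add: cinv_cmap[OF good yd])
        have "\<forall>\<^sub>F x in nhds y. S x = c" using y(2) by (simp add: A_def)
        then have "\<forall>\<^sub>F \<zeta> in nhds 0. ?f \<zeta> = c" using lim by (rule eventually_compose_filterlim)
        then obtain T where T: "open T" "0 \<in> T" "\<forall>\<zeta>\<in>T. ?f \<zeta> = c" unfolding eventually_nhds by (elim exE conjE)
        have "?f 1 = c"
        proof (rule analytic_continuation_open[of "T \<inter> ball 0 2" "ball 0 2" ?f "\<lambda>_. c"])
          show "T \<inter> ball 0 2 \<noteq> {}" using T(2) by auto
          show "open (T \<inter> ball 0 2)" using T(1) by (intro open_Int) auto
          show "?f \<zeta> = c" if "\<zeta> \<in> T \<inter> ball 0 2" for \<zeta> using T(3) that by simp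
          show "?f holomorphic_on ball 0 2" by (rule f)
          show "(1 :: complex) \<in> ball 0 2" by (simp add: dist_norm)
        qed (simp_all add: holomorphic_on_const)
        moreover have "x \<in> cdom \<kappa> q" using x by (simp add: W_def)
        ultimately show ?thesis by (simp add: cinv_cmap[OF good])
      qed
      show ?thesis
      proof
        fix x assume "x \<in> W"
        with W have "\<forall>\<^sub>F y in nhds x. y \<in> W" by (rule eventually_nhds_in_open)
        then have "\<forall>\<^sub>F y in nhds x. S y = c" by eventually_elim (rule const)
        then show "x \<in> A" by (simp add: A_def)
      qed
    qed
    then have "W \<subseteq> - A" using q qW by blast
    then show "\<exists>T. open T \<and> q \<in> T \<and> T \<subseteq> - A" using W qW by blast
  qed
  ultimately have "A \<inter> C = {} \<or> - A \<inter> C = {}" using C(1) by (intro connectedD) auto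
  moreover have "p \<in> A" using loc by (simp add: A_def)
  ultimately have "x \<in> A" using C by blast
  then show ?thesis using eventually_nhds_x_imp_x unfolding A_def by blast
qed

end

text \<open>Preimages of coordinate balls are connected neighbourhoods, so components are
  open.\<close>

lemma eventually_in_component:
  fixes \<kappa> :: "('a::topological_space, 'e::real_normed_vector) charts"
  assumes good: "good_charts \<kappa>" and C: "C \<in> components (UNIV :: 'a set)" "p \<in> C"
  shows "\<forall>\<^sub>F x in nhds p. x \<in> C"
proof -
  let ?z0 = "cmap \<kappa> p p" and ?I = "cmap \<kappa> p ` cdom \<kappa> p"
  have "?z0 \<in> ?I" using cdom_self[OF good] by blast
  then obtain r where r: "r > 0" "ball ?z0 r \<subseteq> ?I" using open_cimage[OF good] open_contains_ball by metis
  let ?W = "cinv \<kappa> p ` ball ?z0 r"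
  have "connected ?W"
    by (intro connected_continuous_image continuous_on_subset[OF continuous_on_cinv[OF good] r(2)]) simp
  moreover have "p \<in> ?W" using r(1) by (metis cinv_cmap[OF good cdom_self[OF good]] centre_in_ball image_eqI)
  ultimately have "?W \<subseteq> C" using components_maximal[OF C(1)] C(2) by blast
  have lim: "(cmap \<kappa> p \<longlongrightarrow> ?z0) (nhds p)" by (rule filterlim_cmap[OF good cdom_self[OF good]])
  have "\<forall>\<^sub>F x in nhds p. cmap \<kappa> p x \<in> ball ?z0 r"
    by (rule topological_tendstoD[OF lim]) (use r in auto)
  with eventually_cdom[OF good cdom_self[OF good]] show ?thesis
  proof eventually_elim
    case (elim x)
    then have "x \<in> ?W" by (metis cinv_cmap[OF good] image_eqI)
    then show ?case using \<open>?W \<subseteq> C\<close> by blast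
  qed
qed

section \<open>Compactness, connectedness and closedness of products over the links\<close>

lemma vec_set_eq_image: "{U :: 'a ^ 'l. \<forall>l. U $ l \<in> C l} = (\<lambda>f. \<chi> l. f l) ` PiE UNIV C"
proof
  show "{U :: 'a ^ 'l. \<forall>l. U $ l \<in> C l} \<subseteq> (\<lambda>f. \<chi> l. f l) ` PiE UNIV C"
  proof
    fix U :: "'a ^ 'l" assume "U \<in> {U. \<forall>l. U $ l \<in> C l}"
    then have "(\<lambda>l. U $ l) \<in> PiE UNIV C" by auto
    then show "U \<in> (\<lambda>f. \<chi> l. f l) ` PiE UNIV C" by (rule rev_image_eqI) simp
  qed
qed auto

lemma continuous_vec_lambda:
  fixes A :: "('l::finite \<Rightarrow> 'a::topological_space) set"
  shows "continuous_on A (\<lambda>f. \<chi> l. f l)"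
  by (intro continuous_on_vec_lambda continuous_on_subset[OF continuous_on_product_coordinates]) auto

text \<open>Tychonoff's theorem for the function space, carried over by the continuous map
  \<open>\<lambda>f. \<chi> l. f l\<close>.\<close>

lemma compact_vec:
  assumes "\<And>l. compact (C l)"
  shows "compact {U :: 'a::topological_space ^ 'l::finite. \<forall>l. U $ l \<in> C l}"
proof -
  have "compactin (product_topology (\<lambda>_. euclidean) UNIV) (PiE UNIV C)"
    using assms by (simp add: compactin_PiE)
  then have "compact (PiE UNIV C)" unfolding euclidean_product_topology compactin_euclidean_iff .
  then show ?thesis unfolding vec_set_eq_image by (intro compact_continuous_image continuous_vec_lambda)
qed

lemma connected_vec:
  assumes "\<And>l. connected (C l)"
  shows "connected {U :: 'a::topological_space ^ 'l::finite. \<forall>l. U $ l \<in> C l}"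
proof -
  have "connectedin (product_topology (\<lambda>_. euclidean) UNIV) (PiE UNIV C)"
    using assms by (simp add: connectedin_PiE)
  then have "connected (PiE UNIV C)" unfolding euclidean_product_topology by simp
  then show ?thesis unfolding vec_set_eq_image by (intro connected_continuous_image continuous_vec_lambda)
qed

lemma closed_vec:
  assumes "\<And>l. closed (C l)"
  shows "closed {U :: 'a::topological_space ^ 'l::finite. \<forall>l. U $ l \<in> C l}"
proof -
  have "{U :: 'a ^ 'l. \<forall>l. U $ l \<in> C l} = (\<Inter>l. (\<lambda>U. U $ l) -` C l)" by auto
  moreover have "closed (\<Inter>l. (\<lambda>U :: 'a ^ 'l. U $ l) -` C l)"
    by (intro closed_INT ballI closed_vimage assms continuous_on_vec_nth)
  ultimately show ?thesis by simp
qed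

lemma has_mderiv_cmap_self:
  assumes "good_charts \<kappa>"
  shows "has_mderiv \<kappa> std_charts (cmap \<kappa> p) p (\<lambda>v. v)"
  using has_mderivD(2)[OF has_mderiv_ident[OF assms, of p]] filterlim_cmap[OF assms cdom_self[OF assms, of p]]
  by (simp add: has_mderiv_def o_def)

lemma has_mderiv_cinv_self:
  assumes "good_charts \<kappa>"
  shows "has_mderiv std_charts \<kappa> (cinv \<kappa> p) (cmap \<kappa> p p) (\<lambda>v. v)"
  using has_mderivD(2)[OF has_mderiv_ident[OF assms, of p]] filterlim_cinv_center[OF assms, of p]
  by (simp add: has_mderiv_def o_def cinv_cmap[OF assms cdom_self[OF assms]])

text \<open>Realises every tangent vector as a velocity, which allows two normals to be tested
  against the same direction.\<close>

lemma chart_line_has_mderiv: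
  fixes \<kappa> :: "('a::topological_space, 'e::real_normed_vector) charts"
  assumes good: "good_charts \<kappa>"
  obtains c :: "real \<Rightarrow> 'a" where "c 0 = p" "has_mderiv std_charts \<kappa> c 0 (\<lambda>s. s *\<^sub>R v)"
proof (rule that)
  let ?l = "\<lambda>s::real. cmap \<kappa> p p + s *\<^sub>R v"
  have "has_mderiv std_charts std_charts ?l 0 (\<lambda>s. s *\<^sub>R v)"
    unfolding has_mderiv_std_iff by (auto intro!: derivative_eq_intros)
  moreover have "has_mderiv std_charts \<kappa> (cinv \<kappa> p) (?l 0) (\<lambda>v. v)"
    using has_mderiv_cinv_self[OF good] by simp
  ultimately show "has_mderiv std_charts \<kappa> (\<lambda>s. cinv \<kappa> p (?l s)) 0 (\<lambda>s. s *\<^sub>R v)"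
    using has_mderiv_compose[OF good_std_charts good_std_charts] by blast
  show "cinv \<kappa> p (?l 0) = p" by (simp add: cinv_cmap[OF good cdom_self[OF good]])
qed

lemma has_mderiv_vec_nth:
  assumes "has_mderiv \<kappa> (vec_charts \<kappa>') F p F'"
  shows "has_mderiv \<kappa> \<kappa>' (\<lambda>x. F x $ l) p (\<lambda>v. F' v $ l)"
  using tendsto_vec_nth[OF has_mderivD(1)[OF assms]]
    bounded_linear.has_derivative[OF bounded_linear_vec_nth[of l] has_mderivD(2)[OF assms]]
  by (simp add: has_mderiv_def vec_cmap o_def)

context complexified_group
begin

lemma dL_one: "dL GC \<kappa> \<e> g v = v"
  using has_mderiv_unique[OF has_mderiv_dL[of \<e> g]] has_mderiv_ident[OF good] by (metis one_gmult ext)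

text \<open>In the chart at the identity the homomorphism law makes \<open>\<gamma> t\<close> the
  square of \<open>\<gamma> (t/2)\<close>, and squaring there has differential v + v. So
  \<open>complexify_squaring_curve\<close> extends the coordinate curve, and the inverse chart
  brings the extension back to the group.\<close>

lemma one_param_complexify:
  assumes \<gamma>: "one_param GC \<kappa> B \<gamma>"
  obtains \<epsilon> and E :: "complex \<Rightarrow> 'g" where "\<epsilon> > 0" "\<And>t. \<bar>t\<bar> < \<epsilon> \<Longrightarrow> E (of_real t) = \<gamma> t"
    "\<And>z. z \<in> ball 0 \<epsilon> \<Longrightarrow> \<exists>T. has_mderiv std_charts \<kappa> E z T \<and> (\<forall>v. T (imult v) = imult (T v))"
proof -
  let ?P = "\<lambda>z. cinv \<kappa> \<e> (fst z) \<cdot> cinv \<kappa> \<e> (snd z)"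
  let ?I = "cmap \<kappa> \<e> ` cdom \<kappa> \<e>"
  let ?O = "{z \<in> ?I \<times> ?I. ?P z \<in> cdom \<kappa> \<e>}"
  define z0 where "z0 = cmap \<kappa> \<e> \<e>"
  define sq where "sq = (\<lambda>z. cmap \<kappa> \<e> (cinv \<kappa> \<e> z \<cdot> cinv \<kappa> \<e> z))"
  define S where "S = (\<lambda>z. (z, z)) -` ?O"
  have e0: "\<e> \<in> cdom \<kappa> \<e>" by (rule cdom_self[OF good])
  have z0: "cinv \<kappa> \<e> z0 = \<e>" "z0 \<in> ?I" using e0 by (simp_all add: z0_def cinv_cmap[OF good])
  have O: "open ?O" "holo_on (\<lambda>z. cmap \<kappa> \<e> (?P z)) ?O" by (rule chart_mult_holo[OF ident_holo])+
  have S: "open S" unfolding S_def by (intro open_vimage O continuous_intros)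
  have diag: "holo_on (\<lambda>z::'e. (z, z)) S"
    by (rule holo_on_linear) (auto simp: imult_prod_def intro: bounded_linear_Pair bounded_linear_ident)
  have sqS: "holo_on sq S"
  proof -
    have "(\<lambda>z. (z, z)) ` S \<subseteq> ?O" by (auto simp: S_def)
    from holo_on_compose[OF diag O(2) this] show ?thesis by (simp add: sq_def)
  qed
  have z0S: "z0 \<in> S" using z0 e0 by (simp add: S_def)
  have sq0: "sq z0 = z0" using z0 by (simp add: sq_def z0_def)
  have "has_mderiv std_charts \<kappa> (cinv \<kappa> \<e>) z0 (\<lambda>v. v)"
    unfolding z0_def by (rule has_mderiv_cinv_self[OF good])
  from has_mderiv_gmult[OF good_std_charts this this]
  have "has_mderiv std_charts \<kappa> (\<lambda>z. cinv \<kappa> \<e> z \<cdot> cinv \<kappa> \<e> z) z0 (\<lambda>v. v + v)"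
    by (simp add: z0 dR_one dL_one)
  moreover have "has_mderiv \<kappa> std_charts (cmap \<kappa> \<e>) (cinv \<kappa> \<e> z0 \<cdot> cinv \<kappa> \<e> z0) (\<lambda>v. v)"
    using has_mderiv_cmap_self[OF good, of \<e>] by (simp add: z0)
  ultimately have "has_mderiv std_charts std_charts sq z0 (\<lambda>v. v + v)"
    unfolding sq_def by (rule has_mderiv_compose[OF good_std_charts good])
  then have "(sq has_derivative (\<lambda>v. 2 *\<^sub>R v)) (at z0)" by (simp add: has_mderiv_std_iff scaleR_2)
  then have D: "frechet_derivative sq (at z0) = (\<lambda>v. 2 *\<^sub>R v)" using frechet_derivative_at by metis
  define x where "x = (\<lambda>t. cmap \<kappa> \<e> (\<gamma> t))"
  have x0: "x 0 = z0" by (simp add: x_def z0_def one_param_zero[OF \<gamma>])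
  have xd: "(x has_vector_derivative B) (at 0)" using \<gamma> unfolding one_param_def x_def by blast
  have "(\<gamma> \<longlongrightarrow> \<gamma> 0) (nhds 0)"
    using one_param_continuous[OF \<gamma>] by (metis UNIV_I continuous_on_def tendsto_at_iff_tendsto_nhds)
  then have ev: "\<forall>\<^sub>F t in nhds 0. \<gamma> t \<in> cdom \<kappa> \<e>"
    using eventually_compose_filterlim[OF eventually_cdom[OF good e0]] one_param_zero[OF \<gamma>] by simp
  moreover have "filterlim (\<lambda>t::real. t / 2) (nhds 0) (nhds 0)"
    using tendsto_divide[OF filterlim_ident tendsto_const, of 2 "0::real"] by simp
  ultimately have "\<forall>\<^sub>F t in nhds 0. \<gamma> (t / 2) \<in> cdom \<kappa> \<e>" by (rule eventually_compose_filterlim)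
  then have "\<forall>\<^sub>F t in nhds 0. x t = sq (x (t / 2))"
    by eventually_elim (simp add: x_def sq_def cinv_cmap[OF good] flip: one_param_add[OF \<gamma>])
  then obtain \<epsilon>1 and y :: "complex \<Rightarrow> 'e" where y: "\<epsilon>1 > 0" "holo_on y (ball 0 \<epsilon>1)"
      "\<And>t. \<bar>t\<bar> < \<epsilon>1 \<Longrightarrow> y (of_real t) = x t"
    by (rule complexify_squaring_curve[OF S sqS z0S sq0 D x0 xd]) blast
  have y0: "y 0 = z0" using y(3)[of 0] y(1) x0 by simp
  have "isCont y 0" using holo_on_continuous[OF y(2)] y(1) by (simp add: continuous_on_eq_continuous_at)
  then have "(y \<longlongrightarrow> z0) (nhds 0)" using y0 by (metis isCont_def tendsto_at_iff_tendsto_nhds)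
  then have "\<forall>\<^sub>F z in nhds 0. y z \<in> ?I"
    by (rule eventually_compose_filterlim[OF eventually_cimage[OF good z0(2)]])
  then obtain \<epsilon>2 where \<epsilon>2: "\<epsilon>2 > 0" "\<And>z. dist z 0 < \<epsilon>2 \<Longrightarrow> y z \<in> ?I" unfolding eventually_nhds_metric by blast
  obtain \<epsilon>3 where \<epsilon>3: "\<epsilon>3 > 0" "\<And>t. dist t 0 < \<epsilon>3 \<Longrightarrow> \<gamma> t \<in> cdom \<kappa> \<e>" using ev unfolding eventually_nhds_metric by blast
  define \<epsilon> where "\<epsilon> = min \<epsilon>1 (min \<epsilon>2 \<epsilon>3)"
  have \<epsilon>: "\<epsilon> > 0" "\<epsilon> \<le> \<epsilon>1" "\<epsilon> \<le> \<epsilon>2" "\<epsilon> \<le> \<epsilon>3" using y(1) \<epsilon>2 \<epsilon>3 by (auto simp: \<epsilon>_def)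
  show thesis
  proof (rule that[of \<epsilon> "\<lambda>z. cinv \<kappa> \<e> (y z)"])
    show "cinv \<kappa> \<e> (y (of_real t)) = \<gamma> t" if "\<bar>t\<bar> < \<epsilon>" for t
      using y(3)[of t] \<epsilon>3(2)[of t] that \<epsilon> by (simp add: x_def cinv_cmap[OF good])
    fix z :: complex assume z: "z \<in> ball 0 \<epsilon>"
    have "y z \<in> ?I" using \<epsilon>2(2)[of z] z \<epsilon> by simp
    then obtain A where A: "has_mderiv std_charts \<kappa> (cinv \<kappa> \<e>) (y z) A" "\<And>v. A (imult v) = imult (A v)"
      using has_mderiv_cinv[OF atlas] by metis
    have "z \<in> ball 0 \<epsilon>1" using z \<epsilon> by auto
    then have yd: "has_mderiv std_charts std_charts y z (frechet_derivative y (at z))"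
      and yi: "\<And>v. frechet_derivative y (at z) (imult v) = imult (frechet_derivative y (at z) v)"
      using holo_onD[OF y(2)] unfolding has_mderiv_std_iff by blast+
    show "\<exists>T. has_mderiv std_charts \<kappa> (\<lambda>z. cinv \<kappa> \<e> (y z)) z T \<and> (\<forall>v. T (imult v) = imult (T v))"
      by (rule exI, rule conjI, rule has_mderiv_compose[OF good_std_charts good_std_charts yd A(1)])
         (simp add: yi A(2))
  qed (rule \<epsilon>)
qed

subsection \<open>Fields\<close>

abbreviation fm :: "'g ^ 'l::finite \<Rightarrow> 'g ^ 'l \<Rightarrow> 'g ^ 'l" (infixl "\<star>" 70) where
  "V \<star> U \<equiv> field_mult GC V U"

definition finv :: "'g ^ 'l \<Rightarrow> 'g ^ 'l" where "finv V = (\<chi> l. ginv (V $ l))"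

text \<open>\<open>rt U v\<close> is the tangent vector at \<open>U\<close> of the right-invariant vector field generated by \<open>v\<close>.\<close>

definition rt :: "'g ^ 'l \<Rightarrow> 'e ^ 'l \<Rightarrow> 'e ^ 'l::finite" where
  "rt U v = (\<chi> l. dR GC \<kappa> (U $ l) \<e> (v $ l))"

definition fip :: "'e ^ 'l::finite \<Rightarrow> 'e ^ 'l \<Rightarrow> real" where
  "fip u v = (\<Sum>l\<in>UNIV. ip (u $ l) (v $ l))"

definition jpf :: "'e ^ 'l \<Rightarrow> 'e ^ 'l::finite" where "jpf v = (\<chi> l. jp (v $ l))"

abbreviation VC :: "('g ^ 'l::finite, 'e ^ 'l) charts" where "VC \<equiv> vec_charts \<kappa>"

lemma good_VC: "good_charts VC"
  by (rule good_vec_charts[OF good])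

lemma fm_nth [simp]: "(V \<star> U) $ l = V $ l \<cdot> U $ l"
  by (simp add: field_mult_def)

lemma fm_assoc: "V \<star> U \<star> W = V \<star> (U \<star> W)"
  and finv_fm [simp]: "finv V \<star> (V \<star> U) = U"
  and fm_finv [simp]: "V \<star> (finv V \<star> U) = U"
  by (simp_all add: vec_eq_iff gmult_assoc finv_def)

lemma finv_link: "V \<in> link_fields G \<Longrightarrow> finv V \<in> link_fields G"
  and fm_link: "V \<in> link_fields G \<Longrightarrow> W \<in> link_fields G \<Longrightarrow> V \<star> W \<in> link_fields G"
  by (simp_all add: link_fields_def finv_def G_inv G_mult)

lemma continuous_on_nth:
  "continuous_on A f \<Longrightarrow> continuous_on A (\<lambda>x. (f x :: 'a::topological_space ^ 'l::finite) $ l)"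
  using continuous_on_compose2[OF continuous_on_vec_nth] by blast

lemma continuous_on_fm:
  "continuous_on A f \<Longrightarrow> continuous_on A g \<Longrightarrow> continuous_on A (\<lambda>x. f x \<star> g x)"
  unfolding field_mult_def by (intro continuous_on_vec_lambda continuous_on_gmult continuous_on_nth)

lemma continuous_on_finv: "continuous_on A f \<Longrightarrow> continuous_on A (\<lambda>x. finv (f x))"
  unfolding finv_def by (intro continuous_on_vec_lambda continuous_on_ginv continuous_on_nth)

definition flow :: "('l::finite \<Rightarrow> real \<Rightarrow> 'g) \<Rightarrow> real \<Rightarrow> 'g ^ 'l" where "flow \<gamma> t = (\<chi> l. \<gamma> l t)"

text \<open>Values in \<open>G\<close> make left multiplication by the flow preserve \<Omega>, while
  its motion follows the right-invariant field generated by \<open>B\<close>.\<close>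

definition is_flow :: "('l::finite \<Rightarrow> real \<Rightarrow> 'g) \<Rightarrow> 'e ^ 'l \<Rightarrow> bool" where
  "is_flow \<gamma> B \<longleftrightarrow> (\<forall>l. one_param GC \<kappa> (B $ l) (\<gamma> l) \<and> range (\<gamma> l) \<subseteq> G)"

lemma flow_exists: "(\<And>l. B $ l \<in> Lie) \<Longrightarrow> \<exists>\<gamma>. is_flow \<gamma> B"
  unfolding is_flow_def lie_algebra_def mem_Collect_eq by metis

lemma flow_link: "is_flow \<gamma> B \<Longrightarrow> flow \<gamma> t \<in> link_fields G"
  unfolding is_flow_def flow_def link_fields_def by auto

lemma flow_add: "is_flow \<gamma> B \<Longrightarrow> flow \<gamma> (s + t) = flow \<gamma> s \<star> flow \<gamma> t"
  unfolding is_flow_def flow_def by (simp add: vec_eq_iff) (metis one_param_add)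

lemma flow_zero: "is_flow \<gamma> B \<Longrightarrow> flow \<gamma> 0 \<star> U = U"
  unfolding is_flow_def flow_def by (simp add: vec_eq_iff) (metis one_param_zero one_gmult)

lemma flow_minus: "is_flow \<gamma> B \<Longrightarrow> flow \<gamma> (- t) = finv (flow \<gamma> t)"
  unfolding is_flow_def flow_def finv_def by (simp add: vec_eq_iff) (metis one_param_minus)

lemma continuous_flow: "is_flow \<gamma> B \<Longrightarrow> continuous_on UNIV (flow \<gamma>)"
  unfolding is_flow_def flow_def by (intro continuous_on_vec_lambda) (metis one_param_continuous)

lemma flow_has_mderiv:
  assumes "is_flow \<gamma> B"
  shows "has_mderiv std_charts VC (\<lambda>t. flow \<gamma> t \<star> U) 0 (\<lambda>s. s *\<^sub>R rt U B)"
proof (rule has_mderiv_vec)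
  fix l
  have \<gamma>: "one_param GC \<kappa> (B $ l) (\<gamma> l)" using assms by (simp add: is_flow_def)
  from has_mderiv_right_gmult[OF good_std_charts one_param_has_mderiv[OF this], of "U $ l"]
  show "has_mderiv std_charts \<kappa> (\<lambda>t. (flow \<gamma> t \<star> U) $ l) 0 (\<lambda>s. (s *\<^sub>R rt U B) $ l)"
    by (simp add: flow_def rt_def one_param_zero[OF \<gamma>] linear_scale[OF linear_dR])
qed

lemma fip_diff: "\<lbrakk>\<And>l. u $ l \<in> Lie; \<And>l. v $ l \<in> Lie; \<And>l. w $ l \<in> Lie\<rbrakk> \<Longrightarrow> fip (u - v) w = fip u w - fip v w"
  by (simp add: fip_def ip_diff sum_subtractf)

lemma fip_commute: "\<lbrakk>\<And>l. u $ l \<in> Lie; \<And>l. v $ l \<in> Lie\<rbrakk> \<Longrightarrow> fip u v = fip v u"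
  unfolding fip_def by (intro sum.cong refl ip_commute)

lemma fip_nonpos_zero:
  assumes "\<And>l. u $ l \<in> Lie" "fip u u \<le> 0"
  shows "u = 0"
proof -
  have "fip u u \<ge> 0" unfolding fip_def by (intro sum_nonneg ip_nonneg assms(1))
  then have "fip u u = 0" using assms(2) by simp
  then have "ip (u $ l) (u $ l) = 0" for l
    unfolding fip_def using assms(1) ip_nonneg by (subst (asm) sum_nonneg_eq_0_iff) auto
  then have "u $ l = 0" for l using ip_pos[OF assms(1), of l] by force
  then show ?thesis by (simp add: vec_eq_iff)
qed

lemma metric_N_eq:
  "metric_N GC \<kappa> G m U Z1 Z2 =
    (\<Sum>l\<in>UNIV. ip (rp (dR GC \<kappa> (ginv (U $ l)) (U $ l) (Z1 $ l))) (rp (dR GC \<kappa> (ginv (U $ l)) (U $ l) (Z2 $ l)))) +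
    fip (jpf (\<chi> l. dR GC \<kappa> (ginv (U $ l)) (U $ l) (Z1 $ l))) (jpf (\<chi> l. dR GC \<kappa> (ginv (U $ l)) (U $ l) (Z2 $ l)))"
  by (simp add: metric_N_def metric_C_eq sum.distrib fip_def jpf_def)

end

section \<open>The normal direction and the inward condition\<close>

text \<open>The product form of \<Omega> is present as invariance under left multiplication by
  \<open>link_fields G\<close>; boundedness is supplied in \<open>constant_on_component\<close> as a
  compact set containing \<Omega>.\<close>

locale inward_drift = complexified_group GC \<kappa> G m X
  for GC :: "('g::t2_space) monoid"
    and \<kappa> :: "('g, 'e::{euclidean_space,complex_space}) charts"
    and G :: "'g set"
    and m :: "'g \<Rightarrow> 'e \<Rightarrow> 'e \<Rightarrow> real"
    and X :: "'m::finite \<Rightarrow> 'e" +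
  fixes S :: "'g ^ 'l::finite \<Rightarrow> complex"
    and \<Omega> :: "('g ^ 'l) set"
    and n :: "'g ^ 'l \<Rightarrow> 'e ^ 'l"
  assumes S_holo: "holo_map (vec_charts \<kappa>) std_charts S"
    and \<Omega>_invariant: "\<And>V U. V \<in> link_fields G \<Longrightarrow> U \<in> \<Omega> \<Longrightarrow> field_mult GC V U \<in> \<Omega>"
    and normal: "\<And>U. U \<in> frontier \<Omega> \<Longrightarrow>
      outer_unit_normal (vec_charts \<kappa>) (metric_N GC \<kappa> G m) \<Omega> U (n U)"
    and inward: "\<And>U. U \<in> frontier \<Omega> \<Longrightarrow>
      metric_N GC \<kappa> G m U (velocity_field GC \<kappa> X S U) (n U) \<le> 0"
begin

section \<open>Derivatives of the action along curves and flows\<close>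

definition dS :: "'g ^ 'l \<Rightarrow> 'e ^ 'l \<Rightarrow> complex" where "dS U = mdiff VC std_charts S U"

lemma has_mderiv_dS: "has_mderiv VC std_charts S U (dS U)"
  and dS_imult: "dS U (imult v) = \<i> * dS U v"
  unfolding dS_def using holo_map_has_mderiv[OF good_VC good_std_charts S_holo]
  by (simp_all add: imult_complex_def)

lemma linear_dS: "linear (dS U)"
  by (rule bounded_linear.linear[OF has_mderiv_bounded_linear[OF has_mderiv_dS]])

lemma continuous_S: "continuous_on A S"
  using S_holo unfolding holo_map_def using continuous_on_subset by blast

lemma S_curve:
  assumes "has_mderiv std_charts VC c 0 (\<lambda>s. s *\<^sub>R w)"
  shows "((\<lambda>t. S (c t)) has_vector_derivative dS (c 0) w) (at 0)"
  using has_mderiv_compose[OF good_std_charts good_VC assms has_mderiv_dS]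
  by (simp add: has_mderiv_std_iff has_vector_derivative_def linear_scale[OF linear_dS])

lemma Im_S_curve:
  assumes "has_mderiv std_charts VC c 0 (\<lambda>s. s *\<^sub>R w)"
  shows "((\<lambda>t. Im (S (c t))) has_real_derivative Im (dS (c 0) w)) (at 0)"
  unfolding has_real_derivative_iff_has_vector_derivative
  by (rule bounded_linear.has_vector_derivative[OF bounded_linear_Im S_curve[OF assms]])

lemma Re_S_curve:
  assumes "has_mderiv std_charts VC c 0 (\<lambda>s. s *\<^sub>R w)"
  shows "((\<lambda>t. Re (S (c t))) has_real_derivative Re (dS (c 0) w)) (at 0)"
  unfolding has_real_derivative_iff_has_vector_derivative
  by (rule bounded_linear.has_vector_derivative[OF bounded_linear_Re S_curve[OF assms]])

text \<open>The group law moves the base point along the flow, so derivatives at time 0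
  suffice.\<close>

lemma flow_derivative:
  assumes \<gamma>: "is_flow \<gamma> B"
    and f: "((\<lambda>s. f (flow \<gamma> s \<star> (flow \<gamma> t \<star> U))) has_real_derivative y) (at 0)"
  shows "((\<lambda>t. f (flow \<gamma> t \<star> U)) has_real_derivative y) (at t)"
proof -
  have "flow \<gamma> s \<star> (flow \<gamma> t \<star> U) = flow \<gamma> (s + t) \<star> U" for s
    by (simp add: flow_add[OF \<gamma>] fm_assoc)
  then have "((\<lambda>s. f (flow \<gamma> (s + t) \<star> U)) has_real_derivative y) (at 0)" using f by simp
  then have "((\<lambda>t. f (flow \<gamma> t \<star> U)) has_real_derivative y) (at (0 + t))"
    by (simp only: DERIV_shift)
  then show ?thesis by simp
qed

lemma Im_flow_derivative:
  assumes \<gamma>: "is_flow \<gamma> B"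
  shows "((\<lambda>t. Im (S (flow \<gamma> t \<star> U))) has_real_derivative
    Im (dS (flow \<gamma> t \<star> U) (rt (flow \<gamma> t \<star> U) B))) (at t)"
  using flow_derivative[OF \<gamma>, of "\<lambda>U. Im (S U)"] Im_S_curve[OF flow_has_mderiv[OF \<gamma>, of "flow \<gamma> t \<star> U"]]
  by (simp add: flow_zero[OF \<gamma>])

lemma Re_flow_derivative:
  assumes \<gamma>: "is_flow \<gamma> B"
  shows "((\<lambda>t. Re (S (flow \<gamma> t \<star> U))) has_real_derivative
    Re (dS (flow \<gamma> t \<star> U) (rt (flow \<gamma> t \<star> U) B))) (at t)"
  using flow_derivative[OF \<gamma>, of "\<lambda>U. Re (S U)"] Re_S_curve[OF flow_has_mderiv[OF \<gamma>, of "flow \<gamma> t \<star> U"]]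
  by (simp add: flow_zero[OF \<gamma>])

lemma linear_rt: "linear (rt U)"
  by (rule linearI) (simp_all add: rt_def vec_eq_iff linear_add[OF linear_dR] linear_scale[OF linear_dR])

lemma rt_imult: "rt U (imult v) = imult (rt U v)"
  by (simp add: rt_def imult_vec_def dR_imult vec_eq_iff)

lemma drift_J_eq: "drift_J GC \<kappa> S l Y U = - Im (dS U (axis l (dR GC \<kappa> (U $ l) \<e> Y)))"
proof -
  have "has_mderiv std_charts std_charts Im (S U) Im"
    unfolding has_mderiv_std_iff by (rule bounded_linear_imp_has_derivative[OF bounded_linear_Im])
  from has_mderiv_compose[OF good_VC good_std_charts has_mderiv_dS this]
  have "mdiff VC std_charts (\<lambda>U. Im (S U)) U = (\<lambda>v. Im (dS U v))" by (rule has_mderiv_mdiff)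
  then show ?thesis by (simp add: drift_J_def lie_deriv_def)
qed

text \<open>The left-hand side is what remains of the product of velocity field and normal once the
  normal is purely imaginary; expanding \<open>B\<close> in the orthonormal basis turns it into a
  single derivative of \<open>Im S\<close>.\<close>

lemma sum_drift_J:
  assumes B: "\<And>l. B $ l \<in> Lie"
  shows "(\<Sum>l\<in>UNIV. \<Sum>a\<in>UNIV. drift_J GC \<kappa> S l (X a) U * ip (X a) (B $ l)) = - Im (dS U (rt U B))"
proof -
  have rt: "rt U B = (\<Sum>l\<in>UNIV. axis l (dR GC \<kappa> (U $ l) \<e> (B $ l)))"
    by (simp add: vec_eq_iff rt_def sum_component axis_def if_distrib cong: if_cong)
  have ax: "linear (\<lambda>v. axis l v :: 'e ^ 'l)" for l
    by (rule linearI) (simp_all add: axis_def vec_eq_iff)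
  have lin: "linear (\<lambda>Y. Im (dS U (axis l (dR GC \<kappa> (U $ l) \<e> Y))))" for l
    using linear_compose[OF linear_compose[OF linear_compose[OF linear_dR ax] linear_dS]
        bounded_linear.linear[OF bounded_linear_Im]] by (simp add: o_def)
  have "Im (dS U (axis l (dR GC \<kappa> (U $ l) \<e> (B $ l)))) =
      (\<Sum>a\<in>UNIV. ip (X a) (B $ l) * Im (dS U (axis l (dR GC \<kappa> (U $ l) \<e> (X a)))))" for l
    by (subst basis_expand[OF B]) (simp add: linear_sum[OF lin] linear_scale[OF lin])
  then have "Im (dS U (rt U B)) =
      (\<Sum>l\<in>UNIV. \<Sum>a\<in>UNIV. ip (X a) (B $ l) * Im (dS U (axis l (dR GC \<kappa> (U $ l) \<e> (X a)))))"
    by (simp add: rt linear_sum[OF linear_dS])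
  then show ?thesis by (simp add: drift_J_eq sum_negf mult.commute)
qed

text \<open>Translation back to the identity cancels the one in the velocity field and leaves
  \<open>drift_K\<close> and \<open>drift_J\<close> as coefficients of the real and the imaginary
  part.\<close>

lemma velocity_pullback:
  "dR GC \<kappa> (ginv (U $ l)) (U $ l) (velocity_field GC \<kappa> X S U $ l) =
    (\<Sum>a\<in>UNIV. drift_K GC \<kappa> S l (X a) U *\<^sub>R X a) + imult (\<Sum>a\<in>UNIV. drift_J GC \<kappa> S l (X a) U *\<^sub>R X a)"
  by (simp add: velocity_field_def linear_sum[OF linear_dR] dR_inverse sum.distrib imult_sum imult_scaleR)

text \<open>\<open>i B\<close>, translated to \<open>U\<close>, is the unit normal of \<open>\<Omega>\<close> at \<open>U\<close>. It is characterised without a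
  defining function, so that it can be transported by translations from the left.\<close>

definition normal_dir :: "'g ^ 'l \<Rightarrow> 'e ^ 'l \<Rightarrow> bool" where
  "normal_dir U B \<longleftrightarrow> (\<forall>l. B $ l \<in> Lie) \<and> fip B B = 1 \<and>
     (\<forall>v c. c 0 = U \<longrightarrow> has_mderiv std_charts VC c 0 (\<lambda>s. s *\<^sub>R rt U v) \<longrightarrow>
        (fip B (jpf v) < 0 \<longrightarrow> (\<forall>\<^sub>F t in at_right 0. c t \<in> interior \<Omega>)) \<and>
        (fip B (jpf v) > 0 \<longrightarrow> (\<forall>\<^sub>F t in at_right 0. c t \<notin> \<Omega>)))"

lemma interior_invariant:
  assumes V: "V \<in> link_fields G" and U: "U \<in> interior \<Omega>"
  shows "V \<star> U \<in> interior \<Omega>"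
proof (rule interiorI)
  have "continuous_on UNIV (\<lambda>U. finv V \<star> U)" by (intro continuous_on_fm continuous_on_const continuous_on_id)
  then show "open ((\<lambda>U. finv V \<star> U) -` interior \<Omega>)" using open_vimage[OF open_interior] by blast
  show "V \<star> U \<in> (\<lambda>U. finv V \<star> U) -` interior \<Omega>" using U by simp
  show "(\<lambda>U. finv V \<star> U) -` interior \<Omega> \<subseteq> \<Omega>"
  proof
    fix W assume "W \<in> (\<lambda>U. finv V \<star> U) -` interior \<Omega>"
    then have "finv V \<star> W \<in> \<Omega>" using interior_subset by blast
    then have "V \<star> (finv V \<star> W) \<in> \<Omega>" by (rule \<Omega>_invariant[OF V])
    then show "W \<in> \<Omega>" by simp
  qed
qed

lemma closure_invariant:
  assumes V: "V \<in> link_fields G" and U: "U \<in> closure \<Omega>"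
  shows "V \<star> U \<in> closure \<Omega>"
proof -
  have "continuous_on (closure \<Omega>) (\<lambda>U. V \<star> U)" by (intro continuous_on_fm continuous_on_const continuous_on_id)
  moreover have "(\<lambda>U. V \<star> U) ` \<Omega> \<subseteq> closure \<Omega>" using \<Omega>_invariant[OF V] closure_subset by blast
  ultimately have "(\<lambda>U. V \<star> U) ` closure \<Omega> \<subseteq> closure \<Omega>" by (intro image_closure_subset) auto
  then show ?thesis using U by blast
qed

lemma frontier_invariant:
  assumes V: "V \<in> link_fields G" and U: "U \<in> frontier \<Omega>"
  shows "V \<star> U \<in> frontier \<Omega>"
proof -
  have "V \<star> U \<notin> interior \<Omega>"
    using interior_invariant[OF finv_link[OF V], of "V \<star> U"] U by (auto simp: frontier_def)
  then show ?thesis using closure_invariant[OF V, of U] U by (simp add: frontier_def)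
qed

lemma normal_dir_exists:
  assumes U: "U \<in> frontier \<Omega>"
  shows "\<exists>B. normal_dir U B \<and> 0 \<le> Im (dS U (rt U B))"
proof -
  define N where "N = (\<chi> l. dR GC \<kappa> (ginv (U $ l)) (U $ l) (n U $ l))"
  define A where "A = (\<chi> l. rp (N $ l))"
  define B where "B = jpf N"
  have A: "A $ l \<in> Lie" and B: "B $ l \<in> Lie" for l by (simp_all add: A_def B_def jpf_def rp_Lie jp_Lie)
  note out = normal[OF U, unfolded outer_unit_normal_def]
  have unit: "metric_N GC \<kappa> G m U (n U) (n U) = 1" by (rule conjunct1[OF out])
  obtain Q \<rho> D where QD: "open Q \<and> U \<in> Q \<and> Q \<subseteq> cdom VC U \<and>
      (\<forall>z\<in>cmap VC U ` Q. ((\<rho> \<circ> cinv VC U) has_derivative (\<lambda>v. D z \<bullet> v)) (at z)) \<and>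
      continuous_on (cmap VC U ` Q) D \<and> \<rho> U = (0::real) \<and> \<Omega> \<inter> Q = {q\<in>Q. \<rho> q < 0} \<and>
      (\<exists>c>0. \<forall>v. D (cmap VC U U) \<bullet> v = c * metric_N GC \<kappa> G m U (n U) v)"
    using conjunct2[OF out] by (elim exE)
  have Q: "open Q" "U \<in> Q" "Q \<subseteq> cdom VC U" using QD by - (elim conjE, assumption)+
  have "\<forall>z\<in>cmap VC U ` Q. ((\<rho> \<circ> cinv VC U) has_derivative (\<lambda>v. D z \<bullet> v)) (at z)"
    using QD by (elim conjE)
  then have \<rho>d: "((\<rho> \<circ> cinv VC U) has_derivative (\<lambda>v. D z \<bullet> v)) (at z)" if "z \<in> cmap VC U ` Q" for z
    using that by (rule bspec)
  have \<rho>0: "\<rho> U = 0" and \<Omega>Q: "\<Omega> \<inter> Q = {q\<in>Q. \<rho> q < 0}" using QD by - (elim conjE, assumption)+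
  have "\<exists>c>0. \<forall>v. D (cmap VC U U) \<bullet> v = c * metric_N GC \<kappa> G m U (n U) v" using QD by (elim conjE)
  then obtain c where c: "c > 0" "\<And>v. D (cmap VC U U) \<bullet> v = c * metric_N GC \<kappa> G m U (n U) v" by blast
  have metr: "metric_N GC \<kappa> G m U (n U) (rt U v) = (\<Sum>l\<in>UNIV. ip (A $ l) (rp (v $ l))) + fip B (jpf v)" for v
    by (simp add: metric_N_eq rt_def dR_inverse A_def B_def N_def jpf_def fip_def)
  have cQ: "cinv VC U (cmap VC U q) = q" if "q \<in> Q" for q
    using cinv_cmap[OF good_VC, of q U] Q(3) that by blast
  have \<rho>c: "continuous_on Q \<rho>"
  proof -
    have "continuous_on (cmap VC U ` Q) (\<rho> \<circ> cinv VC U)"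
      by (intro continuous_at_imp_continuous_on ballI has_derivative_continuous[OF \<rho>d])
    then have "continuous_on Q (\<lambda>q. (\<rho> \<circ> cinv VC U) (cmap VC U q))"
      using continuous_on_subset[OF continuous_on_cmap[OF good_VC] Q(3)] by (rule continuous_on_compose2) auto
    then show ?thesis
      by (rule continuous_on_eq) (simp add: cQ)
  qed
  \<comment> \<open>Inside \<open>Q\<close> a nonzero sign of \<rho> decides between interior and
    exterior, so boundary points in \<open>Q\<close> satisfy \<rho> = 0.\<close>
  have neg: "q \<in> interior \<Omega>" if "q \<in> Q" "\<rho> q < 0" for q
  proof (rule interiorI)
    show "open (Q \<inter> \<rho> -` {..<0})" by (rule continuous_open_preimage[OF \<rho>c Q(1)]) simp
    show "q \<in> Q \<inter> \<rho> -` {..<0}" using that by simp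
    show "Q \<inter> \<rho> -` {..<0} \<subseteq> \<Omega>" using \<Omega>Q by blast
  qed
  have pos: "q \<notin> closure \<Omega>" if "q \<in> Q" "\<rho> q > 0" for q
  proof -
    have "open (Q \<inter> \<rho> -` {0<..})" by (rule continuous_open_preimage[OF \<rho>c Q(1)]) simp
    moreover have "(Q \<inter> \<rho> -` {0<..}) \<inter> \<Omega> = {}" using \<Omega>Q by force
    ultimately have "(Q \<inter> \<rho> -` {0<..}) \<inter> closure \<Omega> = {}" by (simp add: open_Int_closure_eq_empty)
    then show ?thesis using that by blast
  qed
  have der: "((\<lambda>s. \<rho> (c' s)) has_real_derivative
        c * ((\<Sum>l\<in>UNIV. ip (A $ l) (rp (v $ l))) + fip B (jpf v))) (at 0)"
      and near: "\<forall>\<^sub>F s in nhds 0. c' s \<in> Q"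
    if c': "c' 0 = U" "has_mderiv std_charts VC c' 0 (\<lambda>s. s *\<^sub>R rt U v)" for c' v
  proof -
    have lim: "(c' \<longlongrightarrow> U) (nhds 0)" using has_mderivD(1)[OF c'(2)] c'(1) by simp
    then show near: "\<forall>\<^sub>F s in nhds 0. c' s \<in> Q" using Q(1,2) by (rule topological_tendstoD)
    have "((\<lambda>s. cmap VC U (c' s)) has_derivative (\<lambda>s. s *\<^sub>R rt U v)) (at 0)"
      using has_mderivD(2)[OF c'(2)] by (simp add: c'(1) o_def)
    moreover have "((\<rho> \<circ> cinv VC U) has_derivative (\<lambda>v. D (cmap VC U U) \<bullet> v)) (at (cmap VC U (c' 0)))"
      using \<rho>d[of "cmap VC U U"] Q(2) c'(1) by simp
    ultimately have "((\<lambda>s. (\<rho> \<circ> cinv VC U) (cmap VC U (c' s))) has_derivative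
        (\<lambda>s. D (cmap VC U U) \<bullet> (s *\<^sub>R rt U v))) (at 0)"
      by (rule has_derivative_compose)
    moreover have "\<forall>\<^sub>F s in nhds 0. (\<rho> \<circ> cinv VC U) (cmap VC U (c' s)) = \<rho> (c' s)"
      using near by eventually_elim (simp add: cQ)
    ultimately have "((\<lambda>s. \<rho> (c' s)) has_derivative (\<lambda>s. D (cmap VC U U) \<bullet> (s *\<^sub>R rt U v))) (at 0)"
      by (rule has_derivative_eventually_eq)
    then show "((\<lambda>s. \<rho> (c' s)) has_real_derivative
        c * ((\<Sum>l\<in>UNIV. ip (A $ l) (rp (v $ l))) + fip B (jpf v))) (at 0)"
      by (simp add: has_field_derivative_def c(2) metr mult.commute[of _ "c * _"] flip: metr)
  qed
  \<comment> \<open>The flow of the real part \<open>A\<close> stays in the frontier, so \<rho>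
    vanishes along it near \<open>U\<close>; but the derivative of \<rho> along it is
    \<open>c * fip A A\<close>, since \<open>A\<close> has no imaginary part.\<close>
  have "fip A A = 0"
  proof -
    obtain \<gamma> where \<gamma>: "is_flow \<gamma> A" using flow_exists[of A] A by blast
    let ?c = "\<lambda>t. flow \<gamma> t \<star> U"
    have c0: "?c 0 = U" by (rule flow_zero[OF \<gamma>])
    have "\<forall>\<^sub>F s in nhds 0. \<rho> (?c s) = 0"
      using near[OF c0 flow_has_mderiv[OF \<gamma>]]
    proof eventually_elim
      case (elim s)
      have "?c s \<in> frontier \<Omega>" by (rule frontier_invariant[OF flow_link[OF \<gamma>] U])
      then have "?c s \<in> closure \<Omega>" "?c s \<notin> interior \<Omega>" by (auto simp: frontier_def)
      then show ?case using neg[OF elim] pos[OF elim] by force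
    qed
    then have "((\<lambda>s. \<rho> (?c s)) has_real_derivative 0) (at 0)"
      using DERIV_cong_ev[OF refl _ refl, of "\<lambda>s. \<rho> (?c s)" "\<lambda>_. 0" 0 0] DERIV_const by blast
    from DERIV_unique[OF der[OF c0 flow_has_mderiv[OF \<gamma>]] this]
    have *: "(\<Sum>l\<in>UNIV. ip (A $ l) (rp (A $ l))) + fip B (jpf A) = 0" using c(1) by simp
    have rj: "rp (A $ l) = A $ l" "jp (A $ l) = 0" for l
      using rp_eq[OF A, of 0 l] jp_eq[OF A, of 0 l] subspace_0[OF subspace_Lie] by simp_all
    have "fip B (jpf A) = 0" using ip_zero_right[OF B] by (simp add: fip_def jpf_def rj)
    then show ?thesis using * by (simp add: rj fip_def)
  qed
  then have A0: "A = 0" using A fip_nonpos_zero[of A] by simp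
  then have rpN: "rp (N $ l) = 0" for l by (simp add: A_def vec_eq_iff)
  have B1: "fip B B = 1"
    using unit ip_zero_left[OF subspace_0[OF subspace_Lie]] rpN
    by (simp add: metric_N_eq B_def N_def)
  have Asum: "(\<Sum>l\<in>UNIV. ip (A $ l) (rp (v $ l))) = 0" for v :: "'e ^ 'l"
    by (simp add: A0 ip_zero_left[OF rp_Lie])
  have "normal_dir U B"
    unfolding normal_dir_def
  proof (intro conjI allI impI)
    fix v and c' :: "real \<Rightarrow> 'g ^ 'l"
    assume c': "c' 0 = U" "has_mderiv std_charts VC c' 0 (\<lambda>s. s *\<^sub>R rt U v)"
    have d: "((\<lambda>s. \<rho> (c' s)) has_real_derivative c * fip B (jpf v)) (at 0)"
      using der[OF c'] by (simp add: Asum)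
    have nearr: "\<forall>\<^sub>F s in at_right 0. c' s \<in> Q"
      using near[OF c'] by (rule filter_leD[OF at_within_le_nhds])
    show "\<forall>\<^sub>F t in at_right 0. c' t \<in> interior \<Omega>" if "fip B (jpf v) < 0"
    proof -
      have "c * fip B (jpf v) < 0" using c(1) that by (simp add: mult_pos_neg)
      from DERIV_neg_dec_right[OF d this] obtain d where "d > 0" "\<And>h. 0 < h \<Longrightarrow> h < d \<Longrightarrow> \<rho> (c' (0 + h)) < \<rho> (c' 0)" by blast
      then have "\<forall>\<^sub>F h in at_right 0. \<rho> (c' h) < 0"
        unfolding eventually_at_right_field by (intro exI[of _ d]) (simp add: c'(1) \<rho>0)
      with nearr show ?thesis by eventually_elim (rule neg)
    qed
    show "\<forall>\<^sub>F t in at_right 0. c' t \<notin> \<Omega>" if "fip B (jpf v) > 0"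
    proof -
      have "c * fip B (jpf v) > 0" using c(1) that by simp
      from DERIV_pos_inc_right[OF d this] obtain d where "d > 0" "\<And>h. 0 < h \<Longrightarrow> h < d \<Longrightarrow> \<rho> (c' 0) < \<rho> (c' (0 + h))" by blast
      then have "\<forall>\<^sub>F h in at_right 0. \<rho> (c' h) > 0"
        unfolding eventually_at_right_field by (intro exI[of _ d]) (simp add: c'(1) \<rho>0)
      with nearr show ?thesis by eventually_elim (use \<Omega>Q in force)
    qed
  qed (use B B1 in auto)
  moreover have "0 \<le> Im (dS U (rt U B))"
  proof -
    let ?J = "\<lambda>l. \<Sum>a\<in>UNIV. drift_J GC \<kappa> S l (X a) U *\<^sub>R X a"
    have Lsum: "(\<Sum>a\<in>UNIV. f a *\<^sub>R X a) \<in> Lie" for f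
      by (intro subspace_sum subspace_Lie subspace_scale basis_in_Lie)
    \<comment> \<open>Since \<open>rp\<close> of the translated normal is 0, the coefficients
      \<open>drift_K\<close> drop out and only the pairing of \<open>drift_J\<close> with
      \<open>B\<close> remains.\<close>
    have "metric_N GC \<kappa> G m U (velocity_field GC \<kappa> X S U) (n U) = (\<Sum>l\<in>UNIV. ip (?J l) (B $ l))"
      using rpN
      by (simp add: metric_N_eq velocity_pullback rp_eq jp_eq Lsum N_def fip_def jpf_def B_def ip_zero_right)
    also have "\<dots> = (\<Sum>l\<in>UNIV. \<Sum>a\<in>UNIV. drift_J GC \<kappa> S l (X a) U * ip (X a) (B $ l))"
      by (intro sum.cong refl)
         (subst ip_sum, auto intro: subspace_scale[OF subspace_Lie] simp: basis_in_Lie B ip_scale)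
    also have "\<dots> = - Im (dS U (rt U B))" by (rule sum_drift_J[OF B])
    finally show ?thesis using inward[OF U] by simp
  qed
  ultimately show ?thesis by blast
qed

text \<open>A curve through \<open>V \<star> U\<close> is pulled back to \<open>U\<close>. In each
  link its velocity is conjugated by the inverse of \<open>V\<close>, an isometry fixing
  \<open>B\<close>, so the pairing with \<open>B\<close> does not change.\<close>

lemma normal_dir_transport:
  assumes nd: "normal_dir U B" and V: "V \<in> link_fields G"
    and inv: "\<And>l. Ad (ginv (V $ l)) (B $ l) = B $ l"
  shows "normal_dir (V \<star> U) B"
  unfolding normal_dir_def
proof (intro conjI allI impI)
  fix v and c :: "real \<Rightarrow> 'g ^ 'l"
  assume c: "c 0 = V \<star> U" "has_mderiv std_charts VC c 0 (\<lambda>s. s *\<^sub>R rt (V \<star> U) v)"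
  define w where "w = (\<chi> l. Ad (ginv (V $ l)) (v $ l))"
  let ?c = "\<lambda>s. finv V \<star> c s"
  have c0: "?c 0 = U" by (simp add: c(1))
  have BL: "B $ l \<in> Lie" for l using nd by (simp add: normal_dir_def)
  have cd: "has_mderiv std_charts VC ?c 0 (\<lambda>s. s *\<^sub>R rt U w)"
  proof (rule has_mderiv_vec)
    fix l
    have "dL GC \<kappa> (ginv (V $ l)) (V $ l \<cdot> U $ l) (dR GC \<kappa> (V $ l \<cdot> U $ l) \<e> (v $ l)) =
        dR GC \<kappa> (U $ l) \<e> (Ad (ginv (V $ l)) (v $ l))"
      using dL_dR[of "ginv (V $ l)" "V $ l \<cdot> U $ l" "v $ l"] by simp
    then show "has_mderiv std_charts \<kappa> (\<lambda>s. (finv V \<star> c s) $ l) 0 (\<lambda>s. (s *\<^sub>R rt U w) $ l)"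
      using has_mderiv_left_gmult[OF good_std_charts has_mderiv_vec_nth[OF c(2), of l], of "ginv (V $ l)"]
      by (simp add: finv_def c(1) rt_def w_def linear_scale[OF linear_dL])
  qed
  have "fip B (jpf w) = fip B (jpf v)"
  proof -
    have gi: "ginv (V $ l) \<in> G" for l using V G_inv by (simp add: link_fields_def)
    have "ip (B $ l) (jp (w $ l)) = ip (B $ l) (jp (v $ l))" for l
    proof -
      have "ip (B $ l) (jp (w $ l)) = ip (Ad (ginv (V $ l)) (B $ l)) (Ad (ginv (V $ l)) (jp (v $ l)))"
        by (simp add: w_def jp_Ad[OF gi] inv)
      then show ?thesis by (simp only: Ad_ip[OF gi BL jp_Lie])
    qed
    then show ?thesis by (simp add: fip_def jpf_def)
  qed
  then have *: "fip B (jpf v) < 0 \<Longrightarrow> \<forall>\<^sub>F t in at_right 0. ?c t \<in> interior \<Omega>"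
    "fip B (jpf v) > 0 \<Longrightarrow> \<forall>\<^sub>F t in at_right 0. ?c t \<notin> \<Omega>"
    using nd c0 cd unfolding normal_dir_def by metis+
  show "\<forall>\<^sub>F t in at_right 0. c t \<in> interior \<Omega>" if "fip B (jpf v) < 0"
    using *(1)[OF that]
  proof eventually_elim
    case (elim t)
    from interior_invariant[OF V elim] show ?case by simp
  qed
  show "\<forall>\<^sub>F t in at_right 0. c t \<notin> \<Omega>" if "fip B (jpf v) > 0"
    using *(2)[OF that]
    by eventually_elim (use \<Omega>_invariant[OF finv_link[OF V]] in blast)
qed (use nd in \<open>auto simp: normal_dir_def\<close>)

text \<open>For distinct unit vectors \<open>fip B B'\<close> is below 1, and then the direction
  i(B' - B) would lead into the interior according to \<open>B\<close> and out of \<Omega> according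
  to \<open>B'\<close>.\<close>

lemma normal_dir_unique:
  assumes B: "normal_dir U B" and B': "normal_dir U B'"
  shows "B = B'"
proof -
  have L: "B $ l \<in> Lie" "B' $ l \<in> Lie" "(B' - B) $ l \<in> Lie" for l
    using B B' subspace_diff[OF subspace_Lie] by (auto simp: normal_dir_def)
  have one: "fip B B = 1" "fip B' B' = 1" using B B' by (auto simp: normal_dir_def)
  have comm: "fip B' B = fip B B'" "fip B (B' - B) = fip (B' - B) B" "fip B' (B' - B) = fip (B' - B) B'"
    using L by (auto intro: fip_commute)
  have "1 \<le> fip B B'"
  proof (rule ccontr)
    assume "\<not> 1 \<le> fip B B'"
    then have lt: "fip B (B' - B) < 0" "fip B' (B' - B) > 0" using L one comm by (simp_all add: fip_diff)
    define v where "v = imult (B' - B)"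
    have "jp (0 + imult ((B' - B) $ l)) = (B' - B) $ l" for l
      by (rule jp_eq[OF subspace_0[OF subspace_Lie] L(3)])
    then have jv: "jpf v = B' - B" by (simp add: jpf_def v_def imult_vec_def vec_eq_iff)
    obtain c where c: "c 0 = U" "has_mderiv std_charts VC c 0 (\<lambda>s. s *\<^sub>R rt U v)"
      by (rule chart_line_has_mderiv[OF good_VC])
    have "\<forall>\<^sub>F t in at_right 0. c t \<in> interior \<Omega>" using B c lt(1) unfolding normal_dir_def jv[symmetric] by blast
    moreover have "\<forall>\<^sub>F t in at_right 0. c t \<notin> \<Omega>" using B' c lt(2) unfolding normal_dir_def jv[symmetric] by blast
    ultimately have "\<forall>\<^sub>F t in at_right (0::real). False"
      by eventually_elim (use interior_subset in blast)
    then show False by (simp add: eventually_False)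
  qed
  then have "fip (B' - B) (B' - B) \<le> 0"
    using L one comm by (simp add: fip_diff)
  then have "B' - B = 0" by (rule fip_nonpos_zero[OF L(3)])
  then show ?thesis by simp
qed

text \<open>\<open>normal_dir_exists\<close> gives the sign of the derivative for some normal at the
  moved point; uniqueness identifies that normal with the transported \<open>B\<close>.\<close>

lemma flow_normal:
  assumes U: "U \<in> frontier \<Omega>" and B: "normal_dir U B" and \<gamma>: "is_flow \<gamma> B"
  shows "flow \<gamma> t \<star> U \<in> frontier \<Omega>" "normal_dir (flow \<gamma> t \<star> U) B"
    "0 \<le> Im (dS (flow \<gamma> t \<star> U) (rt (flow \<gamma> t \<star> U) B))"
proof -
  show fr: "flow \<gamma> t \<star> U \<in> frontier \<Omega>" by (rule frontier_invariant[OF flow_link[OF \<gamma>] U])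
  show nd: "normal_dir (flow \<gamma> t \<star> U) B"
  proof (rule normal_dir_transport[OF B flow_link[OF \<gamma>]])
    fix l
    have op: "one_param GC \<kappa> (B $ l) (\<gamma> l)" using \<gamma> by (simp add: is_flow_def)
    show "Ad (ginv (flow \<gamma> t $ l)) (B $ l) = B $ l"
      using Ad_fix[OF op, of "- t"] one_param_minus[OF op, of t] by (simp add: flow_def)
  qed
  show "0 \<le> Im (dS (flow \<gamma> t \<star> U) (rt (flow \<gamma> t \<star> U) B))"
    using normal_dir_exists[OF fr] normal_dir_unique[OF nd] by blast
qed

lemma compact_link_G: "compact (link_fields G :: ('g ^ 'l) set)"
  unfolding link_fields_def by (rule compact_vec[OF compact_G])

text \<open>Recurrence is applied in the compact group \<open>link_fields G\<close>, with \<Phi>(V,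
  W) = f(V W^-1 U): on the flow this depends only on the difference of the times.\<close>

lemma flow_recurrent:
  fixes \<gamma> :: "'l \<Rightarrow> real \<Rightarrow> 'g"
  assumes \<gamma>: "is_flow \<gamma> B" and f: "continuous_on UNIV f"
    and mono: "\<And>s t. 0 \<le> s \<Longrightarrow> s \<le> t \<Longrightarrow> f (flow \<gamma> s \<star> U) \<le> (f (flow \<gamma> t \<star> U) :: real)"
    and T: "0 \<le> T"
  shows "f (flow \<gamma> T \<star> U) = f U"
proof -
  have "f (flow \<gamma> T \<star> U) = f (flow \<gamma> 0 \<star> U)"
  proof (rule recurrent_mono_const[where \<gamma>="flow \<gamma>" and K="link_fields G" and
        \<Phi>="\<lambda>z. f (fst z \<star> (finv (snd z) \<star> U))" and g="\<lambda>t. f (flow \<gamma> t \<star> U)"])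
    show "continuous_on UNIV (\<lambda>z. f (fst z \<star> (finv (snd z) \<star> U)))"
      by (intro continuous_on_compose2[OF f] continuous_on_fm continuous_on_finv continuous_on_const
          continuous_on_fst continuous_on_snd continuous_on_id) auto
    show "f (fst (flow \<gamma> s, flow \<gamma> t) \<star> (finv (snd (flow \<gamma> s, flow \<gamma> t)) \<star> U)) = f (flow \<gamma> (s - t) \<star> U)" for s t
      using flow_add[OF \<gamma>, of s "- t"] by (simp add: flow_minus[OF \<gamma>] fm_assoc)
  qed (use mono T in \<open>auto simp: flow_link[OF \<gamma>] flow_zero[OF \<gamma>] compact_link_G\<close>)
  then show ?thesis by (simp add: flow_zero[OF \<gamma>])
qed

end

section \<open>The maximum of the imaginary part on a component\<close>

context inward_drift
begin

lemma boundary_maximum_moves_inside: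
  assumes C: "C \<in> components UNIV" and U: "U \<in> frontier \<Omega>" "U \<in> C"
    and max: "\<And>W. W \<in> closure \<Omega> \<Longrightarrow> W \<in> C \<Longrightarrow> Im (S W) \<le> Im (S U)"
  shows "\<exists>p\<in>interior \<Omega> \<inter> C. S p = S U"
proof -
  obtain B where B: "normal_dir U B" using normal_dir_exists[OF U(1)] by blast
  have BL: "B $ l \<in> Lie" for l using B by (simp add: normal_dir_def)
  obtain \<gamma> where \<gamma>: "is_flow \<gamma> B" using flow_exists[of B] BL by blast
  have op: "one_param GC \<kappa> (B $ l) (\<gamma> l)" for l using \<gamma> by (simp add: is_flow_def)
  have "\<forall>l. \<exists>\<epsilon> (E :: complex \<Rightarrow> 'g). \<epsilon> > 0 \<and> (\<forall>t. \<bar>t\<bar> < \<epsilon> \<longrightarrow> E (of_real t) = \<gamma> l t) \<and>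
      (\<forall>z\<in>ball 0 \<epsilon>. \<exists>T. has_mderiv std_charts \<kappa> E z T \<and> (\<forall>v. T (imult v) = imult (T v)))"
    by (rule allI, rule one_param_complexify[OF op]) blast
  then obtain \<epsilon>' and E :: "'l \<Rightarrow> complex \<Rightarrow> 'g" where E0: "\<And>l. \<epsilon>' l > 0 \<and>
      (\<forall>t. \<bar>t\<bar> < \<epsilon>' l \<longrightarrow> E l (of_real t) = \<gamma> l t) \<and>
      (\<forall>z\<in>ball 0 (\<epsilon>' l). \<exists>T. has_mderiv std_charts \<kappa> (E l) z T \<and> (\<forall>v. T (imult v) = imult (T v)))"
    by metis
  define \<epsilon> where "\<epsilon> = Min (range \<epsilon>')"
  have le: "\<epsilon> \<le> \<epsilon>' l" for l by (simp add: \<epsilon>_def)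
  have \<epsilon>: "\<epsilon> > 0" unfolding \<epsilon>_def using E0 by (subst Min_gr_iff) auto
  have Er: "E l (of_real t) = \<gamma> l t" if "\<bar>t\<bar> < \<epsilon>" for l t
    using E0[of l] le[of l] that by (meson less_le_trans)
  have Ed: "\<exists>T. has_mderiv std_charts \<kappa> (E l) z T \<and> (\<forall>v. T (imult v) = imult (T v))" if "z \<in> ball 0 \<epsilon>" for l z
    using E0[of l] le[of l] that by (meson subset_ball subsetD)
  have E_0: "E l 0 = \<e>" for l using Er[of 0 l] \<epsilon> one_param_zero[OF op] by simp
  \<comment> \<open>Along the real axis \<open>E l\<close> is the curve \<open>\<gamma> l\<close>
    with velocity \<open>B $ l\<close>, and a complex linear map on the plane is determined by its
    value at 1.\<close>
  have Ed0: "has_mderiv std_charts \<kappa> (E l) 0 (\<lambda>z. cscale z (B $ l))" for l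
  proof -
    obtain T where T: "has_mderiv std_charts \<kappa> (E l) 0 T" "\<And>v. T (imult v) = imult (T v)"
      using Ed[of 0 l] \<epsilon> by auto
    have "has_mderiv std_charts std_charts (complex_of_real) 0 complex_of_real"
      unfolding has_mderiv_std_iff by (rule bounded_linear_imp_has_derivative[OF bounded_linear_of_real])
    moreover have "has_mderiv std_charts \<kappa> (E l) (of_real 0) T" using T(1) by simp
    ultimately have "has_mderiv std_charts \<kappa> (\<lambda>s. E l (of_real s)) 0 (\<lambda>s. T (of_real s))"
      by (rule has_mderiv_compose[OF good_std_charts good_std_charts])
    moreover have "\<forall>\<^sub>F s in nhds 0. E l (of_real s) = \<gamma> l s"
      unfolding eventually_nhds_metric using Er \<epsilon> by (intro exI[of _ \<epsilon>]) simp
    ultimately have "has_mderiv std_charts \<kappa> (\<gamma> l) 0 (\<lambda>s. T (of_real s))"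
      by (rule has_mderiv_eventually_eq[OF good_std_charts])
    then have "(\<lambda>s. T (of_real s)) = (\<lambda>s. s *\<^sub>R (B $ l))"
      using one_param_has_mderiv[OF op] by (rule has_mderiv_unique)
    from fun_cong[OF this, of 1] have "T 1 = B $ l" by simp
    then have "T z = cscale z (B $ l)" for z
      using complex_linear_eq[OF has_mderiv_bounded_linear[OF T(1)] T(2)] by metis
    then have "T = (\<lambda>z. cscale z (B $ l))" by (rule ext)
    then show ?thesis using T(1) by simp
  qed
  \<comment> \<open>The substitute for \<open>exp (- i s B) W\<close>. Its velocity at 0 is
    generated by \<open>- imult B\<close>, whose pairing with \<open>B\<close> is -1, so it points
    inwards.\<close>
  define c where "c = (\<lambda>W s. (\<chi> l. E l (- (\<i> * of_real s))) \<star> W)"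
  have c0: "c W 0 = W" for W by (simp add: c_def E_0 vec_eq_iff)
  have cd: "has_mderiv std_charts VC (c W) 0 (\<lambda>s. s *\<^sub>R rt W (- imult B))" for W
  proof (rule has_mderiv_vec)
    fix l
    have "has_mderiv std_charts std_charts (\<lambda>s. - (\<i> * complex_of_real s)) 0 (\<lambda>s. - (\<i> * of_real s))"
      unfolding has_mderiv_std_iff by (auto intro!: derivative_eq_intros)
    moreover have "has_mderiv std_charts \<kappa> (E l) (- (\<i> * complex_of_real 0)) (\<lambda>z. cscale z (B $ l))"
      using Ed0 by simp
    ultimately have "has_mderiv std_charts \<kappa> (\<lambda>s. E l (- (\<i> * complex_of_real s))) 0
        (\<lambda>s. cscale (- (\<i> * of_real s)) (B $ l))"
      by (rule has_mderiv_compose[OF good_std_charts good_std_charts])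
    moreover have "cscale (- (\<i> * of_real s)) (B $ l) = s *\<^sub>R (- imult (B $ l))" for s
      by (simp add: cscale_def)
    ultimately have "has_mderiv std_charts \<kappa> (\<lambda>s. E l (- (\<i> * complex_of_real s))) 0 (\<lambda>s. s *\<^sub>R (- imult (B $ l)))"
      by (simp only:)
    from has_mderiv_right_gmult[OF good_std_charts this, of "W $ l"]
    show "has_mderiv std_charts \<kappa> (\<lambda>s. c W s $ l) 0 (\<lambda>s. (s *\<^sub>R rt W (- imult B)) $ l)"
      by (simp add: c_def E_0 rt_def imult_vec_def linear_scale[OF linear_dR] linear_neg[OF linear_dR] del: scaleR_minus_right)
  qed
  have jB: "jpf (- imult B) = - B"
  proof -
    have "jp (0 + imult (- (B $ l))) = - (B $ l)" for l
      by (rule jp_eq[OF subspace_0[OF subspace_Lie] subspace_neg[OF subspace_Lie BL]])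
    then show ?thesis by (simp add: jpf_def imult_vec_def vec_eq_iff imult_minus)
  qed
  have BB: "fip B (- B) < 0"
  proof -
    have "fip B (- B) = fip (0 - B) B"
      using BL subspace_neg[OF subspace_Lie BL] by (subst fip_commute) auto
    also have "\<dots> = fip 0 B - fip B B" using BL subspace_0[OF subspace_Lie] by (intro fip_diff) auto
    also have "fip 0 B = 0" using ip_zero_left[OF BL] by (simp add: fip_def)
    finally show ?thesis using B by (simp add: normal_dir_def)
  qed
  have inside: "\<forall>\<^sub>F s in at_right 0. c W s \<in> interior \<Omega> \<inter> C" if "normal_dir W B" "W \<in> C" for W
  proof -
    have "\<forall>\<^sub>F s in at_right 0. c W s \<in> interior \<Omega>"
      using that(1) c0 cd BB unfolding normal_dir_def by (metis jB)
    moreover have "\<forall>\<^sub>F s in nhds 0. c W s \<in> C"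
      using has_mderivD(1)[OF cd[of W]] unfolding c0
      by (rule eventually_compose_filterlim[OF eventually_in_component[OF good_VC C that(2)]])
    then have "\<forall>\<^sub>F s in at_right 0. c W s \<in> C" by (rule filter_leD[OF at_within_le_nhds])
    ultimately show ?thesis by eventually_elim simp
  qed
  let ?U = "\<lambda>t. flow \<gamma> t \<star> U"
  have UC: "?U t \<in> C" for t
  proof -
    have "connected (range ?U)"
      by (intro connected_continuous_image continuous_on_fm continuous_flow[OF \<gamma>] continuous_on_const) auto
    moreover have "U \<in> range ?U" using flow_zero[OF \<gamma>, of U] by (metis rangeI)
    ultimately have "range ?U \<subseteq> C" using components_maximal[OF C] U(2) by blast
    then show ?thesis by blast
  qed
  have Im: "Im (S (?U t)) = Im (S U)" if "0 \<le> t" for t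
  proof (rule flow_recurrent[OF \<gamma>, of "\<lambda>U. Im (S U)"])
    show "continuous_on UNIV (\<lambda>U. Im (S U))" by (intro continuous_on_Im continuous_S)
    show "Im (S (?U s)) \<le> Im (S (?U t))" if "s \<le> t" for s t
      by (rule DERIV_nonneg_imp_nondecreasing[OF that])
         (use Im_flow_derivative[OF \<gamma>] flow_normal(3)[OF U(1) B \<gamma>] in blast)
  qed (rule that)
  \<comment> \<open>By the preceding step the whole forward orbit consists of maxima. If the
    derivative of \<open>Re S\<close> along \<open>B\<close> were negative, \<open>Im S\<close>
    would increase on the inward curve through one of them.\<close>
  have Re_nonneg: "0 \<le> Re (dS (?U t) (rt (?U t) B))" if t: "0 \<le> t" for t
  proof (rule ccontr)
    let ?W = "?U t"
    assume neg: "\<not> ?thesis"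
    have "dS ?W (rt ?W (- imult B)) = - (\<i> * dS ?W (rt ?W B))"
      by (simp add: linear_neg[OF linear_rt] rt_imult linear_neg[OF linear_dS] dS_imult)
    then have "((\<lambda>s. Im (S (c ?W s))) has_real_derivative - Re (dS ?W (rt ?W B))) (at 0)"
      using Im_S_curve[OF cd[of ?W]] by (simp add: c0)
    from DERIV_pos_inc_right[OF this] neg
    obtain d where d: "d > 0" "\<And>h. 0 < h \<Longrightarrow> h < d \<Longrightarrow> Im (S (c ?W 0)) < Im (S (c ?W (0 + h)))" by auto
    have "\<forall>\<^sub>F s in at_right 0. Im (S ?W) < Im (S (c ?W s))"
      unfolding eventually_at_right_field using d by (intro exI[of _ d]) (simp add: c0)
    from eventually_conj[OF inside[OF flow_normal(2)[OF U(1) B \<gamma>] UC] this]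
    obtain s where s: "c ?W s \<in> interior \<Omega> \<inter> C" "Im (S ?W) < Im (S (c ?W s))"
      using eventually_happens'[OF trivial_limit_at_right_real] by blast
    then have "c ?W s \<in> closure \<Omega>" using interior_subset closure_subset by blast
    then show False using max[of "c ?W s"] s Im[OF t] by simp
  qed
  have Re: "Re (S (?U t)) = Re (S U)" if "0 \<le> t" for t
  proof (rule flow_recurrent[OF \<gamma>, of "\<lambda>U. Re (S U)"])
    show "continuous_on UNIV (\<lambda>U. Re (S U))" by (intro continuous_on_Re continuous_S)
    show "Re (S (?U s)) \<le> Re (S (?U t))" if "0 \<le> s" "s \<le> t" for s t
      by (rule DERIV_nonneg_imp_nondecreasing[OF that(2)])
         (use Re_flow_derivative[OF \<gamma>] Re_nonneg that(1) in \<open>meson order_trans\<close>)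
  qed (rule that)
  \<comment> \<open>Recurrence covers nonnegative times only. That is enough: \<open>f\<close> is
    constant on the open interval from 0 to \<epsilon>, which accumulates at 0, and the identity
    theorem extends this to the disc.\<close>
  define f where "f = (\<lambda>z. S ((\<chi> l. E l z) \<star> U))"
  have "holo_on f (ball 0 \<epsilon>)"
    unfolding holo_on_def
  proof
    fix z :: complex assume "z \<in> ball 0 \<epsilon>"
    then obtain T where T: "\<And>l. has_mderiv std_charts \<kappa> (E l) z (T l)" "\<And>l v. T l (imult v) = imult (T l v)"
      using Ed by metis
    define T' where "T' = (\<lambda>v. \<chi> l. dR GC \<kappa> (U $ l) (E l z) (T l v))"
    have "has_mderiv std_charts VC (\<lambda>z. (\<chi> l. E l z) \<star> U) z T'"
      by (rule has_mderiv_vec) (simp add: T'_def has_mderiv_right_gmult[OF good_std_charts T(1)])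
    from has_mderiv_compose[OF good_std_charts good_VC this has_mderiv_dS]
    have "(f has_derivative (\<lambda>v. dS ((\<chi> l. E l z) \<star> U) (T' v))) (at z)"
      by (simp add: f_def has_mderiv_std_iff)
    moreover have "T' (imult v) = imult (T' v)" for v
      by (simp add: T'_def T(2) dR_imult imult_vec_def vec_eq_iff)
    ultimately show "\<exists>f'. (f has_derivative f') (at z) \<and> (\<forall>v. f' (imult v) = imult (f' v))"
      by (intro exI conjI) (auto simp: dS_imult imult_complex_def)
  qed
  then have fh: "f holomorphic_on ball 0 \<epsilon>" using holo_on_complex_iff by blast
  have freal: "f (of_real t) = S U" if "0 \<le> t" "t < \<epsilon>" for t
  proof -
    have "(\<chi> l. E l (of_real t)) = flow \<gamma> t" using Er that by (simp add: flow_def vec_eq_iff)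
    then show ?thesis using Re[OF that(1)] Im[OF that(1)] by (simp add: f_def complex_eq_iff)
  qed
  have fconst: "f z = S U" if z: "z \<in> ball 0 \<epsilon>" for z
  proof -
    let ?A = "complex_of_real ` {0<..<\<epsilon>}"
    have "(\<lambda>z. f z - S U) z = 0"
    proof (rule analytic_continuation[of "\<lambda>z. f z - S U" "ball 0 \<epsilon>" ?A 0])
      show "(\<lambda>z. f z - S U) holomorphic_on ball 0 \<epsilon>" by (intro holomorphic_intros fh)
      show "(0::complex) islimpt ?A"
        unfolding islimpt_approachable
      proof (intro allI impI)
        fix e :: real assume "e > 0"
        then have "min e \<epsilon> / 2 \<in> {0<..<\<epsilon>}" "min e \<epsilon> / 2 < e" using \<epsilon> by (auto simp: min_def)
        then show "\<exists>x'\<in>?A. x' \<noteq> 0 \<and> dist x' 0 < e"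
          by (intro bexI[of _ "complex_of_real (min e \<epsilon> / 2)"] imageI) (auto simp del: of_real_divide)
      qed
      show "f w - S U = 0" if "w \<in> ?A" for w using that freal by auto
    qed (use \<epsilon> z in auto)
    then show ?thesis by simp
  qed
  have "\<forall>\<^sub>F s in at_right 0. s < \<epsilon>"
    unfolding eventually_at_right_field using \<epsilon> by (intro exI[of _ \<epsilon>]) simp
  moreover have "\<forall>\<^sub>F s in at_right (0::real). 0 < s" by (rule eventually_at_right_less)
  ultimately have "\<forall>\<^sub>F s in at_right 0. c U s \<in> interior \<Omega> \<inter> C \<and> 0 < s \<and> s < \<epsilon>"
    using inside[OF B U(2)] by eventually_elim simp
  then obtain s where s: "c U s \<in> interior \<Omega> \<inter> C" "0 < s" "s < \<epsilon>"
    using eventually_happens'[OF trivial_limit_at_right_real] by blast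
  have "S (c U s) = f (- (\<i> * of_real s))" by (simp add: c_def f_def)
  also have "\<dots> = S U" using s by (intro fconst) (simp add: norm_mult)
  finally show ?thesis using s(1) by blast
qed

text \<open>Closedness of \<open>K\<close> is listed next to compactness because fields do not form
  an instance of the Hausdorff class. A maximum in the interior is used as it stands; one on the
  frontier is traded for an interior point with the same value.\<close>

lemma constant_on_component:
  assumes K: "compact K" "closed K" "\<Omega> \<subseteq> K" and C: "C \<in> components UNIV" "\<Omega> \<inter> C \<noteq> {}"
  shows "\<exists>c. \<forall>U\<in>C. S U = c"
proof -
  have "closed C" by (rule closed_components[OF closed_UNIV C(1)])
  then have "closed (closure \<Omega> \<inter> C)" by (intro closed_Int closed_closure)
  then have "compact (K \<inter> (closure \<Omega> \<inter> C))" by (rule compact_Int_closed[OF K(1)])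
  moreover have "closure \<Omega> \<subseteq> K" by (rule closure_minimal[OF K(3,2)])
  then have "K \<inter> (closure \<Omega> \<inter> C) = closure \<Omega> \<inter> C" by blast
  ultimately have cpt: "compact (closure \<Omega> \<inter> C)" by simp
  moreover have "closure \<Omega> \<inter> C \<noteq> {}" using C(2) closure_subset by blast
  moreover have "continuous_on (closure \<Omega> \<inter> C) (\<lambda>U. Im (S U))" by (intro continuous_on_Im continuous_S)
  ultimately obtain U where U: "U \<in> closure \<Omega>" "U \<in> C"
    and max: "\<And>W. W \<in> closure \<Omega> \<Longrightarrow> W \<in> C \<Longrightarrow> Im (S W) \<le> Im (S U)"
    using continuous_attains_sup by (metis IntE IntI)
  obtain p where p: "p \<in> interior \<Omega>" "p \<in> C" "S p = S U"
  proof (cases "U \<in> interior \<Omega>")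
    case False
    then have "U \<in> frontier \<Omega>" using U by (simp add: frontier_def)
    from boundary_maximum_moves_inside[OF C(1) this U(2) max] show ?thesis using that by blast
  qed (use U that in blast)
  have "\<forall>\<^sub>F x in nhds p. x \<in> interior \<Omega>" using p by (intro eventually_nhds_in_open) auto
  with eventually_in_component[OF good_VC C(1) p(2)]
  have "\<forall>\<^sub>F x in nhds p. Im (S x) \<le> Im (S p)"
  proof eventually_elim
    case (elim x)
    then have "x \<in> closure \<Omega>" using interior_subset closure_subset by blast
    then show ?case using max elim p(3) by simp
  qed
  from Im_max_locally_constant[OF good_VC S_holo this]
  have loc: "\<forall>\<^sub>F x in nhds p. S x = S p" .
  have "S x = S p" if "x \<in> C" for x
    by (rule holo_identity_connected[OF good_VC S_holo in_components_connected[OF C(1)] p(2) that loc])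
  then show ?thesis by blast
qed

end

section \<open>Joining every field to the compact group\<close>

context complexified_group
begin

lemma one_param_path_connected:
  fixes V :: "'g ^ 'l::finite"
  assumes "\<And>l. one_param GC \<kappa> (Y l) (\<gamma> l)"
  shows "\<exists>T. connected T \<and> V \<in> T \<and> (\<chi> l. V $ l \<cdot> \<gamma> l 1) \<in> T"
proof (intro exI conjI)
  let ?p = "\<lambda>s. \<chi> l. V $ l \<cdot> \<gamma> l s"
  have "continuous_on UNIV ?p"
    by (intro continuous_on_vec_lambda continuous_on_gmult continuous_on_const one_param_continuous[OF assms])
  then show "connected (range ?p)" by (rule connected_continuous_image) simp
  have "?p 0 = V" by (simp add: one_param_zero[OF assms] vec_eq_iff)
  then show "V \<in> range ?p" by (rule range_eqI[OF sym])
  show "?p 1 \<in> range ?p" by blast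
qed

lemma exp_i_connected:
  fixes V :: "'g ^ 'l::finite"
  assumes W: "W \<in> link_fields (exp_i GC \<kappa> G)"
  shows "\<exists>T. connected T \<and> V \<in> T \<and> V \<star> W \<in> T"
proof -
  have "\<forall>l. \<exists>Y \<gamma>. one_param GC \<kappa> Y \<gamma> \<and> \<gamma> 1 = W $ l"
    using W unfolding link_fields_def exp_i_def is_lie_exp_def by blast
  then obtain Y \<gamma> where \<gamma>: "\<And>l. one_param GC \<kappa> (Y l) (\<gamma> l)" "\<And>l. \<gamma> l 1 = W $ l" by metis
  from one_param_path_connected[OF \<gamma>(1), of V] show ?thesis by (simp add: \<gamma>(2) field_mult_def)
qed

text \<open>The path s \<mapsto> V exp(i s X) deforms the polar form to its factor in
  \<open>G\<close>, so every component of the space of fields meets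
  \<open>link_fields G\<close>.\<close>

lemma polar_connected:
  fixes U :: "'g ^ 'l::finite"
  shows "\<exists>V\<in>link_fields G. \<exists>T. connected T \<and> V \<in> T \<and> U \<in> T"
proof -
  have "\<forall>l. \<exists>V W. V \<in> G \<and> W \<in> exp_i GC \<kappa> G \<and> U $ l = V \<cdot> W"
  proof
    fix l
    have "\<exists>!(V, Y). V \<in> G \<and> Y \<in> Lie \<and> (\<exists>W. is_lie_exp GC \<kappa> (imult Y) W \<and> U $ l = V \<cdot> W)"
      using complexification unfolding complexification_def by blast
    then obtain V Y W where "V \<in> G" "Y \<in> Lie" "is_lie_exp GC \<kappa> (imult Y) W" "U $ l = V \<cdot> W" by auto
    then show "\<exists>V W. V \<in> G \<and> W \<in> exp_i GC \<kappa> G \<and> U $ l = V \<cdot> W" unfolding exp_i_def by blast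
  qed
  then obtain V W where VW: "\<And>l. V l \<in> G" "\<And>l. W l \<in> exp_i GC \<kappa> G" "\<And>l. U $ l = V l \<cdot> W l" by metis
  have "(\<chi> l. W l) \<in> link_fields (exp_i GC \<kappa> G)" using VW(2) by (simp add: link_fields_def)
  from exp_i_connected[OF this, of "\<chi> l. V l"]
  have "\<exists>T. connected T \<and> (\<chi> l. V l) \<in> T \<and> U \<in> T" by (simp add: field_mult_def VW(3)[symmetric])
  moreover have "(\<chi> l. V l) \<in> link_fields G" using VW(1) by (simp add: link_fields_def)
  ultimately show ?thesis by blast
qed

end

text \<open>A locally constant action has zero drift, so for disconnected \<open>G\<close> the
  constant may differ between components; the second conjunct accounts for this.\<close>

theorem theorem3p5:
  fixes GC :: "('g::t2_space) monoid"
    and \<kappa> :: "('g, complex ^ 'm::finite) charts"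
    and G :: "'g set"
    and m :: "'g \<Rightarrow> complex ^ 'm \<Rightarrow> complex ^ 'm \<Rightarrow> real"
    and X :: "'m \<Rightarrow> complex ^ 'm"
    and d :: nat
    and Ns :: "nat \<Rightarrow> nat"
    and link :: "'l::finite \<Rightarrow> (nat \<Rightarrow> nat) \<times> nat"
    and S :: "'g ^ 'l \<Rightarrow> complex"
    and \<Omega>\<^sub>I \<Omega> :: "('g ^ 'l) set"
    and n :: "'g ^ 'l \<Rightarrow> (complex ^ 'm) ^ 'l"
  assumes complexification: "complexification GC \<kappa> G"
    and metric: "bi_invariant_metric GC \<kappa> G m"
    and basis: "span (range X) = lie_algebra GC \<kappa> G"
      "\<And>a b. m \<one>\<^bsub>GC\<^esub> (X a) (X b) = (if a = b then 1 else 0)"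
    and lattice: "\<And>i. i \<le> d \<Longrightarrow> 0 < Ns i" "bij_betw link UNIV (links d Ns)"
    and S_holo: "holo_map (vec_charts \<kappa>) std_charts S"
    and \<Omega>\<^sub>I_domain: "\<Omega>\<^sub>I \<noteq> {}" "connected \<Omega>\<^sub>I"
      "openin (top_of_set (link_fields (exp_i GC \<kappa> G))) \<Omega>\<^sub>I"
    and \<Omega>\<^sub>I_bounded: "riemann_bounded (vec_charts \<kappa>) (metric_N GC \<kappa> G m) \<Omega>\<^sub>I"
    and \<Omega>\<^sub>I_simply_connected: "simply_connected \<Omega>\<^sub>I"
    and \<Omega>_def: "\<Omega> = {field_mult GC V W | V W. V \<in> link_fields G \<and> W \<in> \<Omega>\<^sub>I}"
    and normal: "\<And>U. U \<in> frontier \<Omega> \<Longrightarrow>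
      outer_unit_normal (vec_charts \<kappa>) (metric_N GC \<kappa> G m) \<Omega> U (n U)"
    and inward: "\<And>U. U \<in> frontier \<Omega> \<Longrightarrow>
      metric_N GC \<kappa> G m U (velocity_field GC \<kappa> X S U) (n U) \<le> 0"
  shows "(connected G \<longrightarrow> (\<exists>c. \<forall>U. S U = c)) \<and>
    (\<forall>C\<in>components (UNIV :: ('g ^ 'l) set). \<exists>c. \<forall>U\<in>C. S U = c)"
proof -
  interpret complexified_group GC \<kappa> G m X
    by unfold_locales (rule complexification metric basis)+
  interpret inward_drift GC \<kappa> G m X S \<Omega> n
  proof
    show "V \<star> U \<in> \<Omega>" if V: "V \<in> link_fields G" and U: "U \<in> \<Omega>" for V U
    proof -
      obtain V' W where "U = V' \<star> W" "V' \<in> link_fields G" "W \<in> \<Omega>\<^sub>I" using U unfolding \<Omega>_def by blast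
      then have "V \<star> U = (V \<star> V') \<star> W" "V \<star> V' \<in> link_fields G" "W \<in> \<Omega>\<^sub>I"
        using V by (simp_all add: fm_assoc fm_link)
      then show ?thesis unfolding \<Omega>_def by blast
    qed
  qed (fact S_holo normal inward)+
  obtain C0 :: "'l \<Rightarrow> 'g set" where C0: "\<And>l. compact (C0 l)" "\<And>U l. U \<in> \<Omega>\<^sub>I \<Longrightarrow> U $ l \<in> C0 l"
    using riemann_bounded_in_compact[OF \<Omega>\<^sub>I_bounded] by blast
  \<comment> \<open>Each link of a field in \<Omega> is an element of \<open>G\<close> times an
    element of a compact set that contains this link of all fields in
    \<open>\<Omega>\<^sub>I\<close>.\<close>
  define K where "K = {U :: 'g ^ 'l. \<forall>l. U $ l \<in> (\<lambda>(x, y). x \<cdot> y) ` (G \<times> C0 l)}"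
  have c: "compact ((\<lambda>(x, y). x \<cdot> y) ` (G \<times> C0 l))" for l
  proof (rule compact_continuous_image[OF _ compact_Times[OF compact_G C0(1)]])
    show "continuous_on (G \<times> C0 l) (\<lambda>(x, y). x \<cdot> y)"
      using holo_mult unfolding holo_map_def using continuous_on_subset by blast
  qed
  have K: "compact K" "closed K"
    unfolding K_def by (rule compact_vec[OF c], rule closed_vec[OF compact_imp_closed[OF c]])
  have \<Omega>K: "\<Omega> \<subseteq> K"
  proof
    fix U assume "U \<in> \<Omega>"
    then obtain V W where VW: "U = V \<star> W" "V \<in> link_fields G" "W \<in> \<Omega>\<^sub>I" unfolding \<Omega>_def by blast
    have "U $ l \<in> (\<lambda>(x, y). x \<cdot> y) ` (G \<times> C0 l)" for l
      using VW C0(2)[OF VW(3), of l] by (intro image_eqI[of _ _ "(V $ l, W $ l)"]) (auto simp: link_fields_def)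
    then show "U \<in> K" by (simp add: K_def)
  qed
  have comp: "\<exists>c. \<forall>U\<in>C. S U = c" if C: "C \<in> components (UNIV :: ('g ^ 'l) set)" for C
  proof (rule constant_on_component[OF K \<Omega>K C])
    \<comment> \<open>A field of \<open>C\<close> is joined to some \<open>V\<close> in
      \<open>link_fields G\<close> by its polar path, and \<open>V\<close> is joined to
      \<open>V \<star> W\<close> for any \<open>W\<close> in \<open>\<Omega>\<^sub>I\<close>; the
      latter lies in \<Omega>.\<close>
    obtain U where U: "U \<in> C" using in_components_nonempty[OF C] by blast
    obtain V T where V: "V \<in> link_fields G" "connected T" "V \<in> T" "U \<in> T" using polar_connected by blast
    have VC: "V \<in> C" using components_maximal[OF C V(2)] V U by blast
    obtain W where W: "W \<in> \<Omega>\<^sub>I" using \<Omega>\<^sub>I_domain(1) by blast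
    then have "W \<in> link_fields (exp_i GC \<kappa> G)" using openin_imp_subset[OF \<Omega>\<^sub>I_domain(3)] by blast
    then obtain T' where T': "connected T'" "V \<in> T'" "V \<star> W \<in> T'" using exp_i_connected by blast
    then have "V \<star> W \<in> C" using components_maximal[OF C T'(1)] VC by blast
    moreover have "V \<star> W \<in> \<Omega>" unfolding \<Omega>_def using V(1) W by blast
    ultimately show "\<Omega> \<inter> C \<noteq> {}" by blast
  qed
  \<comment> \<open>All polar paths end in the connected set \<open>link_fields G\<close>, so there
    is a single component.\<close>
  moreover have "\<exists>c. \<forall>U. S U = c" if G: "connected G"
  proof -
    have con: "connected (link_fields G :: ('g ^ 'l) set)"
      unfolding link_fields_def by (rule connected_vec[OF G])
    obtain C where C: "C \<in> components (UNIV :: ('g ^ 'l) set)" "link_fields G \<subseteq> C"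
      using exists_component_superset[OF subset_UNIV _ con] by blast
    have "U \<in> C" for U
    proof -
      obtain V T where V: "V \<in> link_fields G" "connected T" "V \<in> T" "U \<in> T" using polar_connected by blast
      then show ?thesis using components_maximal[OF C(1) V(2)] C(2) by blast
    qed
    then show ?thesis using comp[OF C(1)] by blast
  qed
  ultimately show ?thesis by blast
qed

end
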